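(* For every $\mu\in\mathscr{P}([0,1]\times\mathbb{P})$, $K(\mu)=\{\Lambda(\mu)\}$; that is, $\Lambda(\mu)$ is the unique solution $X\in\mathbb{P}$ of the generalized Karcher equation $$\int_{[0,1]\times\mathbb{P}}\ell_s(X^{-1/2}AX^{-1/2})\,d\mu(s,A)=0.$$
   Context: $E$ is a (possibly infinite-dimensional) complex Hilbert space, $S(E)$ the Banach space of bounded self-adjoint operators, and $\mathbb{P}\subseteq S(E)$ the cone of positive definite operators, $\mathbb{P}=\bigcup_{k\ge1}\{X\in S(E):\frac1kI\le X\le kI\}$, with the norm topology; $A\le B$ means $B-A$ is positive semidefinite. $\mathscr{P}([0,1]\times\mathbb{P})$ is the set of Borel probability measures $\mu$ on $[0,1]\times\mathbb{P}$ with bounded support: $\mu(\operatorname{supp}\mu)=1$ and $\operatorname{supp}\mu\subseteq[0,1]\times\{A:e^{-r}I\le A\le e^rI\}$ for some $r<\infty$. Operator-valued integrals are weak operator Pettis integrals: $\int g\,d\mu$ is the $T\in S(E)$ with $\langle Tx,y\rangle=\int\langle gx,y\rangle d\mu$ for all $x,y\in E$. For $s\in[0,1]$, $x>0$, $\ell_s(x)=\frac{x-1}{(1-s)x+s}$. $K(\mu)$ denotes the set of all solutions $X\in\mathbb{P}$ of $\int_{[0,1]\times\mathbb{P}}\ell_s(X^{-1/2}AX^{-1/2})\,d\mu(s,A)=0$. For $s,t\in[0,1]$, $x>0$ let $$f_{s,t}(x)=\frac{[(1-t)(1-s)+t]x+s(1-t)}{(1-t)(1-s)x+t+s(1-t)},\qquad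 M_{s,t}(X,A)=X^{1/2}f_{s,t}(X^{-1/2}AX^{-1/2})X^{1/2}$$ for $X,A\in\mathbb{P}$. For $t\in(0,1]$, $L_t(\mu)$ is the unique solution $X\in\mathbb{P}$ of $X=\int_{[0,1]\times\mathbb{P}}M_{s,t}(X,A)\,d\mu(s,A)$. The limit $\Lambda(\mu)=\lim_{t\to0+}L_t(\mu)\in\mathbb{P}$ exists in the strong operator topology and is called the $\mu$-weighted lambda operator mean. *)

theory Defs
  imports
    "HOL-Analysis.Analysis"
    "HOL-Probability.Probability_Measure"
    "HOL-Computational_Algebra.Polynomial"
begin

section \<open>Complex Hilbert spaces\<close>

text \<open>
  The library only knows real inner product spaces. A complex Hilbert space is a complete real
  inner product space with a complex scalar multiplication extending the real one and a
  sesquilinear form (linear in the first argument) whose real part is the real inner product.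
  Hence the norm and topology of the type are those of the complex inner product.
\<close>

class complex_hilbert = real_inner + complete_space +
  fixes scaleC :: "complex \<Rightarrow> 'a \<Rightarrow> 'a"  (infixr \<open>*\<^sub>C\<close> 75)
    and cinner :: "'a \<Rightarrow> 'a \<Rightarrow> complex"
  assumes scaleC_add_right: "a *\<^sub>C (x + y) = a *\<^sub>C x + a *\<^sub>C y"
    and scaleC_add_left: "(a + b) *\<^sub>C x = a *\<^sub>C x + b *\<^sub>C x"
    and scaleC_scaleC: "a *\<^sub>C (b *\<^sub>C x) = (a * b) *\<^sub>C x"
    and scaleC_of_real: "complex_of_real r *\<^sub>C x = r *\<^sub>R x"
    and cinner_commute: "cinner x y = cnj (cinner y x)"
    and cinner_add_left: "cinner (x + y) z = cinner x z + cinner y z"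
    and cinner_scaleC_left: "cinner (a *\<^sub>C x) y = a * cinner x y"
    and Re_cinner: "Re (cinner x y) = inner x y"

section \<open>Self-adjoint and positive definite operators\<close>

text \<open>
  Operators are taken in the library type of bounded real-linear maps; complex linearity is part
  of the definition of the self-adjoint operators. The operator norm does not depend on the
  scalar field.
\<close>

definition selfadjoint_ops :: "('a::complex_hilbert \<Rightarrow>\<^sub>L 'a) set" where
  "selfadjoint_ops = {T :: 'a \<Rightarrow>\<^sub>L 'a. (\<forall>c x. T (c *\<^sub>C x) = c *\<^sub>C T x) \<and> (\<forall>x y. cinner (T x) y = cinner x (T y))}"

text \<open>The condition on \<open>cinner (T x) x\<close> is on its real part, the imaginary part being zero for
  self-adjoint \<open>T\<close>.\<close>

definition pos_semidef :: "('a::complex_hilbert \<Rightarrow>\<^sub>L 'a) \<Rightarrow> bool" where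
  "pos_semidef T \<longleftrightarrow> T \<in> selfadjoint_ops \<and> (\<forall>x. 0 \<le> Re (cinner (T x) x))"

definition op_le :: "('a::complex_hilbert \<Rightarrow>\<^sub>L 'a) \<Rightarrow> ('a \<Rightarrow>\<^sub>L 'a) \<Rightarrow> bool"  (infix \<open>\<preceq>\<close> 50) where
  "A \<preceq> B \<longleftrightarrow> pos_semidef (B - A)"

definition posdef_ops :: "('a::complex_hilbert \<Rightarrow>\<^sub>L 'a) set" where
  "posdef_ops = (\<Union>k\<in>{1::nat..}.
     {X \<in> selfadjoint_ops. (1 / real k) *\<^sub>R id_blinfun \<preceq> X \<and> X \<preceq> real k *\<^sub>R id_blinfun})"

section \<open>Continuous functional calculus\<close>

definition blinfun_power :: "('a::real_normed_vector \<Rightarrow>\<^sub>L 'a) \<Rightarrow> nat \<Rightarrow> ('a \<Rightarrow>\<^sub>L 'a)" where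
  "blinfun_power T n = (((o\<^sub>L) T) ^^ n) id_blinfun"

definition poly_op :: "real poly \<Rightarrow> ('a::real_normed_vector \<Rightarrow>\<^sub>L 'a) \<Rightarrow> ('a \<Rightarrow>\<^sub>L 'a)" where
  "poly_op p T = (\<Sum>i\<le>degree p. coeff p i *\<^sub>R blinfun_power T i)"

text \<open>Only real points of the spectrum are recorded: the spectrum of a self-adjoint operator is
  real. A bounded real-linear inverse of a complex-linear map is automatically complex-linear.\<close>

definition real_spectrum :: "('a::real_normed_vector \<Rightarrow>\<^sub>L 'a) \<Rightarrow> real set" where
  "real_spectrum T = {r. \<nexists>S. S o\<^sub>L (T - r *\<^sub>R id_blinfun) = id_blinfun \<and>
                            (T - r *\<^sub>R id_blinfun) o\<^sub>L S = id_blinfun}"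

text \<open>For self-adjoint \<open>T\<close> and \<open>f\<close> continuous on the spectrum of \<open>T\<close>, the operator \<open>f(T)\<close> is
  the norm limit of \<open>p\<^sub>n(T)\<close> for any real polynomials \<open>p\<^sub>n\<close> converging to \<open>f\<close> uniformly on the
  spectrum.\<close>

definition fun_calc :: "(real \<Rightarrow> real) \<Rightarrow> ('a::complex_hilbert \<Rightarrow>\<^sub>L 'a) \<Rightarrow> ('a \<Rightarrow>\<^sub>L 'a)" where
  "fun_calc f T = (THE S. \<exists>p :: nat \<Rightarrow> real poly.
     uniform_limit (real_spectrum T) (\<lambda>n. poly (p n)) f sequentially \<and>
     (\<lambda>n. poly_op (p n) T) \<longlonglongrightarrow> S)"

definition op_powr :: "('a::complex_hilbert \<Rightarrow>\<^sub>L 'a) \<Rightarrow> real \<Rightarrow> ('a \<Rightarrow>\<^sub>L 'a)" where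
  "op_powr X a = fun_calc (\<lambda>x. x powr a) X"

section \<open>Measures and operator-valued integrals\<close>

definition measure_support :: "'b::topological_space measure \<Rightarrow> 'b set" where
  "measure_support \<mu> =
     {z \<in> space \<mu>. \<forall>U. open U \<and> z \<in> U \<longrightarrow> 0 < emeasure \<mu> (U \<inter> space \<mu>)}"

text \<open>The restriction of the Borel sets of the ambient space (product of the usual and the norm
  topology) is the Borel \<open>\<sigma>\<close>-algebra of the subspace.\<close>

definition bdd_prob_measures :: "(real \<times> ('a::complex_hilbert \<Rightarrow>\<^sub>L 'a)) measure set" where
  "bdd_prob_measures = {\<mu>.
     prob_space \<mu> \<and>
     sets \<mu> = sets (restrict_space borel ({0..1} \<times> posdef_ops)) \<and>
     emeasure \<mu> (measure_support \<mu>) = 1 \<and>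
     (\<exists>r::real. measure_support \<mu> \<subseteq>
        {0..1} \<times> {A. exp (- r) *\<^sub>R id_blinfun \<preceq> A \<and> A \<preceq> exp r *\<^sub>R id_blinfun})}"

definition has_pettis_integral ::
  "'b measure \<Rightarrow> ('b \<Rightarrow> ('a::complex_hilbert \<Rightarrow>\<^sub>L 'a)) \<Rightarrow> ('a \<Rightarrow>\<^sub>L 'a) \<Rightarrow> bool" where
  "has_pettis_integral \<mu> g T \<longleftrightarrow> T \<in> selfadjoint_ops \<and>
     (\<forall>x y. has_bochner_integral \<mu> (\<lambda>z. cinner (g z x) y) (cinner (T x) y))"

section \<open>Generalized Karcher equation and lambda operator mean\<close>

definition ell :: "real \<Rightarrow> real \<Rightarrow> real" where
  "ell s x = (x - 1) / ((1 - s) * x + s)"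

definition karcher_solutions ::
  "(real \<times> ('a::complex_hilbert \<Rightarrow>\<^sub>L 'a)) measure \<Rightarrow> ('a \<Rightarrow>\<^sub>L 'a) set" where
  "karcher_solutions \<mu> = {X \<in> posdef_ops.
     has_pettis_integral \<mu>
       (\<lambda>(s, A). fun_calc (ell s) (op_powr X (-1/2) o\<^sub>L A o\<^sub>L op_powr X (-1/2))) 0}"

definition mean_fun :: "real \<Rightarrow> real \<Rightarrow> real \<Rightarrow> real" where
  "mean_fun s t x = (((1 - t) * (1 - s) + t) * x + s * (1 - t)) /
                    ((1 - t) * (1 - s) * x + t + s * (1 - t))"

definition op_mean ::
  "real \<Rightarrow> real \<Rightarrow> ('a::complex_hilbert \<Rightarrow>\<^sub>L 'a) \<Rightarrow> ('a \<Rightarrow>\<^sub>L 'a) \<Rightarrow> ('a \<Rightarrow>\<^sub>L 'a)" where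
  "op_mean s t X A =
     op_powr X (1/2) o\<^sub>L
       fun_calc (mean_fun s t) (op_powr X (-1/2) o\<^sub>L A o\<^sub>L op_powr X (-1/2)) o\<^sub>L
     op_powr X (1/2)"

text \<open>Meaningful for \<open>0 < t \<le> 1\<close>, where the solution exists and is unique.\<close>

definition L_mean ::
  "real \<Rightarrow> (real \<times> ('a::complex_hilbert \<Rightarrow>\<^sub>L 'a)) measure \<Rightarrow> ('a \<Rightarrow>\<^sub>L 'a)" where
  "L_mean t \<mu> =
     (THE X. X \<in> posdef_ops \<and> has_pettis_integral \<mu> (\<lambda>(s, A). op_mean s t X A) X)"

definition lambda_mean ::
  "(real \<times> ('a::complex_hilbert \<Rightarrow>\<^sub>L 'a)) measure \<Rightarrow> ('a \<Rightarrow>\<^sub>L 'a)" where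
  "lambda_mean \<mu> =
     (THE Y. Y \<in> posdef_ops \<and>
        limitin strong_operator_topology (\<lambda>t. L_mean t \<mu>) Y (at_right 0))"

end

theory Submission
  imports Defs "HOL-Computational_Algebra.Fundamental_Theorem_Algebra"
begin

text \<open>
  Conjugating the Karcher equation by \<open>X\<^sup>1\<^sup>/\<^sup>2\<close> removes the square roots: with \<open>D = A - X\<close> and
  \<open>K = (1 - s) A + s X\<close>, the operator \<open>X\<^sup>1\<^sup>/\<^sup>2 \<ell>\<^sub>s(X\<^sup>-\<^sup>1\<^sup>/\<^sup>2 A X\<^sup>-\<^sup>1\<^sup>/\<^sup>2) X\<^sup>1\<^sup>/\<^sup>2\<close> is
  \<open>G\<^sub>s(A, X) = D - (1 - s) D K\<^sup>-\<^sup>1 D\<close> (lemma \<open>ell_sandwich\<close>).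
  Moreover \<open>f\<^sub>s\<^sub>,\<^sub>t = 1 + t \<ell>\<^sub>r\<close> with \<open>r = 1 - (1 - s)(1 - t)\<close>, so \<open>M\<^sub>s\<^sub>,\<^sub>t(X, A) = X + t G\<^sub>r(A, X)\<close>
  (lemma \<open>op_mean_eq\<close>).
  Hence \<open>L\<^sub>t(\<mu>)\<close> solves the Karcher equation for the weights \<open>s\<close> shifted to \<open>r\<close>, and the Karcher
  equation of \<open>\<mu>\<close> itself is the case \<open>t = 0\<close>. It remains to solve this one-parameter family
  of equations for \<open>t\<close> in \<open>[0,1]\<close> and to show that the solution depends continuously on \<open>t\<close>.

  The main tool is a variational formula. Completing the square gives
  \<open>\<langle>G\<^sub>s(A, X) v, v\<rangle> = min\<^sub>h (\<langle>A w, w\<rangle> - \<langle>X v, v\<rangle> - 2(1 - s) \<langle>X v, h\<rangle> + s(1 - s) \<langle>X h, h\<rangle>)\<close> with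
  \<open>w = v + (1 - s) h\<close> (lemmas \<open>karcher_form_ge\<close> and \<open>karcher_form_min\<close>). The expression is affine
  in \<open>A\<close> and in \<open>X\<close> and Lipschitz in \<open>s\<close>, uniformly up to both ends of \<open>[0,1]\<close>, so two values of
  \<open>G\<close> can be compared by inserting the minimiser of one into the formula for the other.

  Stability is a maximum principle. Let \<open>X\<close> and \<open>Y\<close> solve the equations with parameters \<open>t\<close> and
  \<open>u\<close>, and let \<open>c \<ge> 1\<close> be least with \<open>X \<le> c Y\<close>. If \<open>c > 1\<close>, then \<open>c Y - X\<close> is
  nonnegative but has no positive lower bound, so some unit vectors \<open>v\<close> are almost annihilated by it. At
  such \<open>v\<close> the formula bounds \<open>\<langle>\<integral>G(A, X) v, v\<rangle>\<close> by \<open>c \<langle>\<integral>G(A, Y) v, v\<rangle>\<close>, up to an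
  error \<open>O(|t - u|)\<close> and minus a gain \<open>(c - 1) \<delta>\<close> that comes from the scaling of \<open>Y\<close>. Both
  integrals vanish, so \<open>c - 1 = O(|t - u|)\<close> (lemma \<open>one_sided_stability\<close>). This yields
  uniqueness for each \<open>t\<close>, and shows that the solutions are Lipschitz in \<open>t\<close> for the operator norm.

  For \<open>t > 0\<close> the map \<open>X \<mapsto> X + t \<integral>G\<close> is monotone, preserves the order interval that
  contains the support of \<open>\<mu>\<close>, and contracts ratios: \<open>X \<le> c Y\<close> improves to
  \<open>X \<le> (1 + (c - 1) \<rho>) Y\<close> with \<open>\<rho> < 1\<close>. Iterating it from the two ends of the interval encloses
  a fixed point (lemma \<open>solution_exists_pos\<close>). As \<open>t\<close> tends to \<open>0\<close> these solutions form a Cauchy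
  family, and the limit solves the equation at \<open>t = 0\<close> (lemma \<open>solution_exists_zero\<close>). So \<open>L\<^sub>t(\<mu>)\<close>
  converges in norm, hence strongly, to the unique Karcher solution.

  Two foundations are needed: the continuous functional calculus, which rests on the bound
  \<open>\<parallel>p(T)\<parallel> \<le> sup |p|\<close> over the spectrum (lemma \<open>poly_op_norm_le\<close>), and the Riesz
  representation theorem, which turns weak integrals into operators.
\<close>

section \<open>Self-adjoint operators on a complex Hilbert space\<close>

instance complex_hilbert \<subseteq> banach ..

text \<open>
  Together with \<open>cinner_eq_Complex\<close> this lets the arguments below work with the real inner product;
  complex linearity of an operator becomes a statement about real inner products as well.
\<close>

lemma inner_scaleC_left:
  fixes x y :: "'a::complex_hilbert"
  shows "(c *\<^sub>C x) \<bullet> y = x \<bullet> (cnj c *\<^sub>C y)"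
proof -
  have "cinner x (cnj c *\<^sub>C y) = c * cinner x y"
    by (metis cinner_commute cinner_scaleC_left complex_cnj_cnj complex_cnj_mult)
  then show ?thesis
    by (metis Re_cinner cinner_scaleC_left)
qed

lemma cinner_eq_Complex:
  fixes x y :: "'a::complex_hilbert"
  shows "cinner x y = Complex (x \<bullet> y) (x \<bullet> (\<i> *\<^sub>C y))"
proof -
  have "cinner x (\<i> *\<^sub>C y) = - \<i> * cinner x y"
    by (metis cinner_commute cinner_scaleC_left complex_cnj_cnj complex_cnj_i complex_cnj_mult)
  then have "x \<bullet> (\<i> *\<^sub>C y) = Im (cinner x y)"
    by (metis Re_cinner Re_i_times minus_mult_left uminus_complex.sel(1) minus_minus)
  then show ?thesis
    by (simp add: Re_cinner complex_eq_iff)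
qed

lemma selfadjoint_scaleC: "T \<in> selfadjoint_ops \<Longrightarrow> T (c *\<^sub>C x) = c *\<^sub>C T x"
  by (simp add: selfadjoint_ops_def)

lemma selfadjoint_inner: "T \<in> selfadjoint_ops \<Longrightarrow> T x \<bullet> y = x \<bullet> T y"
  unfolding selfadjoint_ops_def by (metis (mono_tags, lifting) Re_cinner mem_Collect_eq)

text \<open>
  Both conditions are tested against a vector \<open>y\<close>, so they pass to weak limits and weak integrals.
\<close>

lemma selfadjointI:
  fixes T :: "'a::complex_hilbert \<Rightarrow>\<^sub>L 'a"
  assumes sym: "\<And>x y. T x \<bullet> y = x \<bullet> T y"
    and lin: "\<And>c x y. T (c *\<^sub>C x) \<bullet> y = T x \<bullet> (cnj c *\<^sub>C y)"
  shows "T \<in> selfadjoint_ops"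
proof -
  have l: "T (c *\<^sub>C x) = c *\<^sub>C T x" for c x
  proof -
    have "T (c *\<^sub>C x) \<bullet> y = (c *\<^sub>C T x) \<bullet> y" for y
      by (simp only: lin inner_scaleC_left)
    then show ?thesis using vector_eq_rdot by blast
  qed
  show ?thesis
    unfolding selfadjoint_ops_def
    by (simp add: l cinner_eq_Complex sym)
qed

lemma selfadjoint_zero: "0 \<in> selfadjoint_ops"
  by (rule selfadjointI) auto

lemma selfadjoint_id: "id_blinfun \<in> selfadjoint_ops"
  by (rule selfadjointI) (auto simp: inner_scaleC_left)

lemma selfadjoint_add: "S \<in> selfadjoint_ops \<Longrightarrow> T \<in> selfadjoint_ops \<Longrightarrow> S + T \<in> selfadjoint_ops"
  by (rule selfadjointI)
    (auto simp: selfadjoint_inner selfadjoint_scaleC inner_scaleC_left blinfun.add_left inner_add_left inner_add_right)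

lemma selfadjoint_scaleR: "T \<in> selfadjoint_ops \<Longrightarrow> r *\<^sub>R T \<in> selfadjoint_ops"
  by (rule selfadjointI)
    (auto simp: selfadjoint_inner selfadjoint_scaleC inner_scaleC_left blinfun.scaleR_left)

lemma selfadjoint_diff: "S \<in> selfadjoint_ops \<Longrightarrow> T \<in> selfadjoint_ops \<Longrightarrow> S - T \<in> selfadjoint_ops"
  using selfadjoint_add[of S "(-1) *\<^sub>R T"] selfadjoint_scaleR[of T "-1"] by simp

lemma selfadjoint_compose_commute:
  assumes "S \<in> selfadjoint_ops" "T \<in> selfadjoint_ops" "S o\<^sub>L T = T o\<^sub>L S"
  shows "S o\<^sub>L T \<in> selfadjoint_ops"
proof (rule selfadjointI)
  fix x y
  show "(S o\<^sub>L T) x \<bullet> y = x \<bullet> (S o\<^sub>L T) y"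
    using arg_cong[OF assms(3), of "\<lambda>U. blinfun_apply U y"] by (simp add: selfadjoint_inner assms(1,2))
qed (simp add: selfadjoint_scaleC assms inner_scaleC_left)

lemma selfadjoint_sandwich:
  "S \<in> selfadjoint_ops \<Longrightarrow> T \<in> selfadjoint_ops \<Longrightarrow> S o\<^sub>L T o\<^sub>L S \<in> selfadjoint_ops"
  by (rule selfadjointI) (auto simp: selfadjoint_inner selfadjoint_scaleC inner_scaleC_left)

lemma selfadjoint_inverse:
  assumes K: "K \<in> selfadjoint_ops" and KJ: "K o\<^sub>L J = id_blinfun"
  shows "J \<in> selfadjoint_ops"
proof -
  have KJ': "K (J x) = x" for x
    by (metis KJ blinfun_apply_blinfun_compose blinfun_apply_id_blinfun id_apply)
  have sym: "J x \<bullet> y = x \<bullet> J y" for x y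
    using selfadjoint_inner[OF K, of "J x" "J y"] by (simp add: KJ')
  have "J (c *\<^sub>C x) \<bullet> y = J x \<bullet> (cnj c *\<^sub>C y)" for c x y
  proof -
    have "J (c *\<^sub>C x) \<bullet> y = x \<bullet> (cnj c *\<^sub>C J y)"
      by (simp add: sym inner_scaleC_left)
    also have "\<dots> = J x \<bullet> K (cnj c *\<^sub>C J y)"
      using selfadjoint_inner[OF K, of "J x" "cnj c *\<^sub>C J y"] by (simp add: KJ')
    also have "\<dots> = J x \<bullet> (cnj c *\<^sub>C y)"
      by (simp add: selfadjoint_scaleC[OF K] KJ')
    finally show ?thesis .
  qed
  with sym show ?thesis by (rule selfadjointI)
qed

lemma selfadjoint_limit:
  fixes T :: "nat \<Rightarrow> ('a::complex_hilbert \<Rightarrow>\<^sub>L 'a)"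
  assumes T: "\<And>n. T n \<in> selfadjoint_ops" and lim: "T \<longlonglongrightarrow> S"
  shows "S \<in> selfadjoint_ops"
proof (rule selfadjointI)
  have l: "(\<lambda>n. T n x \<bullet> y) \<longlonglongrightarrow> S x \<bullet> y" for x y
    by (intro tendsto_inner blinfun.tendsto tendsto_const lim)
  have r: "(\<lambda>n. x \<bullet> T n y) \<longlonglongrightarrow> x \<bullet> S y" for x y
    by (intro tendsto_inner blinfun.tendsto tendsto_const lim)
  show "S x \<bullet> y = x \<bullet> S y" for x y
    using l[of x y] r[of x y] LIMSEQ_unique by (simp add: selfadjoint_inner T)
  show "S (c *\<^sub>C x) \<bullet> y = S x \<bullet> (cnj c *\<^sub>C y)" for c x y
    using l[of "c *\<^sub>C x" y] l[of x "cnj c *\<^sub>C y"] LIMSEQ_unique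
    by (simp add: selfadjoint_scaleC T inner_scaleC_left)
qed

text \<open>
  Polarisation: the form is evaluated at \<open>x + T x\<close>, where the mixed terms add up to \<open>2 \<parallel>T x\<parallel>\<^sup>2\<close>.
\<close>

lemma selfadjoint_eq_zeroI:
  assumes T: "T \<in> selfadjoint_ops" and z: "\<And>v. T v \<bullet> v = 0"
  shows "T = 0"
proof (rule blinfun_eqI)
  fix x
  have "T (x + T x) \<bullet> (x + T x) = T x \<bullet> x + T (T x) \<bullet> T x + 2 * (T x \<bullet> T x)"
    using T by (simp add: blinfun.add_right inner_add_left inner_add_right selfadjoint_inner)
  then show "T x = blinfun_apply 0 x" by (simp add: z)
qed

text \<open>
  The order interval \<open>a I \<le> T \<le> b I\<close>, phrased with the real quadratic form.
\<close>

definition form_between :: "real \<Rightarrow> real \<Rightarrow> ('a::complex_hilbert \<Rightarrow>\<^sub>L 'a) \<Rightarrow> bool" where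
  "form_between a b T \<longleftrightarrow>
     T \<in> selfadjoint_ops \<and> (\<forall>x. a * (x \<bullet> x) \<le> T x \<bullet> x \<and> T x \<bullet> x \<le> b * (x \<bullet> x))"

lemma op_le_iff:
  assumes "A \<in> selfadjoint_ops" "B \<in> selfadjoint_ops"
  shows "A \<preceq> B \<longleftrightarrow> (\<forall>x. A x \<bullet> x \<le> B x \<bullet> x)"
  using assms by (simp add: op_le_def pos_semidef_def selfadjoint_diff Re_cinner blinfun.diff_left inner_diff_left)

lemma op_le_form_between:
  "a *\<^sub>R id_blinfun \<preceq> T \<and> T \<preceq> b *\<^sub>R id_blinfun \<longleftrightarrow> form_between a b T"
proof (cases "T \<in> selfadjoint_ops")
  case True
  then show ?thesis
    by (auto simp: form_between_def op_le_iff selfadjoint_id selfadjoint_scaleR blinfun.scaleR_left)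
next
  case False
  have "T \<in> selfadjoint_ops" if "a *\<^sub>R id_blinfun \<preceq> T"
    using that selfadjoint_add[of "T - a *\<^sub>R id_blinfun" "a *\<^sub>R id_blinfun"]
    by (simp add: op_le_def pos_semidef_def selfadjoint_id selfadjoint_scaleR)
  with False show ?thesis by (auto simp: form_between_def)
qed

lemma form_between_mono:
  "form_between a b T \<Longrightarrow> a' \<le> a \<Longrightarrow> b \<le> b' \<Longrightarrow> form_between a' b' T"
  unfolding form_between_def
  using mult_right_mono[OF _ inner_ge_zero] by (blast intro: order_trans)

lemma posdef_iff: "X \<in> posdef_ops \<longleftrightarrow> (\<exists>a>0. \<exists>b. form_between a b X)"
proof
  assume "X \<in> posdef_ops"
  then obtain k :: nat where "k \<ge> 1" "form_between (1/real k) (real k) X"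
    unfolding posdef_ops_def using op_le_form_between by blast
  then show "\<exists>a>0. \<exists>b. form_between a b X"
    by (intro exI[of _ "1 / real k"] conjI exI[of _ "real k"]) auto
next
  assume "\<exists>a>0. \<exists>b. form_between a b X"
  then obtain a b where ab: "a > 0" "form_between a b X" by blast
  obtain k :: nat where k: "real k > max 1 (max (1/a) b)"
    using reals_Archimedean2 by blast
  then have "1 / real k \<le> a" using ab
    by (simp add: field_simps)
  then have "form_between (1/real k) (real k) X"
    using form_between_mono[OF ab(2)] k by simp
  with op_le_form_between[of "1/real k" X "real k"] k show "X \<in> posdef_ops"
    unfolding posdef_ops_def form_between_def by (auto intro!: bexI[of _ k])
qed

lemma form_between_selfadjoint: "form_between a b T \<Longrightarrow> T \<in> selfadjoint_ops"
  by (simp add: form_between_def)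

lemma form_between_ge: "form_between a b T \<Longrightarrow> a * (x \<bullet> x) \<le> T x \<bullet> x"
  by (simp add: form_between_def)

lemma form_between_le: "form_between a b T \<Longrightarrow> T x \<bullet> x \<le> b * (x \<bullet> x)"
  by (simp add: form_between_def)

text \<open>
  The Cauchy--Schwarz inequality for the semidefinite form \<open>\<langle>T x, y\<rangle>\<close> at \<open>y = T x\<close>; it is used both to
  bound the norm and to conclude that \<open>T x\<close> is small when \<open>\<langle>T x, x\<rangle>\<close> is.
\<close>

lemma form_between_square:
  assumes T: "form_between 0 b T"
  shows "T x \<bullet> T x \<le> b * (T x \<bullet> x)"
proof -
  let ?p = "T x \<bullet> T x" and ?q = "T x \<bullet> x" and ?r = "T (T x) \<bullet> T x"
  have q: "0 \<le> ?q" and r: "0 \<le> ?r" "?r \<le> b * ?p"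
    using T by (auto simp: form_between_def)
  have sym: "T (T x) \<bullet> x = ?p"
    using T by (metis form_between_def selfadjoint_inner)
  have form: "0 \<le> u\<^sup>2 * ?q - 2 * u * w * ?p + w\<^sup>2 * ?r" for u w :: real
  proof -
    have "0 \<le> T (u *\<^sub>R x - w *\<^sub>R T x) \<bullet> (u *\<^sub>R x - w *\<^sub>R T x)"
      using T by (auto simp: form_between_def)
    also have "\<dots> = u\<^sup>2 * ?q - 2 * u * w * ?p + w\<^sup>2 * ?r"
      by (simp add: blinfun.diff_right blinfun.scaleR_right inner_diff_left inner_diff_right sym
          power2_eq_square algebra_simps)
    finally show ?thesis .
  qed
  show ?thesis
  proof (cases "?p = 0")
    case True
    have "T x = 0" using True by simp
    then show ?thesis by simp
  next
    case False
    then have p: "?p > 0" by (metis inner_ge_zero less_eq_real_def)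
    have "0 \<le> b * ?p" using r by linarith
    then have b: "0 \<le> b" using p by (simp add: zero_le_mult_iff)
    have "0 \<le> b\<^sup>2 * ?q - 2 * b * 1 * ?p + 1\<^sup>2 * (b * ?p)"
      using form[of b 1] r by (simp)
    then have 1: "0 \<le> b * (b * ?q - ?p)" by (simp add: power2_eq_square algebra_simps)
    show ?thesis
    proof (cases "b = 0")
      case True
      have "?r = 0" using r True by simp
      then have "0 \<le> ?q - 2 * w * ?p" for w using form[of 1 w] by simp
      from this[of "(?q + 1) / ?p"] p q False have False by (simp add: divide_simps)
      then show ?thesis ..
    qed (use 1 b in \<open>auto simp: zero_le_mult_iff\<close>)
  qed
qed

lemma form_between_norm_apply:
  assumes T: "form_between 0 b T"
  shows "norm (T x) \<le> b * norm x"
proof (cases "T x = 0")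
  case True
  have "0 \<le> b * (x \<bullet> x)" using form_between_ge[OF T, of x] form_between_le[OF T, of x] by simp
  then show ?thesis using True using inner_gt_zero_iff[of x] True
    by (cases "x = 0") (auto simp: zero_le_mult_iff simp del: inner_gt_zero_iff)
next
  case False
  have "T x \<bullet> x \<le> b * (x \<bullet> x)" using T by (auto simp: form_between_def)
  moreover have "0 < x \<bullet> x" using False by (auto simp: blinfun.zero_right)
  moreover have "0 \<le> T x \<bullet> x" using T by (auto simp: form_between_def)
  ultimately have b: "0 \<le> b" by (smt (verit) zero_le_mult_iff)
  have "norm (T x) * norm (T x) \<le> b * (norm (T x) * norm x)"
    using form_between_square[OF T, of x] norm_cauchy_schwarz[of "T x" x] b
    by (smt (verit) mult_left_mono power2_eq_square power2_norm_eq_inner)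
  with False show ?thesis by simp
qed

lemma form_between_norm: "form_between 0 b T \<Longrightarrow> 0 \<le> b \<Longrightarrow> norm T \<le> b"
  by (rule norm_blinfun_bound) (auto simp: form_between_norm_apply)

lemma form_between_limit:
  assumes T: "\<And>n. form_between a b (T n)" and lim: "T \<longlonglongrightarrow> S"
  shows "form_between a b S"
proof -
  have l: "(\<lambda>n. T n x \<bullet> x) \<longlonglongrightarrow> S x \<bullet> x" for x
    by (intro tendsto_inner blinfun.tendsto tendsto_const lim)
  show ?thesis
    unfolding form_between_def
  proof (intro conjI allI)
    show "S \<in> selfadjoint_ops"
      using selfadjoint_limit[OF form_between_selfadjoint[OF T] lim] .
    show "a * (x \<bullet> x) \<le> S x \<bullet> x" for x
      by (rule LIMSEQ_le_const[OF l]) (use form_between_ge[OF T] in auto)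
    show "S x \<bullet> x \<le> b * (x \<bullet> x)" for x
      by (rule LIMSEQ_le_const2[OF l]) (use form_between_le[OF T] in auto)
  qed
qed

lemma form_between_add:
  "form_between a b S \<Longrightarrow> form_between a' b' T \<Longrightarrow> form_between (a + a') (b + b') (S + T)"
  unfolding form_between_def
  by (auto simp: selfadjoint_add blinfun.add_left inner_add_left distrib_right add_mono)

lemma form_between_scaleR:
  "form_between a b S \<Longrightarrow> 0 \<le> r \<Longrightarrow> form_between (r * a) (r * b) (r *\<^sub>R S)"
  unfolding form_between_def
  by (auto simp: selfadjoint_scaleR blinfun.scaleR_left mult.assoc mult_left_mono)

lemma form_between_id: "form_between r r (r *\<^sub>R id_blinfun)"
  by (auto simp: form_between_def selfadjoint_id selfadjoint_scaleR blinfun.scaleR_left)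

section \<open>Riesz representation and inverses of coercive operators\<close>

text \<open>
  The representing vector minimises \<open>J x = \<parallel>x\<parallel>\<^sup>2 - 2 f x\<close>: by the parallelogram identity minimising
  sequences are Cauchy, and the first variation of \<open>J\<close> at the minimum vanishes.
\<close>

theorem riesz_representation:
  fixes f :: "'a::{real_inner,complete_space} \<Rightarrow> real"
  assumes f: "bounded_linear f"
  shows "\<exists>z. \<forall>x. f x = z \<bullet> x"
proof -
  interpret f: bounded_linear f by fact
  define J where "J x = x \<bullet> x - 2 * f x" for x
  obtain B where B: "\<And>x. norm (f x) \<le> norm x * B" using f.bounded by blast
  have lower: "- B\<^sup>2 \<le> J x" for x
  proof -
    have "f x \<le> norm x * B" using B[of x] by simp
    moreover have "0 \<le> (norm x - B)\<^sup>2" by simp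
    ultimately show ?thesis
      by (simp add: J_def power2_diff power2_norm_eq_inner)
  qed
  then have bdd: "bdd_below (range J)" by (auto simp: bdd_below_def)
  define m where "m = Inf (range J)"
  have m: "m \<le> J x" for x unfolding m_def by (rule cInf_lower[OF _ bdd]) simp
  have ex: "\<exists>x. J x < m + inverse (real (Suc n))" for n
    using cInf_lessD[of "range J" "m + inverse (real (Suc n))"] by (auto simp: m_def)
  then obtain x where x: "\<And>n. J (x n) < m + inverse (real (Suc n))" by metis
  have para: "(u - v) \<bullet> (u - v) = 2 * J u + 2 * J v - 4 * J ((1/2) *\<^sub>R (u + v))" for u v
    by (simp add: J_def f.scaleR f.add inner_diff_left inner_diff_right inner_add_left inner_add_right
        inner_commute algebra_simps)
  have "Cauchy x"
  proof (rule metric_CauchyI)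
    fix e :: real assume e: "0 < e"
    obtain N where N: "inverse (real (Suc N)) < e\<^sup>2 / 4"
      using reals_Archimedean[of "e\<^sup>2 / 4"] e by auto
    have "dist (x i) (x j) < e" if "i \<ge> N" "j \<ge> N" for i j
    proof -
      have i: "inverse (real (Suc i)) \<le> inverse (real (Suc N))" and
           j: "inverse (real (Suc j)) \<le> inverse (real (Suc N))"
        using that by (auto intro!: le_imp_inverse_le)
      have "(norm (x i - x j))\<^sup>2 < e\<^sup>2"
        using para[of "x i" "x j"] x[of i] x[of j] i j N m[of "(1/2) *\<^sub>R (x i + x j)"]
        unfolding power2_norm_eq_inner by linarith
      then show ?thesis using e by (simp add: dist_norm power2_less_imp_less)
    qed
    then show "\<exists>M. \<forall>i\<ge>M. \<forall>j\<ge>M. dist (x i) (x j) < e" by blast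
  qed
  then obtain z where z: "x \<longlonglongrightarrow> z" using Cauchy_convergent convergent_def by blast
  have "(\<lambda>n. J (x n)) \<longlonglongrightarrow> J z"
    unfolding J_def by (intro tendsto_intros z f.tendsto)
  moreover have "(\<lambda>n. m + inverse (real (Suc n))) \<longlonglongrightarrow> m + 0"
    by (intro tendsto_intros LIMSEQ_inverse_real_of_nat)
  ultimately have Jz: "J z \<le> m"
    using x by (intro LIMSEQ_le[of "\<lambda>n. J (x n)"]) (auto intro: less_imp_le)
  have "f h = z \<bullet> h" for h
  proof -
    define d where "d = z \<bullet> h - f h"
    define q where "q = h \<bullet> h"
    have q: "q \<ge> 0" by (simp add: q_def)
    have "J (z + r *\<^sub>R h) = J z + 2 * r * d + r\<^sup>2 * q" for r
      by (simp add: J_def d_def q_def f.add f.scaleR inner_add_left inner_add_right inner_commute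
          power2_eq_square algebra_simps)
    then have "0 \<le> 2 * r * d + r\<^sup>2 * q" for r using m[of "z + r *\<^sub>R h"] Jz by simp
    moreover define r where "r = - d / (q + 1)"
    ultimately have "0 \<le> 2 * r * d + r\<^sup>2 * q" by blast
    moreover have d: "d = - r * (q + 1)" using q by (simp add: r_def)
    ultimately have "r\<^sup>2 * (q + 2) \<le> 0" by (simp add: power2_eq_square algebra_simps)
    then have "r = 0" using q by (simp add: mult_le_0_iff)
    then show ?thesis using d by (simp add: d_def)
  qed
  then show ?thesis by blast
qed

text \<open>
  Solving \<open>K x = y\<close> means finding a fixed point of \<open>x \<mapsto> x - \<alpha> (K x - y)\<close>, and coercivity makes this map a
  contraction for small \<open>\<alpha>\<close>.
\<close>

lemma coercive_invertible:
  fixes K :: "'a::{real_inner,complete_space} \<Rightarrow>\<^sub>L 'a"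
  assumes c: "0 < c" and K: "\<And>x. c * (x \<bullet> x) \<le> K x \<bullet> x"
  shows "\<exists>J. K o\<^sub>L J = id_blinfun \<and> J o\<^sub>L K = id_blinfun"
proof -
  have low: "c * norm x \<le> norm (K x)" for x
  proof (cases "x = 0")
    case False
    have "c * norm x * norm x \<le> norm (K x) * norm x"
      using K[of x] norm_cauchy_schwarz[of "K x" x] by (simp add: power2_norm_eq_inner[symmetric] power2_eq_square)
    then show ?thesis using False by simp
  qed simp
  \<comment> \<open>The summand \<open>c\<close> makes \<open>N\<close> positive and \<open>c \<le> N\<close>; the value \<open>\<alpha> = c / N\<^sup>2\<close> below minimises the
    contraction constant \<open>1 - 2 \<alpha> c + \<alpha>\<^sup>2 N\<^sup>2\<close>.\<close>
  define N where "N = norm K + c"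
  have N: "0 < N" "c \<le> N" "norm K \<le> N" using c norm_ge_zero[of K] by (auto simp: N_def add_nonneg_pos)
  define k where "k = sqrt (1 - c\<^sup>2 / N\<^sup>2)"
  have cN: "0 < c\<^sup>2 / N\<^sup>2" "c\<^sup>2 / N\<^sup>2 \<le> 1" using N c by (auto simp: power_mono)
  have k: "0 \<le> k" "k < 1" "k\<^sup>2 = 1 - c\<^sup>2 / N\<^sup>2" using cN by (auto simp: k_def)
  define \<alpha> where "\<alpha> = c / N\<^sup>2"
  have contr: "norm (x - \<alpha> *\<^sub>R K x) \<le> k * norm x" for x
  proof -
    have "norm (K x) \<le> N * norm x"
      using norm_blinfun[of K x] N by (meson mult_right_mono norm_ge_zero order_trans)
    then have KN: "K x \<bullet> K x \<le> N\<^sup>2 * (x \<bullet> x)"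
      by (metis norm_ge_zero power2_norm_eq_inner power_mono power_mult_distrib)
    have "(norm (x - \<alpha> *\<^sub>R K x))\<^sup>2 = x \<bullet> x - 2 * \<alpha> * (K x \<bullet> x) + \<alpha>\<^sup>2 * (K x \<bullet> K x)"
      unfolding power2_norm_eq_inner
      by (simp add: inner_diff_left inner_diff_right inner_commute power2_eq_square algebra_simps)
    also have "\<dots> \<le> x \<bullet> x - 2 * \<alpha> * (c * (x \<bullet> x)) + \<alpha>\<^sup>2 * (N\<^sup>2 * (x \<bullet> x))"
      by (intro add_mono diff_mono order_refl mult_left_mono K KN) (use c in \<open>auto simp: \<alpha>_def\<close>)
    also have "\<dots> = k\<^sup>2 * (x \<bullet> x)"
    proof -
      have "\<alpha> * c = c\<^sup>2 / N\<^sup>2" "\<alpha>\<^sup>2 * N\<^sup>2 = c\<^sup>2 / N\<^sup>2"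
        using N by (auto simp: \<alpha>_def power2_eq_square)
      then have "k\<^sup>2 = 1 - 2 * (\<alpha> * c) + \<alpha>\<^sup>2 * N\<^sup>2" by (simp add: k(3))
      then show ?thesis by (simp only:) (simp add: algebra_simps)
    qed
    also have "\<dots> = (k * norm x)\<^sup>2" by (simp add: power_mult_distrib power2_norm_eq_inner)
    finally show ?thesis using k by (simp add: power2_le_iff_abs_le)
  qed
  have ex: "\<exists>x. K x = y" for y
  proof -
    have "\<exists>!x. x - \<alpha> *\<^sub>R (K x - y) = x"
    proof (rule banach_fix_type[OF k(1,2)], intro allI)
      fix u v
      show "dist (u - \<alpha> *\<^sub>R (K u - y)) (v - \<alpha> *\<^sub>R (K v - y)) \<le> k * dist u v"
        using contr[of "u - v"] by (simp add: dist_norm blinfun.diff_right algebra_simps)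
    qed
    then obtain x where "x - \<alpha> *\<^sub>R (K x - y) = x" by blast
    then show ?thesis using N c by (auto simp: \<alpha>_def)
  qed
  then obtain j where j: "\<And>y. K (j y) = y" by metis
  have inj: "x = y" if "K x = K y" for x y
    using low[of "x - y"] that c by (simp add: blinfun.diff_right mult_le_0_iff)
  have "bounded_linear j"
  proof (rule bounded_linear_intro[where K="1/c"])
    show "j (x + y) = j x + j y" for x y by (rule inj) (simp add: j blinfun.add_right)
    show "j (r *\<^sub>R x) = r *\<^sub>R j x" for r x by (rule inj) (simp add: j blinfun.scaleR_right)
    show "norm (j x) \<le> norm x * (1/c)" for x using low[of "j x"] c by (simp add: j field_simps)
  qed
  then have J: "Blinfun j x = j x" for x by (simp add: bounded_linear_Blinfun_apply)
  have "K o\<^sub>L Blinfun j = id_blinfun" "Blinfun j o\<^sub>L K = id_blinfun"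
    by (auto intro!: blinfun_eqI simp: J j intro: inj)
  then show ?thesis by blast
qed

section \<open>Polynomials of an operator\<close>

lemma poly_op_upto:
  "degree p \<le> n \<Longrightarrow> poly_op p T = (\<Sum>i\<le>n. coeff p i *\<^sub>R blinfun_power T i)"
  unfolding poly_op_def
  by (rule sum.mono_neutral_left) (auto simp: coeff_eq_0)

lemma poly_op_zero [simp]: "poly_op 0 T = 0"
  by (simp add: poly_op_def)

lemma poly_op_pCons: "poly_op (pCons a p) T = a *\<^sub>R id_blinfun + (T o\<^sub>L poly_op p T)"
proof -
  have "poly_op (pCons a p) T = (\<Sum>i\<le>Suc (degree p). coeff (pCons a p) i *\<^sub>R blinfun_power T i)"
    by (rule poly_op_upto) (rule degree_pCons_le)
  also have "\<dots> = a *\<^sub>R id_blinfun + (\<Sum>i\<le>degree p. coeff p i *\<^sub>R (T o\<^sub>L blinfun_power T i))"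
    unfolding sum.atMost_Suc_shift by (simp add: blinfun_power_def)
  also have "(\<Sum>i\<le>degree p. coeff p i *\<^sub>R (T o\<^sub>L blinfun_power T i)) = T o\<^sub>L poly_op p T"
    by (rule blinfun_eqI)
      (simp add: poly_op_def blinfun.sum_left blinfun.sum_right blinfun.scaleR_left blinfun.scaleR_right)
  finally show ?thesis .
qed

lemma poly_op_add: "poly_op (p + q) T = poly_op p T + poly_op q T"
  using poly_op_upto[of p "max (degree p) (degree q)" T] poly_op_upto[of q "max (degree p) (degree q)" T]
    poly_op_upto[of "p + q" "max (degree p) (degree q)" T] degree_add_le_max[of p q]
  by (simp add: scaleR_add_left sum.distrib)

lemma poly_op_smult: "poly_op (smult c p) T = c *\<^sub>R poly_op p T"
  using poly_op_upto[of "smult c p" "degree p" T] degree_smult_le[of c p]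
  by (simp add: poly_op_def scaleR_sum_right)

lemma poly_op_diff: "poly_op (p - q) T = poly_op p T - poly_op q T"
  using poly_op_add[of "p - q" q T] by (simp add: algebra_simps)

lemma poly_op_mult: "poly_op (p * q) T = poly_op p T o\<^sub>L poly_op q T"
proof (induction p)
  case (pCons a p)
  show ?case
    by (rule blinfun_eqI)
      (simp add: poly_op_add poly_op_smult poly_op_pCons pCons.IH blinfun.add_left blinfun.scaleR_left)
qed (auto intro!: blinfun_eqI)

lemma poly_op_commute: "poly_op p T o\<^sub>L poly_op q T = poly_op q T o\<^sub>L poly_op p T"
  by (simp flip: poly_op_mult add: mult.commute)

lemma poly_op_const: "poly_op [:c:] T = c *\<^sub>R id_blinfun"
  by (auto simp: poly_op_pCons intro!: blinfun_eqI simp: blinfun.add_left)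

lemma poly_op_linear: "poly_op [:c, d:] T = c *\<^sub>R id_blinfun + d *\<^sub>R T"
  by (auto simp: poly_op_pCons intro!: blinfun_eqI simp: blinfun.add_left blinfun.scaleR_left blinfun.scaleR_right)

lemma poly_op_selfadjoint: "T \<in> selfadjoint_ops \<Longrightarrow> poly_op p T \<in> selfadjoint_ops"
proof (induction p)
  case (pCons a p)
  have T: "T = poly_op [:0, 1:] T" by (simp add: poly_op_linear)
  have "T o\<^sub>L poly_op p T \<in> selfadjoint_ops"
    using pCons poly_op_commute[of "[:0,1:]" T p] T by (intro selfadjoint_compose_commute) auto
  then show ?case
    by (simp add: poly_op_pCons selfadjoint_add selfadjoint_scaleR selfadjoint_id)
qed (simp add: selfadjoint_zero)

section \<open>Polynomials and the spectrum\<close>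

definition invertible_op :: "('a::real_normed_vector \<Rightarrow>\<^sub>L 'a) \<Rightarrow> bool" where
  "invertible_op S \<longleftrightarrow> (\<exists>J. J o\<^sub>L S = id_blinfun \<and> S o\<^sub>L J = id_blinfun)"

lemma real_spectrum_iff: "r \<in> real_spectrum T \<longleftrightarrow> \<not> invertible_op (T - r *\<^sub>R id_blinfun)"
  by (simp add: real_spectrum_def invertible_op_def)

lemma blinfun_compose_assoc: "(A o\<^sub>L B) o\<^sub>L C = A o\<^sub>L (B o\<^sub>L C)"
  by (rule blinfun_eqI) simp

lemma blinfun_compose_id [simp]: "A o\<^sub>L id_blinfun = A" "id_blinfun o\<^sub>L A = A"
  by (auto intro!: blinfun_eqI)

lemma invertible_op_compose:
  assumes "invertible_op A" "invertible_op B" shows "invertible_op (A o\<^sub>L B)"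
proof -
  obtain J where J: "J o\<^sub>L A = id_blinfun" "A o\<^sub>L J = id_blinfun"
    using assms by (auto simp: invertible_op_def)
  obtain L where L: "L o\<^sub>L B = id_blinfun" "B o\<^sub>L L = id_blinfun"
    using assms by (auto simp: invertible_op_def)
  have "(L o\<^sub>L J) o\<^sub>L (A o\<^sub>L B) = L o\<^sub>L (J o\<^sub>L A) o\<^sub>L B" by (simp add: blinfun_compose_assoc)
  moreover have "(A o\<^sub>L B) o\<^sub>L (L o\<^sub>L J) = A o\<^sub>L (B o\<^sub>L L) o\<^sub>L J" by (simp add: blinfun_compose_assoc)
  ultimately show ?thesis unfolding invertible_op_def using J L by (auto intro!: exI[of _ "L o\<^sub>L J"])
qed

lemma coercive_invertible_op:
  fixes K :: "'a::{real_inner,complete_space} \<Rightarrow>\<^sub>L 'a"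
  assumes "0 < c" "\<And>x. c * (x \<bullet> x) \<le> K x \<bullet> x"
  shows "invertible_op K"
  using coercive_invertible[OF assms] unfolding invertible_op_def by blast

lemma invertible_op_uminus:
  assumes "invertible_op K" shows "invertible_op (- K)"
proof -
  obtain J where "J o\<^sub>L K = id_blinfun" "K o\<^sub>L J = id_blinfun"
    using assms by (auto simp: invertible_op_def)
  moreover have "(- A) o\<^sub>L (- B) = A o\<^sub>L B" for A B :: "'a \<Rightarrow>\<^sub>L 'a"
    by (rule blinfun_eqI) (simp add: blinfun.minus_left blinfun.minus_right)
  ultimately have "(- J) o\<^sub>L (- K) = id_blinfun" "(- K) o\<^sub>L (- J) = id_blinfun"
    by simp_all
  then show ?thesis by (auto simp: invertible_op_def)
qed

lemma poly_map_of_real_add: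
  "poly (map_poly complex_of_real (p + q)) z = poly (map_poly of_real p) z + poly (map_poly of_real q) z"
proof -
  have "map_poly complex_of_real (p + q) = map_poly of_real p + map_poly of_real q"
    by (rule poly_eqI) (simp add: coeff_map_poly)
  then show ?thesis by simp
qed

lemma poly_map_of_real_mult:
  "poly (map_poly complex_of_real (p * q)) z = poly (map_poly of_real p) z * poly (map_poly of_real q) z"
  by (induction p) (simp_all add: map_poly_smult map_poly_pCons poly_map_of_real_add distrib_right mult.assoc)

text \<open>
  A complex root \<open>a + b \<i>\<close> of \<open>q\<close> is also a root of the remainder of \<open>q\<close> modulo \<open>(x - a)\<^sup>2 + b\<^sup>2\<close>, which
  has degree at most one and hence vanishes.
\<close>

lemma real_poly_quadratic_factor:
  fixes q :: "real poly"
  assumes deg: "degree q > 0" and no: "\<And>r. poly q r \<noteq> 0"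
  obtains a b where "b \<noteq> 0" "[:a\<^sup>2 + b\<^sup>2, - 2 * a, 1:] dvd q"
proof -
  have "degree (map_poly complex_of_real q) > 0" using deg by (simp add: degree_map_poly)
  then have "\<not> constant (poly (map_poly complex_of_real q))"
    by (simp add: constant_degree)
  then obtain z where z: "poly (map_poly complex_of_real q) z = 0"
    using fundamental_theorem_of_algebra by blast
  define a b where "a = Re z" and "b = Im z"
  have zab: "z = Complex a b" by (simp add: a_def b_def)
  have b: "b \<noteq> 0"
  proof
    assume "b = 0"
    then have "z = complex_of_real a" by (simp add: zab complex_eq_iff)
    then have "poly (map_poly complex_of_real q) z = of_real (poly q a)"
      by (induction q) (simp_all add: map_poly_pCons)
    then show False using z no by simp
  qed
  define d where "d = [:a\<^sup>2 + b\<^sup>2, - 2 * a, 1:]"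
  define r where "r = q mod d"
  have dz: "poly (map_poly complex_of_real d) z = 0"
    by (simp add: d_def map_poly_pCons zab complex_eq_iff power2_eq_square algebra_simps)
  have "q = d * (q div d) + r" by (simp add: r_def)
  then have rz: "poly (map_poly complex_of_real r) z = 0"
    using z dz poly_map_of_real_add[of "d * (q div d)" r z] by (simp add: poly_map_of_real_mult)
  have "degree r < 2 \<or> r = 0"
    using degree_mod_less[of d q] by (auto simp: r_def d_def)
  then have "degree r \<le> 1" by auto
  then obtain c e where r: "r = [:c, e:]" 
    using degree1_coeffs[of r] degree_eq_zeroE[of r] by (metis One_nat_def le_SucE le_zero_eq pCons_0_0)
  have "e = 0" "c = 0" using rz b by (auto simp: r map_poly_pCons zab complex_eq_iff)
  then have "d dvd q" using r r_def by auto
  then show ?thesis using that b d_def by blast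
qed

text \<open>
  One half of the spectral mapping theorem, with real polynomials only. Split off a factor of least
  degree: a linear factor \<open>x - r\<close> gives an invertible operator unless \<open>r\<close> is in the spectrum, and
  a quadratic factor \<open>(x - a)\<^sup>2 + b\<^sup>2\<close> always gives one, because \<open>(T - a)\<^sup>2 + b\<^sup>2\<close> is coercive.
\<close>

lemma noninvertible_poly_root:
  fixes T :: "'a::complex_hilbert \<Rightarrow>\<^sub>L 'a"
  assumes T: "T \<in> selfadjoint_ops"
  shows "q \<noteq> 0 \<Longrightarrow> \<not> invertible_op (poly_op q T) \<Longrightarrow> \<exists>r\<in>real_spectrum T. poly q r = 0"
proof (induction "degree q" arbitrary: q rule: less_induct)
  case less
  show ?case
  proof (cases "degree q = 0")
    case True
    then obtain c where q: "q = [:c:]" "c \<noteq> 0" using less.prems by (metis degree_eq_zeroE pCons_0_0)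
    have "invertible_op (poly_op q T)"
      unfolding invertible_op_def q(1) poly_op_const
      by (intro exI[of _ "(1/c) *\<^sub>R id_blinfun"])
        (use q(2) in \<open>auto intro!: blinfun_eqI simp: blinfun.scaleR_left\<close>)
    with less.prems show ?thesis by blast
  next
    case False
    obtain d k where d: "d dvd q" "q = d * k" "degree d > 0"
      and dinv: "invertible_op (poly_op d T) \<or> (\<exists>r\<in>real_spectrum T. poly d r = 0)"
    proof (cases "\<exists>r. poly q r = 0")
      case True
      then obtain r where "poly q r = 0" by blast
      then have "[:-r, 1:] dvd q" by (simp add: poly_eq_0_iff_dvd)
      moreover have "invertible_op (poly_op [:-r,1:] T) \<or> (\<exists>s\<in>real_spectrum T. poly [:-r,1:] s = 0)"
        by (auto simp: poly_op_linear real_spectrum_iff)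
      ultimately show ?thesis using that by (metis dvdE degree_pCons_eq_if one_neq_zero pCons_eq_0_iff zero_less_Suc)
    next
      case False
      then obtain a b where ab: "b \<noteq> 0" "[:a\<^sup>2 + b\<^sup>2, - 2 * a, 1:] dvd q"
        using real_poly_quadratic_factor[of q] \<open>degree q \<noteq> 0\<close> by blast
      have "invertible_op (poly_op [:a\<^sup>2 + b\<^sup>2, - 2 * a, 1:] T)"
      proof (rule coercive_invertible_op[of "b\<^sup>2"])
        show "0 < b\<^sup>2" using ab by simp
        fix x
        have "0 \<le> (T x - a *\<^sub>R x) \<bullet> (T x - a *\<^sub>R x)" by simp
        also have "\<dots> = T (T x) \<bullet> x - 2 * a * (T x \<bullet> x) + a\<^sup>2 * (x \<bullet> x)"
          by (simp add: inner_diff_left inner_diff_right selfadjoint_inner[OF T] inner_commute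
              power2_eq_square algebra_simps)
        finally show "b\<^sup>2 * (x \<bullet> x) \<le> poly_op [:a\<^sup>2 + b\<^sup>2, - 2 * a, 1:] T x \<bullet> x"
          by (simp add: poly_op_pCons blinfun.add_left blinfun.add_right blinfun.diff_left blinfun.diff_right
              blinfun.scaleR_left blinfun.scaleR_right inner_add_left inner_diff_left algebra_simps)
      qed
      moreover have "degree [:a\<^sup>2 + b\<^sup>2, - 2 * a, 1:] > 0" by simp
      ultimately show ?thesis using that ab(2) by blast
    qed
    show ?thesis
    proof (cases "\<exists>r\<in>real_spectrum T. poly d r = 0")
      case True
      then show ?thesis using d by auto
    next
      case False
      then have "invertible_op (poly_op d T)" using dinv by blast
      then have "\<not> invertible_op (poly_op k T)"
        using less.prems(2) unfolding d(2) poly_op_mult using invertible_op_compose by blast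
      moreover have k: "k \<noteq> 0" using d less.prems by auto
      moreover have "degree k < degree q"
        using d k less.prems(1) by (auto simp: degree_mult_eq)
      ultimately show ?thesis using less.hyps[of k] d by auto
    qed
  qed
qed

text \<open>
  The norm of \<open>S\<close> is approached by vectors \<open>x\<close> with \<open>\<parallel>S x\<parallel>\<close> close to \<open>\<parallel>S\<parallel> \<parallel>x\<parallel>\<close>, and these are
  approximate eigenvectors: \<open>\<parallel>(S\<^sup>2 - n\<^sup>2) x\<parallel>\<^sup>2 \<le> n\<^sup>2 (n\<^sup>2 \<parallel>x\<parallel>\<^sup>2 - \<parallel>S x\<parallel>\<^sup>2)\<close> for \<open>n = \<parallel>S\<parallel>\<close>. An inverse would
  therefore bound \<open>\<parallel>S\<parallel>\<close> strictly below \<open>n\<close>.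
\<close>

lemma norm_square_noninvertible:
  fixes S :: "'a::complex_hilbert \<Rightarrow>\<^sub>L 'a"
  assumes S: "S \<in> selfadjoint_ops" and x0: "(x0::'a) \<noteq> 0"
  shows "\<not> invertible_op ((S o\<^sub>L S) - (norm S)\<^sup>2 *\<^sub>R id_blinfun)"
proof
  define n where "n = norm S"
  assume "invertible_op ((S o\<^sub>L S) - (norm S)\<^sup>2 *\<^sub>R id_blinfun)"
  then obtain J where J0: "J o\<^sub>L ((S o\<^sub>L S) - n\<^sup>2 *\<^sub>R id_blinfun) = id_blinfun"
    unfolding invertible_op_def n_def by blast
  have J: "J (S (S x) - n\<^sup>2 *\<^sub>R x) = x" for x
  proof -
    have "J (S (S x) - n\<^sup>2 *\<^sub>R x) = (J o\<^sub>L ((S o\<^sub>L S) - n\<^sup>2 *\<^sub>R id_blinfun)) x"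
      by (simp add: blinfun.diff_left blinfun.scaleR_left)
    then show ?thesis unfolding J0 by simp
  qed
  define M where "M = norm J"
  have main: "x \<bullet> x \<le> M\<^sup>2 * (n\<^sup>2 * (n\<^sup>2 * (x \<bullet> x) - S x \<bullet> S x))" for x
  proof -
    let ?y = "S (S x) - n\<^sup>2 *\<^sub>R x"
    have "(norm x)\<^sup>2 \<le> (M * norm ?y)\<^sup>2"
      using norm_blinfun[of J ?y] by (simp add: J M_def power_mono)
    then have 1: "x \<bullet> x \<le> M\<^sup>2 * (?y \<bullet> ?y)"
      by (simp add: power_mult_distrib power2_norm_eq_inner)
    have "(norm (S (S x)))\<^sup>2 \<le> (n * norm (S x))\<^sup>2"
      unfolding n_def by (intro power_mono norm_blinfun) simp
    then have "S (S x) \<bullet> S (S x) \<le> n\<^sup>2 * (S x \<bullet> S x)"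
      by (simp add: power_mult_distrib power2_norm_eq_inner)
    moreover have "?y \<bullet> ?y = S (S x) \<bullet> S (S x) - 2 * n\<^sup>2 * (S x \<bullet> S x) + n\<^sup>2 * n\<^sup>2 * (x \<bullet> x)"
      by (simp add: inner_diff_left inner_diff_right selfadjoint_inner[OF S] inner_commute algebra_simps)
    ultimately have "?y \<bullet> ?y \<le> n\<^sup>2 * (n\<^sup>2 * (x \<bullet> x) - S x \<bullet> S x)" by (simp add: algebra_simps)
    then have "M\<^sup>2 * (?y \<bullet> ?y) \<le> M\<^sup>2 * (n\<^sup>2 * (n\<^sup>2 * (x \<bullet> x) - S x \<bullet> S x))"
      by (rule mult_left_mono) simp
    with 1 show ?thesis by linarith
  qed
  have "x0 \<bullet> x0 > 0" using x0 by simp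
  with main[of x0] have Mn': "M \<noteq> 0" "n \<noteq> 0"
    by (auto simp del: inner_gt_zero_iff)
  then have Mn: "M\<^sup>2 * n\<^sup>2 > 0" by simp
  define e where "e = 1 / (M\<^sup>2 * n\<^sup>2)"
  have e: "e > 0" using Mn by (simp add: e_def)
  have low: "S x \<bullet> S x \<le> (n\<^sup>2 - e) * (x \<bullet> x)" for x
  proof -
    have "e * (x \<bullet> x) \<le> e * (M\<^sup>2 * (n\<^sup>2 * (n\<^sup>2 * (x \<bullet> x) - S x \<bullet> S x)))"
      using main[of x] e by (simp add: mult_left_mono)
    also have "\<dots> = n\<^sup>2 * (x \<bullet> x) - S x \<bullet> S x" using Mn' by (simp add: e_def)
    finally show ?thesis by (simp add: algebra_simps)
  qed
  have "0 \<le> S x0 \<bullet> S x0" by simp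
  with low[of x0] have "0 \<le> (n\<^sup>2 - e) * (x0 \<bullet> x0)" by linarith
  then have ne: "0 \<le> n\<^sup>2 - e" using \<open>x0 \<bullet> x0 > 0\<close> by (simp add: zero_le_mult_iff)
  have "norm S \<le> sqrt (n\<^sup>2 - e)"
  proof (rule norm_blinfun_bound)
    fix x
    have "(norm (S x))\<^sup>2 \<le> (sqrt (n\<^sup>2 - e) * norm x)\<^sup>2"
      using low[of x] ne by (simp add: power_mult_distrib power2_norm_eq_inner)
    then show "norm (S x) \<le> sqrt (n\<^sup>2 - e) * norm x"
      by (rule power2_le_imp_le) (rule mult_nonneg_nonneg, use ne in auto)
  qed (use ne in simp)
  also have "\<dots> < sqrt (n\<^sup>2)" using e by (intro real_sqrt_less_mono) simp
  also have "\<dots> = norm S" by (simp add: n_def)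
  finally show False by simp
qed

text \<open>
  With \<open>n = \<parallel>p(T)\<parallel>\<close>, the operator \<open>q(T)\<close> for \<open>q = p\<^sup>2 - n\<^sup>2\<close> is not invertible, so \<open>q\<close> has a root in the
  spectrum, where \<open>|p| = n\<close>.
\<close>

lemma poly_op_norm_le:
  fixes T :: "'a::complex_hilbert \<Rightarrow>\<^sub>L 'a"
  assumes T: "T \<in> selfadjoint_ops" and e: "0 \<le> e"
    and b: "\<And>r. r \<in> real_spectrum T \<Longrightarrow> \<bar>poly p r\<bar> \<le> e"
  shows "norm (poly_op p T) \<le> e"
proof (rule ccontr)
  assume "\<not> ?thesis"
  then have n: "norm (poly_op p T) > e" by simp
  then have "poly_op p T \<noteq> 0" using e by auto
  then obtain x0 where "poly_op p T x0 \<noteq> 0" by (metis blinfun_eqI zero_blinfun.rep_eq)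
  then have x0: "x0 \<noteq> 0" by (auto simp: blinfun.zero_right)
  have attained: "\<exists>r\<in>real_spectrum T. (poly q r)\<^sup>2 = (norm (poly_op q T))\<^sup>2"
    if "q * q - [:(norm (poly_op q T))\<^sup>2:] \<noteq> 0" for q
    using noninvertible_poly_root[OF T that] norm_square_noninvertible[OF poly_op_selfadjoint[OF T, of q] x0]
    by (auto simp: poly_op_diff poly_op_mult poly_op_const power2_eq_square)
  show False
  proof (cases "p * p - [:(norm (poly_op p T))\<^sup>2:] = 0")
    case False
    then obtain r where "r \<in> real_spectrum T" "(poly p r)\<^sup>2 = (norm (poly_op p T))\<^sup>2"
      using attained by blast
    then have "poly p r = norm (poly_op p T) \<or> poly p r = - norm (poly_op p T)"
      by (simp only: power2_eq_iff)
    then show False using b[OF \<open>r \<in> real_spectrum T\<close>] n by auto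
  next
    case True
    \<comment> \<open>Here \<open>p\<close> is constant and \<open>q = 0\<close>, so only a point of the spectrum is needed; the polynomial \<open>x\<close> provides one.\<close>
    have "[:0,1:] * [:0,1:] - [:(norm (poly_op [:0,1:] T))\<^sup>2:] \<noteq> 0" by simp
    then obtain r where r: "r \<in> real_spectrum T" using attained by blast
    have "poly (p * p - [:(norm (poly_op p T))\<^sup>2:]) r = 0" using True by simp
    then have "(poly p r)\<^sup>2 = (norm (poly_op p T))\<^sup>2" by (simp add: power2_eq_square)
    then have "poly p r = norm (poly_op p T) \<or> poly p r = - norm (poly_op p T)"
      by (simp only: power2_eq_iff)
    then show False using b[OF r] n by auto
  qed
qed

lemma real_spectrum_subset:
  assumes T: "form_between a b T"
  shows "real_spectrum T \<subseteq> {a..b}"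
proof
  fix r assume r: "r \<in> real_spectrum T"
  show "r \<in> {a..b}"
  proof (rule ccontr)
    assume "r \<notin> {a..b}"
    then consider "r < a" | "r > b" by force
    then have "invertible_op (T - r *\<^sub>R id_blinfun)"
    proof cases
      case 1
      show ?thesis
        by (rule coercive_invertible_op[of "a - r"])
          (use 1 form_between_ge[OF T] in \<open>auto simp: blinfun.diff_left blinfun.scaleR_left inner_diff_left algebra_simps\<close>)
    next
      case 2
      have "invertible_op (r *\<^sub>R id_blinfun - T)"
        by (rule coercive_invertible_op[of "r - b"])
          (use 2 form_between_le[OF T] in \<open>auto simp: blinfun.diff_left blinfun.scaleR_left inner_diff_left algebra_simps\<close>)
      from invertible_op_uminus[OF this] show ?thesis by simp
    qed
    with r show False by (simp add: real_spectrum_iff)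
  qed
qed

section \<open>Continuous functional calculus\<close>

text \<open>
  Well-definedness of \<open>f(T)\<close>: two approximating sequences of polynomials differ by a sequence that tends to zero
  uniformly on the spectrum, hence also in norm when applied to \<open>T\<close>.
\<close>

lemma fun_calc_eqI:
  assumes T: "T \<in> selfadjoint_ops"
    and p: "uniform_limit (real_spectrum T) (\<lambda>n. poly (p n)) f sequentially"
    and S: "(\<lambda>n. poly_op (p n) T) \<longlonglongrightarrow> S"
  shows "fun_calc f T = S"
  unfolding fun_calc_def
proof (rule the_equality)
  show "\<exists>p. uniform_limit (real_spectrum T) (\<lambda>n. poly (p n)) f sequentially \<and> (\<lambda>n. poly_op (p n) T) \<longlonglongrightarrow> S"
    using p S by blast
next
  fix S' assume "\<exists>p. uniform_limit (real_spectrum T) (\<lambda>n. poly (p n)) f sequentially \<and> (\<lambda>n. poly_op (p n) T) \<longlonglongrightarrow> S'"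
  then obtain q where q: "uniform_limit (real_spectrum T) (\<lambda>n. poly (q n)) f sequentially"
    and S': "(\<lambda>n. poly_op (q n) T) \<longlonglongrightarrow> S'" by blast
  have "(\<lambda>n. poly_op (q n) T - poly_op (p n) T) \<longlonglongrightarrow> 0"
  proof (rule tendstoI)
    fix e :: real assume e: "0 < e"
    have "\<forall>\<^sub>F n in sequentially. \<forall>x\<in>real_spectrum T. dist (poly (p n) x) (f x) < e/4"
      "\<forall>\<^sub>F n in sequentially. \<forall>x\<in>real_spectrum T. dist (poly (q n) x) (f x) < e/4"
      using p[unfolded uniform_limit_iff, rule_format, of "e/4"]
        q[unfolded uniform_limit_iff, rule_format, of "e/4"] e by simp_all
    then show "\<forall>\<^sub>F n in sequentially. dist (poly_op (q n) T - poly_op (p n) T) 0 < e"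
    proof eventually_elim
      case (elim n)
      have "norm (poly_op (q n - p n) T) \<le> e/2"
      proof (rule poly_op_norm_le[OF T])
        fix r assume "r \<in> real_spectrum T"
        then have "\<bar>poly (p n) r - f r\<bar> < e/4" "\<bar>poly (q n) r - f r\<bar> < e/4"
          using elim by (auto simp: dist_real_def)
        then show "\<bar>poly (q n - p n) r\<bar> \<le> e/2" unfolding poly_diff by linarith
      qed (use e in simp)
      then show ?case using e by (simp add: poly_op_diff)
    qed
  qed
  moreover have "(\<lambda>n. poly_op (q n) T - poly_op (p n) T) \<longlonglongrightarrow> S' - S"
    by (intro tendsto_diff S S')
  ultimately show "S' = S" using LIMSEQ_unique by fastforce
qed

lemma polynomial_uniform_approximation:
  fixes f :: "real \<Rightarrow> real"
  assumes "continuous_on {a..b} f"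
  shows "\<exists>p. uniform_limit {a..b} (\<lambda>n. poly (p n)) f sequentially"
proof -
  have "\<exists>q. \<forall>x\<in>{a..b}. \<bar>poly q x - f x\<bar> < inverse (real (Suc n))" for n
  proof -
    obtain g where g: "real_polynomial_function g" "\<And>x. x \<in> {a..b} \<Longrightarrow> \<bar>f x - g x\<bar> < inverse (real (Suc n))"
      using Stone_Weierstrass_real_polynomial_function[OF compact_Icc assms, of "inverse (real (Suc n))"]
      by (auto simp del: of_nat_Suc)
    obtain c m where c: "g = (\<lambda>x. \<Sum>i\<le>m. c i * x ^ i)"
      using g(1) real_polynomial_function_imp_sum by blast
    have "poly (\<Sum>i\<le>m. monom (c i) i) x = g x" for x
      by (simp add: c poly_sum poly_monom)
    then show ?thesis using g(2)
      by (intro exI[of _ "\<Sum>i\<le>m. monom (c i) i"]) (simp add: abs_minus_commute)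
  qed
  then obtain p where p: "\<And>n x. x \<in> {a..b} \<Longrightarrow> \<bar>poly (p n) x - f x\<bar> < inverse (real (Suc n))" by metis
  have "uniform_limit {a..b} (\<lambda>n. poly (p n)) f sequentially"
  proof (rule uniform_limitI)
    fix e :: real assume "0 < e"
    then obtain N where N: "inverse (real (Suc N)) < e" using reals_Archimedean by blast
    have "\<forall>x\<in>{a..b}. dist (poly (p n) x) (f x) < e" if "n \<ge> N" for n
    proof
      fix x assume "x \<in> {a..b}"
      then have "\<bar>poly (p n) x - f x\<bar> < inverse (real (Suc n))" by (rule p)
      also have "\<dots> \<le> inverse (real (Suc N))" using that by (intro le_imp_inverse_le) auto
      finally show "dist (poly (p n) x) (f x) < e" using N by (simp add: dist_real_def)
    qed
    then show "\<forall>\<^sub>F n in sequentially. \<forall>x\<in>{a..b}. dist (poly (p n) x) (f x) < e"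
      using eventually_sequentially by blast
  qed
  then show ?thesis by blast
qed

text \<open>
  Existence of \<open>f(T)\<close>: Weierstrass approximation on an interval that contains the spectrum gives a
  Cauchy sequence of operators.
\<close>

lemma fun_calc_approximation:
  fixes T :: "'a::complex_hilbert \<Rightarrow>\<^sub>L 'a"
  assumes T: "form_between a b T" and f: "continuous_on {a..b} f"
  shows "\<exists>p. uniform_limit {a..b} (\<lambda>n. poly (p n)) f sequentially \<and>
             (\<lambda>n. poly_op (p n) T) \<longlonglongrightarrow> fun_calc f T"
proof -
  obtain p where p: "uniform_limit {a..b} (\<lambda>n. poly (p n)) f sequentially"
    using polynomial_uniform_approximation[OF f] by blast
  have ps: "uniform_limit (real_spectrum T) (\<lambda>n. poly (p n)) f sequentially"
    by (rule uniform_limit_on_subset[OF p real_spectrum_subset[OF T]])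
  have T': "T \<in> selfadjoint_ops" using T by (rule form_between_selfadjoint)
  have "Cauchy (\<lambda>n. poly_op (p n) T)"
  proof (rule metric_CauchyI)
    fix e :: real assume e: "0 < e"
    have "\<forall>\<^sub>F n in sequentially. \<forall>x\<in>real_spectrum T. dist (poly (p n) x) (f x) < e/4"
      using ps[unfolded uniform_limit_iff, rule_format, of "e/4"] e by simp
    then obtain N where N: "\<And>n x. n \<ge> N \<Longrightarrow> x \<in> real_spectrum T \<Longrightarrow> dist (poly (p n) x) (f x) < e/4"
      unfolding eventually_sequentially by blast
    have "dist (poly_op (p m) T) (poly_op (p n) T) < e" if "m \<ge> N" "n \<ge> N" for m n
    proof -
      have "norm (poly_op (p m - p n) T) \<le> e/2"
      proof (rule poly_op_norm_le[OF T'])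
        fix r assume "r \<in> real_spectrum T"
        then have "\<bar>poly (p m) r - f r\<bar> < e/4" "\<bar>poly (p n) r - f r\<bar> < e/4"
          using N that by (auto simp: dist_real_def)
        then show "\<bar>poly (p m - p n) r\<bar> \<le> e/2" unfolding poly_diff by linarith
      qed (use e in simp)
      then show ?thesis using e by (simp add: poly_op_diff dist_norm)
    qed
    then show "\<exists>M. \<forall>m\<ge>M. \<forall>n\<ge>M. dist (poly_op (p m) T) (poly_op (p n) T) < e" by blast
  qed
  then obtain S where S: "(\<lambda>n. poly_op (p n) T) \<longlonglongrightarrow> S"
    using Cauchy_convergent convergent_def by blast
  with p fun_calc_eqI[OF T' ps S] show ?thesis by blast
qed

lemma fun_calc_selfadjoint:
  assumes T: "form_between a b T" and f: "continuous_on {a..b} f"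
  shows "fun_calc f T \<in> selfadjoint_ops"
  using fun_calc_approximation[OF assms] selfadjoint_limit poly_op_selfadjoint form_between_selfadjoint[OF T]
  by metis

text \<open>
  The identity \<open>h = f g\<close> is required on \<open>[a, b]\<close> only, because it will be applied to powers and to
  quotients, where it holds on positive arguments.
\<close>

lemma fun_calc_mult:
  assumes T: "form_between a b T" and f: "continuous_on {a..b} f" and g: "continuous_on {a..b} g"
    and h: "\<And>x. x \<in> {a..b} \<Longrightarrow> h x = f x * g x"
  shows "fun_calc h T = fun_calc f T o\<^sub>L fun_calc g T"
proof -
  obtain p where p: "uniform_limit {a..b} (\<lambda>n. poly (p n)) f sequentially"
    "(\<lambda>n. poly_op (p n) T) \<longlonglongrightarrow> fun_calc f T"
    using fun_calc_approximation[OF T f] by blast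
  obtain q where q: "uniform_limit {a..b} (\<lambda>n. poly (q n)) g sequentially"
    "(\<lambda>n. poly_op (q n) T) \<longlonglongrightarrow> fun_calc g T"
    using fun_calc_approximation[OF T g] by blast
  have "uniform_limit {a..b} (\<lambda>n x. poly (p n) x * poly (q n) x) (\<lambda>x. f x * g x) sequentially"
    by (intro uniform_lim_mult p q compact_imp_bounded compact_continuous_image f g compact_Icc)
  then have "uniform_limit {a..b} (\<lambda>n. poly (p n * q n)) h sequentially"
    by (rule uniform_limit_cong'[THEN iffD1, rotated -1]) (auto simp: h)
  then have "uniform_limit (real_spectrum T) (\<lambda>n. poly (p n * q n)) h sequentially"
    by (rule uniform_limit_on_subset[OF _ real_spectrum_subset[OF T]])
  then show ?thesis
    by (rule fun_calc_eqI[OF form_between_selfadjoint[OF T]])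
      (auto simp: poly_op_mult intro!: bounded_bilinear.tendsto[OF bounded_bilinear_blinfun_compose] p q)
qed

lemma fun_calc_poly:
  assumes T: "form_between a b T" and h: "\<And>x. x \<in> {a..b} \<Longrightarrow> h x = poly p x"
  shows "fun_calc h T = poly_op p T"
proof (rule fun_calc_eqI[OF form_between_selfadjoint[OF T]])
  show "uniform_limit (real_spectrum T) (\<lambda>n. poly p) h sequentially"
    using h real_spectrum_subset[OF T] by (auto intro!: uniform_limitI always_eventually)
qed simp

text \<open>
  On \<open>[a, b]\<close> with \<open>a > 0\<close> the powers are continuous and multiply as expected, so the identities are instances of
  multiplicativity of the functional calculus.
\<close>

lemma op_powr_half:
  fixes X :: "'a::complex_hilbert \<Rightarrow>\<^sub>L 'a"
  assumes X: "form_between a b X" and a: "0 < a"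
  shows "op_powr X (1/2) \<in> selfadjoint_ops" "op_powr X (-1/2) \<in> selfadjoint_ops"
    "op_powr X (1/2) o\<^sub>L op_powr X (1/2) = X"
    "op_powr X (1/2) o\<^sub>L op_powr X (-1/2) = id_blinfun"
    "op_powr X (-1/2) o\<^sub>L op_powr X (1/2) = id_blinfun"
proof -
  have c: "continuous_on {a..b} (\<lambda>x. x powr r)" for r
    using a by (intro continuous_intros) auto
  show "op_powr X (1/2) \<in> selfadjoint_ops" "op_powr X (-1/2) \<in> selfadjoint_ops"
    unfolding op_powr_def by (rule fun_calc_selfadjoint[OF X c])+
  have "op_powr X r o\<^sub>L op_powr X s = poly_op p X"
    if "\<And>x. 0 < x \<Longrightarrow> x powr (r + s) = poly p x" for r s p
  proof -
    have "fun_calc (\<lambda>x. x powr (r + s)) X = op_powr X r o\<^sub>L op_powr X s"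
      unfolding op_powr_def by (rule fun_calc_mult[OF X c c]) (simp add: powr_add)
    moreover have "fun_calc (\<lambda>x. x powr (r + s)) X = poly_op p X"
      by (rule fun_calc_poly[OF X]) (use a that in auto)
    ultimately show ?thesis by simp
  qed
  from this[of "1/2" "1/2" "[:0,1:]"] this[of "1/2" "-1/2" "[:1:]"] this[of "-1/2" "1/2" "[:1:]"]
  show "op_powr X (1/2) o\<^sub>L op_powr X (1/2) = X"
    "op_powr X (1/2) o\<^sub>L op_powr X (-1/2) = id_blinfun"
    "op_powr X (-1/2) o\<^sub>L op_powr X (1/2) = id_blinfun"
    by (auto simp: poly_op_linear poly_op_const)
qed

section \<open>Inverses of operators in an order interval\<close>

lemma inner_self_nonpos: "x \<bullet> x \<le> 0 \<Longrightarrow> x = (0::'a::real_inner)"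
  by (metis inner_ge_zero inner_eq_zero_iff order_antisym)

lemma form_between_apply_upper:
  assumes "form_between a b T" "0 < a" shows "norm (T x) \<le> b * norm x"
  using form_between_norm_apply[OF form_between_mono[OF assms(1), of 0 b]] assms(2) by simp

lemma form_between_apply_lower:
  assumes "form_between a b T" shows "a * norm x \<le> norm (T x)"
proof (cases "x = 0")
  case False
  have "a * (norm x * norm x) \<le> norm (T x) * norm x"
    using form_between_ge[OF assms, of x] norm_cauchy_schwarz[of "T x" x]
    by (simp add: power2_norm_eq_inner[symmetric] power2_eq_square)
  then show ?thesis using False by (simp flip: mult.assoc)
qed simp

text \<open>
  The choice is unique whenever \<open>K\<close> is invertible, in particular when \<open>a I \<le> K\<close> with \<open>a > 0\<close>.
\<close>

definition op_inv :: "('a::real_normed_vector \<Rightarrow>\<^sub>L 'a) \<Rightarrow> ('a \<Rightarrow>\<^sub>L 'a)" where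
  "op_inv K = (SOME J. K o\<^sub>L J = id_blinfun \<and> J o\<^sub>L K = id_blinfun)"

lemma op_inv:
  assumes K: "form_between a b K" and a: "0 < a"
  shows "K o\<^sub>L op_inv K = id_blinfun" "op_inv K o\<^sub>L K = id_blinfun"
proof -
  have "\<exists>J. K o\<^sub>L J = id_blinfun \<and> J o\<^sub>L K = id_blinfun"
    by (rule coercive_invertible[OF a form_between_ge[OF K]])
  then have "K o\<^sub>L op_inv K = id_blinfun \<and> op_inv K o\<^sub>L K = id_blinfun"
    unfolding op_inv_def by (rule someI_ex)
  then show "K o\<^sub>L op_inv K = id_blinfun" "op_inv K o\<^sub>L K = id_blinfun" by auto
qed

lemma op_inv_apply:
  assumes K: "form_between a b K" and a: "0 < a"
  shows "K (op_inv K x) = x" "op_inv K (K x) = x"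
  using op_inv[OF assms] by (metis blinfun_apply_blinfun_compose blinfun_apply_id_blinfun id_apply)+

lemma op_inv_selfadjoint:
  "form_between a b K \<Longrightarrow> 0 < a \<Longrightarrow> op_inv K \<in> selfadjoint_ops"
  using selfadjoint_inverse[OF form_between_selfadjoint op_inv(1)] by blast

lemma op_inv_norm_apply:
  assumes K: "form_between a b K" and a: "0 < a"
  shows "norm (op_inv K x) \<le> norm x / a"
  using form_between_apply_lower[OF K, of "op_inv K x"] a
  by (simp add: op_inv_apply[OF assms] field_simps)

text \<open>
  From \<open>J - J\<^sub>0 = J (K\<^sub>0 - K) J\<^sub>0\<close>; the smallness of \<open>K - K\<^sub>0\<close> first bounds \<open>\<parallel>J\<parallel>\<close> by \<open>2 \<parallel>J\<^sub>0\<parallel>\<close>.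
\<close>

lemma inverse_perturbation:
  fixes K K0 J J0 :: "'a::real_normed_vector \<Rightarrow>\<^sub>L 'a"
  assumes J: "J o\<^sub>L K = id_blinfun" and J0: "K0 o\<^sub>L J0 = id_blinfun"
    and small: "norm (K - K0) * norm J0 \<le> 1/2"
  shows "norm (J - J0) \<le> 2 * (norm J0)\<^sup>2 * norm (K - K0)"
proof -
  have "J - J0 = J o\<^sub>L (K0 - K) o\<^sub>L J0"
  proof (rule blinfun_eqI)
    fix x
    have "J (K (J0 x)) = J0 x" "K0 (J0 x) = x"
      using J J0 by (metis blinfun_apply_blinfun_compose blinfun_apply_id_blinfun id_apply)+
    then show "(J - J0) x = (J o\<^sub>L (K0 - K) o\<^sub>L J0) x"
      by (simp add: blinfun.diff_left blinfun.diff_right)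
  qed
  then have "norm (J - J0) \<le> norm (J o\<^sub>L (K0 - K)) * norm J0"
    using norm_blinfun_compose by metis
  also have "\<dots> \<le> (norm J * norm (K0 - K)) * norm J0"
    by (intro mult_right_mono norm_blinfun_compose) simp
  finally have 1: "norm (J - J0) \<le> norm J * (norm (K - K0) * norm J0)"
    by (simp add: norm_minus_commute mult.assoc)
  also have "\<dots> \<le> norm J * (1/2)"
    by (intro mult_left_mono small) simp
  finally have "norm J \<le> 2 * norm J0"
    using norm_triangle_sub[of J J0] by linarith
  with 1 have "norm (J - J0) \<le> (2 * norm J0) * (norm (K - K0) * norm J0)"
    by (meson mult_right_mono order_trans mult_nonneg_nonneg norm_ge_zero)
  then show ?thesis by (simp add: power2_eq_square mult_ac)
qed

lemma continuous_on_op_inv: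
  fixes K :: "'b::topological_space \<Rightarrow> ('a::real_normed_vector \<Rightarrow>\<^sub>L 'a)"
  assumes K: "continuous_on S K"
    and inv: "\<And>z. z \<in> S \<Longrightarrow> K z o\<^sub>L op_inv (K z) = id_blinfun"
             "\<And>z. z \<in> S \<Longrightarrow> op_inv (K z) o\<^sub>L K z = id_blinfun"
  shows "continuous_on S (\<lambda>z. op_inv (K z))"
  unfolding continuous_on_def
proof
  fix z0 assume z0: "z0 \<in> S"
  let ?J0 = "op_inv (K z0)"
  have Kl: "(K \<longlongrightarrow> K z0) (at z0 within S)" using K z0 by (simp add: continuous_on_def)
  then have d: "((\<lambda>z. norm (K z - K z0)) \<longlongrightarrow> 0) (at z0 within S)"
    using tendsto_norm_zero LIM_zero by blast
  then have "((\<lambda>z. norm (K z - K z0) * norm ?J0) \<longlongrightarrow> 0 * norm ?J0) (at z0 within S)"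
    by (intro tendsto_mult tendsto_const)
  then have "\<forall>\<^sub>F z in at z0 within S. norm (K z - K z0) * norm ?J0 < 1/2"
    by (intro order_tendstoD(2)) auto
  moreover have "\<forall>\<^sub>F z in at z0 within S. z \<in> S"
    by (simp add: eventually_at_filter)
  ultimately have "\<forall>\<^sub>F z in at z0 within S.
      norm (op_inv (K z) - ?J0) \<le> 2 * (norm ?J0)\<^sup>2 * norm (K z - K z0)"
    by eventually_elim (rule inverse_perturbation, auto simp: inv z0)
  moreover have "((\<lambda>z. 2 * (norm ?J0)\<^sup>2 * norm (K z - K z0)) \<longlongrightarrow> 2 * (norm ?J0)\<^sup>2 * 0) (at z0 within S)"
    by (intro tendsto_mult tendsto_const d)
  ultimately have "((\<lambda>z. op_inv (K z) - ?J0) \<longlongrightarrow> 0) (at z0 within S)"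
    using Lim_null_comparison by fastforce
  then show "((\<lambda>z. op_inv (K z)) \<longlongrightarrow> ?J0) (at z0 within S)"
    by (simp add: LIM_zero_iff)
qed

section \<open>The Karcher operator\<close>

definition weighted_sum :: "real \<Rightarrow> ('a::real_normed_vector \<Rightarrow>\<^sub>L 'a) \<Rightarrow> ('a \<Rightarrow>\<^sub>L 'a) \<Rightarrow> ('a \<Rightarrow>\<^sub>L 'a)" where
  "weighted_sum s A X = (1 - s) *\<^sub>R A + s *\<^sub>R X"

lemma weighted_sum_apply: "weighted_sum s A X x = (1 - s) *\<^sub>R A x + s *\<^sub>R X x"
  by (simp add: weighted_sum_def blinfun.add_left blinfun.scaleR_left)

lemma form_between_weighted_sum:
  assumes "form_between a b A" "form_between a b X" "s \<in> {0..1}"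
  shows "form_between a b (weighted_sum s A X)"
proof -
  have "form_between ((1-s)*a + s*a) ((1-s)*b + s*b) (weighted_sum s A X)"
    unfolding weighted_sum_def using assms by (intro form_between_add form_between_scaleR) auto
  then show ?thesis by (simp add: algebra_simps)
qed

text \<open>
  This is \<open>X\<^sup>1\<^sup>/\<^sup>2 \<ell>\<^sub>s(X\<^sup>-\<^sup>1\<^sup>/\<^sup>2 A X\<^sup>-\<^sup>1\<^sup>/\<^sup>2) X\<^sup>1\<^sup>/\<^sup>2\<close>, in a form that is visibly self-adjoint and has no
  singularity at the endpoints \<open>s = 0\<close> and \<open>s = 1\<close>. Equivalently it is \<open>(A - X) K\<^sup>-\<^sup>1 X\<close> with
  \<open>K = (1 - s) A + s X\<close>.
\<close>

definition karcher_op :: "real \<Rightarrow> ('a::real_normed_vector \<Rightarrow>\<^sub>L 'a) \<Rightarrow> ('a \<Rightarrow>\<^sub>L 'a) \<Rightarrow> ('a \<Rightarrow>\<^sub>L 'a)" where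
  "karcher_op s A X =
     (A - X) - (1 - s) *\<^sub>R ((A - X) o\<^sub>L op_inv (weighted_sum s A X) o\<^sub>L (A - X))"

lemma karcher_op_selfadjoint:
  assumes "form_between a b A" "form_between a b X" "0 < a" "s \<in> {0..1}"
  shows "karcher_op s A X \<in> selfadjoint_ops"
  unfolding karcher_op_def
  by (intro selfadjoint_diff selfadjoint_scaleR selfadjoint_sandwich form_between_selfadjoint[OF assms(1)]
      form_between_selfadjoint[OF assms(2)] op_inv_selfadjoint[OF form_between_weighted_sum[OF assms(1,2,4)] assms(3)])

lemma diff_apply_norm:
  assumes "form_between a b A" "form_between a b X" "0 < a"
  shows "norm ((A - X) v) \<le> 2 * b * norm v"
  using norm_triangle_ineq4[of "A v" "X v"] form_between_apply_upper[OF assms(1,3), of v]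
    form_between_apply_upper[OF assms(2,3), of v] by (simp add: blinfun.diff_left)

lemma karcher_op_norm_apply:
  assumes A: "form_between a b A" and X: "form_between a b X" and a: "0 < a" "0 \<le> b" and s: "s \<in> {0..1}"
  shows "norm (karcher_op s A X x) \<le> (2 * b + 4 * b\<^sup>2 / a) * norm x"
proof -
  let ?J = "op_inv (weighted_sum s A X)"
  note K = form_between_weighted_sum[OF A X s]
  note D = diff_apply_norm[OF A X a(1)]
  have "norm ((A - X) (?J ((A - X) x))) \<le> 2 * b * norm (?J ((A - X) x))" by (rule D)
  also have "\<dots> \<le> 2 * b * (norm ((A - X) x) / a)"
    by (intro mult_left_mono op_inv_norm_apply[OF K a(1)]) (use a in auto)
  also have "\<dots> \<le> 2 * b * (2 * b * norm x / a)"
    by (intro mult_left_mono divide_right_mono D) (use a in auto)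
  finally have 1: "norm ((A - X) (?J ((A - X) x))) \<le> 4 * b\<^sup>2 / a * norm x"
    by (simp add: power2_eq_square)
  have "norm (karcher_op s A X x) \<le> norm ((A - X) x) + (1 - s) * norm ((A - X) (?J ((A - X) x)))"
    using norm_triangle_ineq4[of "(A - X) x" "(1 - s) *\<^sub>R ((A - X) (?J ((A - X) x)))"] s
    by (simp add: karcher_op_def blinfun.diff_left[of "_ - _" "_ *\<^sub>R _"] blinfun.scaleR_left)
  also have "\<dots> \<le> 2 * b * norm x + 1 * (4 * b\<^sup>2 / a * norm x)"
    by (intro add_mono D mult_mono 1) (use s in auto)
  finally show ?thesis by (simp add: algebra_simps)
qed

lemma karcher_op_apply:
  assumes A: "form_between a b A" and X: "form_between a b X" and a: "0 < a" and s: "s \<in> {0..1}"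
  shows "karcher_op s A X z = (A - X) (op_inv (weighted_sum s A X) (X z))"
proof -
  let ?K = "weighted_sum s A X" and ?J = "op_inv (weighted_sum s A X)"
  note K = form_between_weighted_sum[OF A X s]
  have "X z = ?K z - (1 - s) *\<^sub>R (A - X) z"
    by (simp add: weighted_sum_apply blinfun.diff_left algebra_simps)
  then have "?J (X z) = z - (1 - s) *\<^sub>R ?J ((A - X) z)"
    by (simp add: blinfun.diff_right blinfun.scaleR_right op_inv_apply[OF K a])
  then have "(A - X) (?J (X z)) = (A - X) z - (1 - s) *\<^sub>R (A - X) (?J ((A - X) z))"
    by (simp only: blinfun.diff_right blinfun.scaleR_right)
  then show ?thesis
    by (simp only: karcher_op_def blinfun.diff_left[of "_ - _" "_ *\<^sub>R _"] blinfun.scaleR_left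
        blinfun_apply_blinfun_compose)
qed

text \<open>
  Substituting \<open>u = R x\<close> turns the form of \<open>R A R\<close> into that of \<open>A\<close> at \<open>u\<close>, while \<open>\<langle>x, x\<rangle> = \<langle>X u, u\<rangle>\<close>.
\<close>

lemma form_between_sandwich:
  assumes A: "form_between a b A" and X: "form_between a b X" and a: "0 < a"
    and S: "S \<in> selfadjoint_ops" and R: "R \<in> selfadjoint_ops"
    and SS: "S o\<^sub>L S = X" and SR: "S o\<^sub>L R = id_blinfun"
  shows "form_between (a / b) (b / a) (R o\<^sub>L A o\<^sub>L R)"
  unfolding form_between_def
proof (intro conjI allI)
  show "R o\<^sub>L A o\<^sub>L R \<in> selfadjoint_ops"
    by (rule selfadjoint_sandwich[OF R form_between_selfadjoint[OF A]])
  fix x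
  define u where "u = R x"
  have "S u = x" unfolding u_def
    using SR by (metis blinfun_apply_blinfun_compose blinfun_apply_id_blinfun id_apply)
  then have "x \<bullet> x = X u \<bullet> u"
    by (metis S SS blinfun_apply_blinfun_compose selfadjoint_inner)
  then have x: "a * (u \<bullet> u) \<le> x \<bullet> x" "x \<bullet> x \<le> b * (u \<bullet> u)"
    using X by (auto simp: form_between_def)
  have q: "(R o\<^sub>L A o\<^sub>L R) x \<bullet> x = A u \<bullet> u"
    by (simp add: u_def selfadjoint_inner[OF R])
  have Au: "a * (u \<bullet> u) \<le> A u \<bullet> u" "A u \<bullet> u \<le> b * (u \<bullet> u)"
    using A by (auto simp: form_between_def)
  show "a / b * (x \<bullet> x) \<le> (R o\<^sub>L A o\<^sub>L R) x \<bullet> x"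
  proof (cases "b \<le> 0")
    case True
    have "0 \<le> A u \<bullet> u" using Au(1) a by (meson inner_ge_zero less_imp_le mult_nonneg_nonneg order_trans)
    moreover have "a / b * (x \<bullet> x) \<le> 0" using True a by (intro mult_nonpos_nonneg divide_nonneg_nonpos) auto
    ultimately show ?thesis using q by simp
  next
    case False
    then have "a / b * (x \<bullet> x) \<le> a / b * (b * (u \<bullet> u))" using a x by (intro mult_left_mono) auto
    also have "\<dots> = a * (u \<bullet> u)" using False by simp
    finally show ?thesis using q Au by simp
  qed
  show "(R o\<^sub>L A o\<^sub>L R) x \<bullet> x \<le> b / a * (x \<bullet> x)"
  proof (cases "b \<le> 0")
    case True
    have "a * (u \<bullet> u) \<le> b * (u \<bullet> u)" using Au by linarith
    also have "\<dots> \<le> 0" using True by (simp add: mult_nonpos_nonneg)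
    finally have u0: "u = 0" using a by (simp add: mult_le_0_iff inner_self_nonpos)
    then have "x = 0" using x by (simp add: inner_self_nonpos)
    then show ?thesis by (simp add: blinfun.zero_right)
  next
    case False
    have "b * (u \<bullet> u) = b / a * (a * (u \<bullet> u))" using a by simp
    also have "\<dots> \<le> b / a * (x \<bullet> x)" using False a x by (intro mult_left_mono) auto
    finally show ?thesis using q Au by simp
  qed
qed

text \<open>
  Both \<open>\<ell>\<^sub>s\<close> and \<open>f\<^sub>s\<^sub>,\<^sub>t\<close> are Moebius functions of this kind, the latter with a shifted weight in place of \<open>s\<close>.
  With \<open>B = R A R\<close>, multiplicativity of
  the functional calculus gives \<open>f(B) ((1 - s) B + s) = p B + q\<close>, and since \<open>R X R = 1\<close> both sides are of
  the form \<open>R (\<dots>) R\<close>; cancelling \<open>R\<close> leaves an identity between \<open>A\<close>, \<open>X\<close> and \<open>K\<^sup>-\<^sup>1\<close> alone.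
\<close>

lemma fun_calc_moebius:
  fixes A X :: "'a::complex_hilbert \<Rightarrow>\<^sub>L 'a"
  assumes A: "form_between a b A" and X: "form_between a b X" and a: "0 < a" and s: "s \<in> {0..1}"
    and f: "\<And>x. 0 < x \<Longrightarrow> f x = (p * x + q) / ((1 - s) * x + s)"
  defines "S \<equiv> op_powr X (1/2)" and "R \<equiv> op_powr X (-1/2)"
  shows "S (fun_calc f (R o\<^sub>L A o\<^sub>L R) (S z)) = (p *\<^sub>R A + q *\<^sub>R X) (op_inv (weighted_sum s A X) (X z))"
    and "fun_calc f (R o\<^sub>L A o\<^sub>L R) \<in> selfadjoint_ops"
proof -
  let ?B = "R o\<^sub>L A o\<^sub>L R" and ?K = "weighted_sum s A X"
  let ?J = "op_inv ?K"
  let ?L = "fun_calc f ?B"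
  note K = form_between_weighted_sum[OF A X s]
  note SR = op_powr_half[OF X a, folded S_def R_def]
  have appl: "S (S x) = X x" "S (R x) = x" "R (S x) = x" for x
    using SR(3-5) by (metis blinfun_apply_blinfun_compose blinfun_apply_id_blinfun id_apply)+
  have Bab: "form_between (a / b) (b / a) ?B"
    by (rule form_between_sandwich[OF A X a SR(1,2,3,4)])
  \<comment> \<open>For \<open>b \<le> 0\<close> the space is zero and any positive lower bound holds.\<close>
  define l where "l = (if b \<le> 0 then 1 else a / b)"
  have l: "l > 0" using a by (auto simp: l_def)
  have B: "form_between l (b / a) ?B"
  proof (cases "b \<le> 0")
    case True
    have "x = 0" for x :: 'a
    proof -
      have "a * (x \<bullet> x) \<le> b * (x \<bullet> x)" using form_between_ge[OF X, of x] form_between_le[OF X, of x] by linarith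
      also have "\<dots> \<le> 0" using True by (simp add: mult_nonpos_nonneg)
      finally show "x = 0" using a by (simp add: mult_le_0_iff inner_self_nonpos)
    qed
    then have "x \<bullet> y = 0" for x y :: 'a by (metis inner_zero_left)
    then show ?thesis using Bab by (simp add: form_between_def)
  qed (use Bab in \<open>simp add: l_def\<close>)
  have den: "(1 - s) * x + s > 0" if "x > 0" for x
  proof (cases "s = 0")
    case False
    then have "s > 0" using s by auto
    then show ?thesis using that s by (intro add_nonneg_pos mult_nonneg_nonneg) auto
  qed (use that in simp)
  have cont: "continuous_on {l..b/a} f"
  proof (rule continuous_on_eq)
    show "continuous_on {l..b/a} (\<lambda>x. (p * x + q) / ((1 - s) * x + s))"
    proof (intro continuous_intros ballI)
      fix x assume "x \<in> {l..b/a}"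
      then show "(1 - s) * x + s \<noteq> 0" using l den[of x] by simp
    qed
  qed (use l f in auto)
  show "?L \<in> selfadjoint_ops" by (rule fun_calc_selfadjoint[OF B cont])
  have "fun_calc (poly [:q, p:]) ?B = ?L o\<^sub>L fun_calc (poly [:s, 1 - s:]) ?B"
  proof (rule fun_calc_mult[OF B cont])
    fix x assume "x \<in> {l..b/a}"
    then have "x > 0" using l by auto
    then have "f x * ((1 - s) * x + s) = p * x + q"
      using den[of x] unfolding f[OF \<open>x > 0\<close>] by (intro nonzero_eq_divide_eq[THEN iffD1]) auto
    then show "poly [:q, p:] x = f x * poly [:s, 1 - s:] x"
      by (simp add: algebra_simps)
  qed (intro continuous_intros)
  then have "poly_op [:q, p:] ?B = ?L o\<^sub>L poly_op [:s, 1 - s:] ?B"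
    using fun_calc_poly[OF B] by metis
  then have "blinfun_apply (poly_op [:q, p:] ?B) y = ?L (poly_op [:s, 1 - s:] ?B y)" for y
    by simp
  then have eq: "q *\<^sub>R y + p *\<^sub>R R (A (R y)) = ?L (s *\<^sub>R y + (1 - s) *\<^sub>R R (A (R y)))" for y
    by (simp add: poly_op_linear blinfun.add_left blinfun.scaleR_left)
  have RX: "R (X y) = S y" for y by (simp flip: appl(1)) (simp add: appl(3))
  define w where "w = ?J (X z)"
  have Kw: "?K w = X z" by (simp add: w_def op_inv_apply[OF K a])
  have "?L (S z) = ?L (R (?K w))" by (simp add: Kw RX)
  also have "R (?K w) = s *\<^sub>R S w + (1 - s) *\<^sub>R R (A (R (S w)))"
    by (simp add: weighted_sum_apply blinfun.add_right blinfun.scaleR_right RX appl add.commute)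
  also have "?L \<dots> = q *\<^sub>R S w + p *\<^sub>R R (A (R (S w)))" by (rule eq[symmetric])
  finally have "S (?L (S z)) = q *\<^sub>R X w + p *\<^sub>R A w"
    by (simp add: blinfun.add_right blinfun.scaleR_right appl)
  then show "S (?L (S z)) = (p *\<^sub>R A + q *\<^sub>R X) (?J (X z))"
    by (simp add: w_def blinfun.add_left blinfun.scaleR_left add.commute)
qed

text \<open>
  The weight of the Karcher operator to which \<open>f\<^sub>s\<^sub>,\<^sub>t\<close> reduces: \<open>f\<^sub>s\<^sub>,\<^sub>t = 1 + t \<ell>\<^sub>r\<close> for \<open>r = shift t s\<close>.
\<close>

definition shift :: "real \<Rightarrow> real \<Rightarrow> real" where
  "shift t s = 1 - (1 - s) * (1 - t)"

lemma shift_unit: "s \<in> {0..1} \<Longrightarrow> t \<in> {0..1} \<Longrightarrow> shift t s \<in> {0..1}"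
  by (auto simp: shift_def mult_le_one)

lemma shift_zero [simp]: "shift 0 s = s" by (simp add: shift_def)

text \<open>
  This inequality is what makes \<open>X \<mapsto> X + t G\<close> monotone.
\<close>

lemma shift_ge: "s \<in> {0..1} \<Longrightarrow> t \<in> {0..1} \<Longrightarrow> t \<le> shift t s"
  by (auto simp: shift_def algebra_simps mult_left_le)

lemma shift_diff: "s \<in> {0..1} \<Longrightarrow> \<bar>shift t s - shift u s\<bar> \<le> \<bar>t - u\<bar>"
proof -
  assume s: "s \<in> {0..1}"
  have "shift t s - shift u s = (1 - s) * (t - u)" by (simp add: shift_def algebra_simps)
  then show ?thesis using s by (simp add: abs_mult mult_left_le_one_le)
qed

lemma ell_sandwich:
  fixes A X :: "'a::complex_hilbert \<Rightarrow>\<^sub>L 'a"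
  assumes "form_between a b A" "form_between a b X" "0 < a" "s \<in> {0..1}"
  shows "op_powr X (1/2) (fun_calc (ell s) (op_powr X (-1/2) o\<^sub>L A o\<^sub>L op_powr X (-1/2)) (op_powr X (1/2) z))
      = karcher_op s A X z"
    and "fun_calc (ell s) (op_powr X (-1/2) o\<^sub>L A o\<^sub>L op_powr X (-1/2)) \<in> selfadjoint_ops"
  using fun_calc_moebius[OF assms, of "ell s" 1 "-1"]
  by (simp_all add: ell_def karcher_op_apply[OF assms])

lemma op_mean_eq:
  fixes A X :: "'a::complex_hilbert \<Rightarrow>\<^sub>L 'a"
  assumes A: "form_between a b A" and X: "form_between a b X" and a: "0 < a" and s: "s \<in> {0..1}"
    and t: "t \<in> {0..1}"
  shows "op_mean s t X A = X + t *\<^sub>R karcher_op (shift t s) A X"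
proof (rule blinfun_eqI)
  fix z
  note s' = shift_unit[OF s t]
  note K = form_between_weighted_sum[OF A X s']
  let ?K = "weighted_sum (shift t s) A X"
  define w where "w = op_inv ?K (X z)"
  have Kw: "?K w = X z" by (simp add: w_def op_inv_apply[OF K a])
  have "op_mean s t X A z = (((1 - t) * (1 - s) + t) *\<^sub>R A + (s * (1 - t)) *\<^sub>R X) w"
    unfolding op_mean_def w_def blinfun_apply_blinfun_compose
    by (rule fun_calc_moebius(1)[OF A X a s']) (simp add: mean_fun_def shift_def algebra_simps)
  also have "\<dots> = ?K w + t *\<^sub>R (A - X) w"
    by (simp add: weighted_sum_apply shift_def blinfun.add_left blinfun.diff_left blinfun.scaleR_left algebra_simps)
  also have "\<dots> = (X + t *\<^sub>R karcher_op (shift t s) A X) z"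
    by (simp add: Kw karcher_op_apply[OF A X a s'] w_def[symmetric] blinfun.add_left blinfun.scaleR_left)
  finally show "op_mean s t X A z = (X + t *\<^sub>R karcher_op (shift t s) A X) z" .
qed

section \<open>A variational formula for the Karcher operator\<close>

text \<open>
  The function of \<open>h\<close> whose minimum is \<open>\<langle>G v, v\<rangle>\<close>. It comes from the description of the weighted harmonic
  mean of \<open>X\<close> and \<open>A\<close> as the minimum of \<open>(1 - s) \<langle>X u, u\<rangle> + s \<langle>A w, w\<rangle>\<close> over \<open>(1 - s) u + s w = v\<close>,
  with the parametrisation \<open>u = v - s h\<close>, \<open>w = v + (1 - s) h\<close>; subtracting \<open>\<langle>X v, v\<rangle>\<close> and dividing
  by \<open>s\<close> leaves an expression that makes sense for \<open>s = 0\<close> too.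
\<close>

definition karcher_form ::
  "real \<Rightarrow> ('a::real_inner \<Rightarrow>\<^sub>L 'a) \<Rightarrow> ('a \<Rightarrow>\<^sub>L 'a) \<Rightarrow> 'a \<Rightarrow> 'a \<Rightarrow> real" where
  "karcher_form s A X v h =
     A (v + (1 - s) *\<^sub>R h) \<bullet> (v + (1 - s) *\<^sub>R h) - X v \<bullet> v - 2 * (1 - s) * (X v \<bullet> h) + s * (1 - s) * (X h \<bullet> h)"

definition karcher_min :: "real \<Rightarrow> ('a::real_inner \<Rightarrow>\<^sub>L 'a) \<Rightarrow> ('a \<Rightarrow>\<^sub>L 'a) \<Rightarrow> 'a \<Rightarrow> 'a" where
  "karcher_min s A X v = - op_inv (weighted_sum s A X) ((A - X) v)"

lemma karcher_form_square:
  fixes A X :: "'a::complex_hilbert \<Rightarrow>\<^sub>L 'a" and v :: 'a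
  assumes A: "form_between a b A" and X: "form_between a b X" and a: "0 < a" and s: "s \<in> {0..1}"
  defines "h0 \<equiv> karcher_min s A X v"
  shows "karcher_form s A X v h = karcher_op s A X v \<bullet> v + (1 - s) * (weighted_sum s A X (h - h0) \<bullet> (h - h0))"
proof -
  let ?K = "weighted_sum s A X"
  note K = form_between_weighted_sum[OF A X s]
  note symA = selfadjoint_inner[OF form_between_selfadjoint[OF A]]
  note symX = selfadjoint_inner[OF form_between_selfadjoint[OF X]]
  note symK = selfadjoint_inner[OF form_between_selfadjoint[OF K]]
  define d where "d = (A - X) v"
  have Kh0: "?K h0 = - d" by (simp add: h0_def karcher_min_def d_def blinfun.minus_right op_inv_apply[OF K a])
  have "(A - X) (op_inv ?K ((A - X) v)) \<bullet> v = op_inv ?K ((A - X) v) \<bullet> (A - X) v"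
    by (simp add: blinfun.diff_left inner_diff_left inner_diff_right symA symX)
  then have G: "karcher_op s A X v \<bullet> v = d \<bullet> v + (1 - s) * (h0 \<bullet> d)"
    by (simp add: karcher_op_def h0_def karcher_min_def d_def[symmetric] blinfun.diff_left[of "_ - _" "_ *\<^sub>R _"]
        blinfun.scaleR_left inner_diff_left)
  have "?K (h - h0) \<bullet> (h - h0) = ?K h \<bullet> h - 2 * (?K h0 \<bullet> h) + ?K h0 \<bullet> h0"
    by (simp add: blinfun.diff_right inner_diff_left inner_diff_right symK inner_commute[of h "?K h0"])
  then have sq: "?K (h - h0) \<bullet> (h - h0) = ?K h \<bullet> h + 2 * (d \<bullet> h) - h0 \<bullet> d"
    by (simp add: Kh0 inner_commute)
  have Khh: "?K h \<bullet> h = (1 - s) * (A h \<bullet> h) + s * (X h \<bullet> h)"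
    by (simp add: weighted_sum_apply inner_add_left)
  have Avh: "A h \<bullet> v = A v \<bullet> h" by (metis inner_commute symA)
  have "A (v + c *\<^sub>R h) \<bullet> (v + c *\<^sub>R h) = A v \<bullet> v + 2 * c * (A v \<bullet> h) + c * c * (A h \<bullet> h)" for c
    by (simp add: blinfun.add_right blinfun.scaleR_right inner_add_left inner_add_right Avh algebra_simps)
  from this[of "1 - s"] have "karcher_form s A X v h =
      A v \<bullet> v - X v \<bullet> v + (1 - s) * ((1 - s) * (A h \<bullet> h) + s * (X h \<bullet> h)) + 2 * (1 - s) * (A v \<bullet> h - X v \<bullet> h)"
    unfolding karcher_form_def by (simp only:) (simp add: algebra_simps)
  also have "\<dots> = karcher_op s A X v \<bullet> v + (1 - s) * (?K (h - h0) \<bullet> (h - h0))"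
    unfolding G sq Khh by (simp add: d_def blinfun.diff_left inner_diff_left algebra_simps)
  finally show ?thesis .
qed

lemma karcher_form_ge:
  fixes A X :: "'a::complex_hilbert \<Rightarrow>\<^sub>L 'a" and v :: 'a
  assumes A: "form_between a b A" and X: "form_between a b X" and a: "0 < a" and s: "s \<in> {0..1}"
  shows "karcher_op s A X v \<bullet> v \<le> karcher_form s A X v h"
proof -
  let ?u = "h - karcher_min s A X v"
  have "0 \<le> a * (?u \<bullet> ?u)" using a by simp
  also have "\<dots> \<le> weighted_sum s A X ?u \<bullet> ?u"
    by (rule form_between_ge[OF form_between_weighted_sum[OF A X s]])
  finally show ?thesis
    unfolding karcher_form_square[OF assms] using s by simp
qed

lemma karcher_form_min:
  fixes A X :: "'a::complex_hilbert \<Rightarrow>\<^sub>L 'a" and v :: 'a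
  assumes A: "form_between a b A" and X: "form_between a b X" and a: "0 < a" and s: "s \<in> {0..1}"
  shows "karcher_form s A X v (karcher_min s A X v) = karcher_op s A X v \<bullet> v"
  by (simp add: karcher_form_square[OF assms] blinfun.zero_right)

lemma karcher_min_norm:
  assumes A: "form_between a b A" and X: "form_between a b X" and a: "0 < a" and s: "s \<in> {0..1}"
  shows "norm (karcher_min s A X v) \<le> 2 * b / a * norm v"
proof -
  have "norm (karcher_min s A X v) \<le> norm ((A - X) v) / a"
    unfolding karcher_min_def norm_minus_cancel
    by (rule op_inv_norm_apply[OF form_between_weighted_sum[OF A X s] a])
  also have "\<dots> \<le> 2 * b * norm v / a"
    by (intro divide_right_mono diff_apply_norm[OF A X a]) (use a in simp)
  finally show ?thesis by simp
qed

text \<open>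
  At the minimiser, \<open>K w = X v\<close>, so \<open>w\<close> cannot be small. This lower bound is the gain that drives both the stability
  estimate and the contraction.
\<close>

lemma karcher_min_form_lower:
  fixes A X :: "'a::complex_hilbert \<Rightarrow>\<^sub>L 'a" and v :: 'a
  assumes A: "form_between a b A" and X: "form_between a b X" and a: "0 < a" "0 < b" and s: "s \<in> {0..1}"
  defines "w \<equiv> v + (1 - s) *\<^sub>R karcher_min s A X v"
  shows "a * (a / b)\<^sup>2 * (v \<bullet> v) \<le> A w \<bullet> w"
proof -
  let ?K = "weighted_sum s A X"
  note K = form_between_weighted_sum[OF A X s]
  have "?K w = ?K v - (1 - s) *\<^sub>R (A - X) v"
    by (simp add: w_def karcher_min_def blinfun.add_right blinfun.diff_right blinfun.scaleR_right
        blinfun.minus_right op_inv_apply[OF K a(1)])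
  also have "\<dots> = X v"
    by (simp add: weighted_sum_apply blinfun.diff_left algebra_simps)
  finally have "a * norm v \<le> norm (?K w)" using form_between_apply_lower[OF X, of v] by simp
  also have "\<dots> \<le> b * norm w" by (rule form_between_apply_upper[OF K a(1)])
  finally have "a / b * norm v \<le> norm w" using a by (simp add: field_simps)
  then have "(a / b * norm v)\<^sup>2 \<le> (norm w)\<^sup>2" using a by (intro power_mono) auto
  then have "(a / b)\<^sup>2 * (v \<bullet> v) \<le> w \<bullet> w" by (simp only: power_mult_distrib power2_norm_eq_inner)
  then have "a * ((a / b)\<^sup>2 * (v \<bullet> v)) \<le> a * (w \<bullet> w)" using a by (intro mult_left_mono) auto
  also have "\<dots> \<le> A w \<bullet> w" by (rule form_between_ge[OF A])
  finally show ?thesis by (simp add: mult.assoc)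
qed

lemma karcher_form_change_weight:
  fixes A X :: "'a::complex_hilbert \<Rightarrow>\<^sub>L 'a"
  assumes A: "form_between a b A" and X: "form_between a b X" and a: "0 < a" "0 \<le> b"
    and s: "s \<in> {0..1}" "s' \<in> {0..1}"
  shows "karcher_form s A X v h \<le>
    karcher_form s' A X v h + \<bar>s - s'\<bar> * (4 * b * (norm v * norm h) + 3 * b * (norm h)\<^sup>2)"
proof -
  have Avh: "A h \<bullet> v = A v \<bullet> h"
    by (metis inner_commute selfadjoint_inner[OF form_between_selfadjoint[OF A]])
  have exp: "A (v + c *\<^sub>R h) \<bullet> (v + c *\<^sub>R h) = A v \<bullet> v + 2 * c * (A v \<bullet> h) + c * c * (A h \<bullet> h)" for c
    by (simp add: blinfun.add_right blinfun.scaleR_right inner_add_left inner_add_right Avh algebra_simps)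
  have diff: "karcher_form s A X v h - karcher_form s' A X v h =
      (s - s') * (2 * (X v \<bullet> h) - 2 * (A v \<bullet> h) - (2 - s - s') * (A h \<bullet> h) + (1 - s - s') * (X h \<bullet> h))"
    unfolding karcher_form_def exp by (simp add: algebra_simps)
  have bnd: "\<bar>T x \<bullet> y\<bar> \<le> b * (norm x * norm y)" if "form_between a b T" for T and x y :: 'a
  proof -
    have "\<bar>T x \<bullet> y\<bar> \<le> norm (T x) * norm y" by (rule Cauchy_Schwarz_ineq2)
    also have "\<dots> \<le> (b * norm x) * norm y"
      by (intro mult_right_mono form_between_apply_upper[OF that a(1)]) simp
    finally show ?thesis by (simp add: mult.assoc)
  qed
  have 1: "\<bar>(2 - s - s') * (A h \<bullet> h)\<bar> \<le> 2 * (b * (norm h * norm h))"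
    unfolding abs_mult using s by (intro mult_mono bnd[OF A]) auto
  have 2: "\<bar>(1 - s - s') * (X h \<bullet> h)\<bar> \<le> 1 * (b * (norm h * norm h))"
    unfolding abs_mult using s by (intro mult_mono bnd[OF X]) auto
  have "\<bar>2 * (X v \<bullet> h) - 2 * (A v \<bullet> h) - (2 - s - s') * (A h \<bullet> h) + (1 - s - s') * (X h \<bullet> h)\<bar>
      \<le> 4 * b * (norm v * norm h) + 3 * b * (norm h)\<^sup>2"
    using 1 2 bnd[OF A, of v h] bnd[OF X, of v h] by (simp add: power2_eq_square)
  then have "\<bar>karcher_form s A X v h - karcher_form s' A X v h\<bar> \<le>
      \<bar>s - s'\<bar> * (4 * b * (norm v * norm h) + 3 * b * (norm h)\<^sup>2)"
    unfolding diff abs_mult by (intro mult_left_mono) auto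
  then show ?thesis by linarith
qed

text \<open>
  The form is affine in \<open>X\<close>; when \<open>X \<le> Y\<close>, the only term of the difference that does not contain \<open>(Y - X) v\<close> has
  a favourable sign.
\<close>

lemma karcher_form_change_base:
  "karcher_form s A X v h = karcher_form s A Y v h +
     ((Y - X) v \<bullet> v + 2 * (1 - s) * ((Y - X) v \<bullet> h) - s * (1 - s) * ((Y - X) h \<bullet> h))"
  by (simp add: karcher_form_def blinfun.diff_left inner_diff_left algebra_simps)

text \<open>
  Replacing \<open>X\<close> by \<open>c X\<close> has the effect of scaling the form by \<open>c\<close> and \<open>A\<close> by \<open>1 / c\<close>; the strict decrease in
  \<open>A\<close> produces the last term.
\<close>

lemma karcher_form_scale:
  "karcher_form s A (c *\<^sub>R X) v h =
     c * karcher_form s A X v h - (c - 1) * (A (v + (1 - s) *\<^sub>R h) \<bullet> (v + (1 - s) *\<^sub>R h))"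
  by (simp add: karcher_form_def blinfun.scaleR_left algebra_simps)

lemma selfadjoint_norm_le:
  assumes T: "T \<in> selfadjoint_ops" and e: "\<And>v. \<bar>T v \<bullet> v\<bar> \<le> e * (v \<bullet> v)" "0 \<le> e"
  shows "norm T \<le> 3 * e"
proof -
  have "form_between (- e) e T" unfolding form_between_def using T e(1) by (auto simp: abs_le_iff minus_le_iff)
  then have "form_between (- e + e) (e + e) (T + e *\<^sub>R id_blinfun)"
    by (intro form_between_add form_between_id)
  then have "norm (T + e *\<^sub>R id_blinfun) \<le> 2 * e"
    using e form_between_norm[of "e + e"] by simp
  moreover have "norm (e *\<^sub>R (id_blinfun :: 'a \<Rightarrow>\<^sub>L 'a)) \<le> e"
    using e norm_blinfun_id_le[where 'a='a] by (simp add: mult_left_le)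
  ultimately show ?thesis
    using norm_triangle_ineq4[of "T + e *\<^sub>R id_blinfun" "e *\<^sub>R id_blinfun"] by simp
qed

section \<open>Weak integrals of the Karcher operator\<close>

text \<open>
  The imaginary part of \<open>\<langle>T x, y\<rangle>\<close> is the real inner product of \<open>T x\<close> with \<open>\<i> y\<close>, so real parts suffice.
\<close>

lemma has_pettis_integral_iff:
  fixes g :: "'b \<Rightarrow> ('a::complex_hilbert \<Rightarrow>\<^sub>L 'a)"
  shows
  "has_pettis_integral \<mu> g T \<longleftrightarrow> T \<in> selfadjoint_ops \<and>
     (\<forall>x y. has_bochner_integral \<mu> (\<lambda>z. g z x \<bullet> y) (T x \<bullet> y))"
proof -
  have "has_bochner_integral \<mu> (\<lambda>z. cinner (g z x) y) (cinner (T x) y)"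
    if "\<forall>x y. has_bochner_integral \<mu> (\<lambda>z. g z x \<bullet> y) (T x \<bullet> y)" for x y
  proof -
    have c: "cinner u w = complex_of_real (u \<bullet> w) + \<i> * complex_of_real (u \<bullet> (\<i> *\<^sub>C w))" for u w :: 'a
      by (simp add: cinner_eq_Complex complex_eq_iff)
    show ?thesis unfolding c
      by (intro has_bochner_integral_add has_bochner_integral_of_real has_bochner_integral_mult_right)
        (use that in auto)
  qed
  moreover have "has_bochner_integral \<mu> (\<lambda>z. g z x \<bullet> y) (T x \<bullet> y)"
    if "\<forall>x y. has_bochner_integral \<mu> (\<lambda>z. cinner (g z x) y) (cinner (T x) y)" for x y
    using has_bochner_integral_Re[of \<mu> "\<lambda>z. cinner (g z x) y" "cinner (T x) y"] that
    by (simp add: Re_cinner)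
  ultimately show ?thesis unfolding has_pettis_integral_def by blast
qed

text \<open>
  The bounded support enters as almost everywhere bounds on the operator, which is the form in which integral estimates
  consume it.
\<close>

locale operator_measure = prob_space \<mu>
  for \<mu> :: "(real \<times> ('a::complex_hilbert \<Rightarrow>\<^sub>L 'a)) measure" +
  fixes \<alpha> \<beta> :: real
  assumes sets_eq: "sets \<mu> = sets (restrict_space borel ({0..1} \<times> posdef_ops))"
    and bounds: "0 < \<alpha>" "\<alpha> \<le> \<beta>"
    and AE_bounds: "AE z in \<mu>. form_between \<alpha> \<beta> (snd z)"
begin

lemma space_eq: "space \<mu> = {0..1} \<times> posdef_ops"
  using sets_eq_imp_space_eq[OF sets_eq] by (simp add: space_restrict_space)

lemma AE_bounded:
  assumes "\<And>s A. s \<in> {0..1} \<Longrightarrow> form_between \<alpha> \<beta> A \<Longrightarrow> P (s, A)"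
  shows "AE z in \<mu>. P z"
  using AE_bounds AE_space
proof eventually_elim
  case (elim z)
  then show ?case using assms[of "fst z" "snd z"] by (auto simp: space_eq)
qed

lemma common_bounds:
  assumes "form_between a b X" "0 < a"
  obtains a' b' where "0 < a'" "0 \<le> b'" "form_between a' b' X" "\<And>A :: 'a \<Rightarrow>\<^sub>L 'a. form_between \<alpha> \<beta> A \<Longrightarrow> form_between a' b' A"
proof
  show "0 < min a \<alpha>" "0 \<le> max b \<beta>" using assms bounds by auto
  show "form_between (min a \<alpha>) (max b \<beta>) X"
    by (rule form_between_mono[OF assms(1)]) auto
  show "form_between (min a \<alpha>) (max b \<beta>) A" if "form_between \<alpha> \<beta> A" for A :: "'a \<Rightarrow>\<^sub>L 'a"
    by (rule form_between_mono[OF that]) auto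
qed

text \<open>
  The integrand is continuous in \<open>(s, A)\<close> on the whole space, because inversion is norm continuous.
\<close>

lemma karcher_op_measurable:
  assumes X: "form_between a b X" "0 < a" and t: "t \<in> {0..1}"
  shows "(\<lambda>z. karcher_op (shift t (fst z)) (snd z) X x \<bullet> y) \<in> borel_measurable \<mu>"
proof -
  let ?K = "\<lambda>z. weighted_sum (shift t (fst z)) (snd z) X"
  let ?S = "{0..1::real} \<times> (posdef_ops :: ('a \<Rightarrow>\<^sub>L 'a) set)"
  have K: "continuous_on ?S ?K"
    unfolding weighted_sum_def shift_def by (intro continuous_intros)
  have inv: "?K z o\<^sub>L op_inv (?K z) = id_blinfun \<and> op_inv (?K z) o\<^sub>L ?K z = id_blinfun" if zS: "z \<in> ?S" for z
  proof -
    obtain c d where A: "c > 0" "form_between c d (snd z)" using zS posdef_iff[of "snd z"]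
      by (auto simp: mem_Times_iff)
    have "form_between (min a c) (max b d) (?K z)"
      using zS t by (intro form_between_weighted_sum form_between_mono[OF X(1)] form_between_mono[OF A(2)] shift_unit) auto
    then show ?thesis using op_inv X(2) A(1) by (metis min_less_iff_conj)
  qed
  have J: "continuous_on ?S (\<lambda>z. op_inv (?K z))"
    by (rule continuous_on_op_inv[OF K]) (use inv in auto)
  have "continuous_on ?S (\<lambda>z. karcher_op (shift t (fst z)) (snd z) X)"
    unfolding karcher_op_def
    by (intro continuous_on_diff continuous_on_scaleR bounded_bilinear.continuous_on[OF bounded_bilinear_blinfun_compose]
        J continuous_on_snd continuous_on_id continuous_on_const) (auto simp: shift_def intro!: continuous_intros)
  then have "continuous_on ?S (\<lambda>z. karcher_op (shift t (fst z)) (snd z) X x \<bullet> y)"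
    by (intro continuous_on_inner blinfun.continuous_on continuous_on_const)
  then have "(\<lambda>z. karcher_op (shift t (fst z)) (snd z) X x \<bullet> y) \<in> borel_measurable (restrict_space borel ?S)"
    by (rule borel_measurable_continuous_on_restrict)
  then show ?thesis by (simp add: measurable_cong_sets[OF sets_eq refl])
qed

lemma karcher_op_bounded:
  assumes X: "form_between a b X" "0 < a" and t: "t \<in> {0..1}"
  shows "\<exists>C\<ge>0. \<forall>x y. AE z in \<mu>. \<bar>karcher_op (shift t (fst z)) (snd z) X x \<bullet> y\<bar> \<le> C * norm x * norm y"
proof -
  obtain a' b' where ab: "0 < a'" "0 \<le> b'" "form_between a' b' X" "\<And>A :: 'a \<Rightarrow>\<^sub>L 'a. form_between \<alpha> \<beta> A \<Longrightarrow> form_between a' b' A"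
    using common_bounds[OF X] by blast
  define C where "C = 2 * b' + 4 * b'\<^sup>2 / a'"
  have "AE z in \<mu>. \<bar>karcher_op (shift t (fst z)) (snd z) X x \<bullet> y\<bar> \<le> C * norm x * norm y" for x y
  proof (rule AE_bounded)
    fix s :: real and A :: "'a \<Rightarrow>\<^sub>L 'a" assume s: "s \<in> {0..1}" and A: "form_between \<alpha> \<beta> A"
    have "\<bar>karcher_op (shift t s) A X x \<bullet> y\<bar> \<le> norm (karcher_op (shift t s) A X x) * norm y"
      by (rule Cauchy_Schwarz_ineq2)
    also have "\<dots> \<le> C * norm x * norm y"
      unfolding C_def
      by (intro mult_right_mono karcher_op_norm_apply[OF ab(4)[OF A] ab(3,1,2) shift_unit[OF s t]]) simp
    finally show "\<bar>karcher_op (shift t (fst (s, A))) (snd (s, A)) X x \<bullet> y\<bar> \<le> C * norm x * norm y" by simp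
  qed
  moreover have "0 \<le> C" using ab by (simp add: C_def)
  ultimately show ?thesis by blast
qed

lemma karcher_op_integrable:
  assumes X: "form_between a b X" "0 < a" and t: "t \<in> {0..1}"
  shows "integrable \<mu> (\<lambda>z. karcher_op (shift t (fst z)) (snd z) X x \<bullet> y)"
proof -
  obtain C where C: "\<forall>x y. AE z in \<mu>. \<bar>karcher_op (shift t (fst z)) (snd z) X x \<bullet> y\<bar> \<le> C * norm x * norm y"
    using karcher_op_bounded[OF assms] by blast
  show ?thesis
  proof (rule integrable_const_bound)
    show "AE z in \<mu>. norm (karcher_op (shift t (fst z)) (snd z) X x \<bullet> y) \<le> C * norm x * norm y"
      unfolding real_norm_def by (rule C[rule_format])
  qed (rule karcher_op_measurable[OF assms])
qed

lemma karcher_op_selfadjoint_space: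
  assumes X: "form_between a b X" "0 < a" and t: "t \<in> {0..1}" and z: "z \<in> space \<mu>"
  shows "karcher_op (shift t (fst z)) (snd z) X \<in> selfadjoint_ops"
proof -
  obtain c d where A: "c > 0" "form_between c d (snd z)" using z posdef_iff[of "snd z"]
    by (auto simp: space_eq mem_Times_iff)
  show ?thesis
    by (rule karcher_op_selfadjoint[OF form_between_mono[OF A(2), of "min a c" "max b d"]
          form_between_mono[OF X(1), of "min a c" "max b d"]])
      (use X A z t shift_unit[of "fst z" t] in \<open>auto simp: space_eq\<close>)
qed

definition is_karcher_integral :: "real \<Rightarrow> ('a \<Rightarrow>\<^sub>L 'a) \<Rightarrow> ('a \<Rightarrow>\<^sub>L 'a) \<Rightarrow> bool" where
  "is_karcher_integral t X T \<longleftrightarrow> T \<in> selfadjoint_ops \<and>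
     (\<forall>x y. T x \<bullet> y = (\<integral>z. karcher_op (shift t (fst z)) (snd z) X x \<bullet> y \<partial>\<mu>))"

text \<open>
  The integral is determined by its form. It exists for positive definite \<open>X\<close> and \<open>t\<close> in \<open>[0,1]\<close>.
\<close>

definition karcher_integral :: "real \<Rightarrow> ('a \<Rightarrow>\<^sub>L 'a) \<Rightarrow> ('a \<Rightarrow>\<^sub>L 'a)" where
  "karcher_integral t X = (SOME T. is_karcher_integral t X T)"

text \<open>
  For fixed \<open>x\<close>, the integral of \<open>\<langle>G x, y\<rangle>\<close> is a bounded functional of \<open>y\<close>, and Riesz representation gives the
  vector \<open>T x\<close>. Symmetry of the integrand yields linearity in \<open>x\<close>.
\<close>

lemma karcher_integral_exists:
  assumes X: "form_between a b X" "0 < a" and t: "t \<in> {0..1}"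
  shows "\<exists>T. is_karcher_integral t X T"
proof -
  let ?G = "\<lambda>z. karcher_op (shift t (fst z)) (snd z) X"
  define B where "B x y = (\<integral>z. ?G z x \<bullet> y \<partial>\<mu>)" for x y
  note int = karcher_op_integrable[OF assms]
  obtain C where C: "0 \<le> C" "\<forall>x y. AE z in \<mu>. \<bar>?G z x \<bullet> y\<bar> \<le> C * norm x * norm y"
    using karcher_op_bounded[OF assms] by blast
  have Bb: "\<bar>B x y\<bar> \<le> C * norm x * norm y" for x y
  proof -
    have "\<bar>B x y\<bar> \<le> (\<integral>z. \<bar>?G z x \<bullet> y\<bar> \<partial>\<mu>)" unfolding B_def by (rule integral_abs_bound)
    also have "\<dots> \<le> C * norm x * norm y"
      by (rule integral_le_const) (use int C(2) in auto)
    finally show ?thesis .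
  qed
  have Badd: "B x (y + y') = B x y + B x y'" for x y y'
    unfolding B_def inner_add_right by (rule Bochner_Integration.integral_add[OF int int])
  have Bscale: "B x (r *\<^sub>R y) = r * B x y" for r x y
    unfolding B_def inner_scaleR_right by simp
  have "\<exists>z. \<forall>y. B x y = z \<bullet> y" for x
  proof (rule riesz_representation)
    show "bounded_linear (B x)"
      by (rule bounded_linear_intro[where K="C * norm x"])
        (use Bb[of x] in \<open>auto simp: Badd Bscale mult_ac\<close>)
  qed
  then obtain j where j: "\<And>x y. B x y = j x \<bullet> y" by metis
  have jeq: "j x = u" if "\<And>y. B x y = u \<bullet> y" for x u
    using that unfolding j by (blast intro: vector_eq_rdot[THEN iffD1])
  have Bsym: "B x y = B y x" for x y
    unfolding B_def
  proof (rule Bochner_Integration.integral_cong[OF refl])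
    fix z assume "z \<in> space \<mu>"
    then show "?G z x \<bullet> y = ?G z y \<bullet> x"
      using selfadjoint_inner[OF karcher_op_selfadjoint_space[OF X t], of z x y] by (simp add: inner_commute)
  qed
  have Blin: "B (c *\<^sub>C x) y = B x (cnj c *\<^sub>C y)" for c x y
    unfolding B_def
  proof (rule Bochner_Integration.integral_cong[OF refl])
    fix z assume "z \<in> space \<mu>"
    then show "?G z (c *\<^sub>C x) \<bullet> y = ?G z x \<bullet> (cnj c *\<^sub>C y)"
      using selfadjoint_scaleC[OF karcher_op_selfadjoint_space[OF X t], of z c x] by (simp add: inner_scaleC_left)
  qed
  have "bounded_linear j"
  proof (rule bounded_linear_intro[where K=C])
    show "j (x + y) = j x + j y" for x y
    proof (rule jeq)
      fix w show "B (x + y) w = (j x + j y) \<bullet> w"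
        using Bsym[of "x + y" w] Bsym[of w x] Bsym[of w y] Badd[of w x y]
        by (simp add: inner_add_left flip: j)
    qed
    show "j (r *\<^sub>R x) = r *\<^sub>R j x" for r x
    proof (rule jeq)
      fix w show "B (r *\<^sub>R x) w = (r *\<^sub>R j x) \<bullet> w"
        using Bsym[of "r *\<^sub>R x" w] Bsym[of w x] Bscale[of w r x] by (simp flip: j)
    qed
    show "norm (j x) \<le> norm x * C" for x
    proof (cases "j x = 0")
      case False
      have "norm (j x) * norm (j x) \<le> C * norm x * norm (j x)"
        using Bb[of x "j x"] by (simp add: j power2_norm_eq_inner[symmetric] power2_eq_square)
      then show ?thesis using False by (simp add: mult.commute)
    qed (use C in simp)
  qed
  then have J: "Blinfun j x = j x" for x by (simp add: bounded_linear_Blinfun_apply)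
  have "is_karcher_integral t X (Blinfun j)"
    unfolding is_karcher_integral_def
  proof (intro conjI allI selfadjointI)
    show "Blinfun j x \<bullet> y = (\<integral>z. ?G z x \<bullet> y \<partial>\<mu>)" for x y
      using j[of x y] by (simp add: J B_def)
    show "Blinfun j x \<bullet> y = x \<bullet> Blinfun j y" for x y
      using Bsym[of x y] by (simp add: J j inner_commute)
    show "Blinfun j (c *\<^sub>C x) \<bullet> y = Blinfun j x \<bullet> (cnj c *\<^sub>C y)" for c x y
      using Blin[of c x y] by (simp add: J j)
  qed
  then show ?thesis by blast
qed

lemma karcher_integral:
  assumes X: "form_between a b X" "0 < a" and t: "t \<in> {0..1}"
  shows "karcher_integral t X \<in> selfadjoint_ops"
    and "has_bochner_integral \<mu> (\<lambda>z. karcher_op (shift t (fst z)) (snd z) X x \<bullet> y) (karcher_integral t X x \<bullet> y)"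
proof -
  have i: "is_karcher_integral t X (karcher_integral t X)"
    unfolding karcher_integral_def by (rule someI_ex[OF karcher_integral_exists[OF assms]])
  then show "karcher_integral t X \<in> selfadjoint_ops" by (simp add: is_karcher_integral_def)
  show "has_bochner_integral \<mu> (\<lambda>z. karcher_op (shift t (fst z)) (snd z) X x \<bullet> y) (karcher_integral t X x \<bullet> y)"
    using i has_bochner_integral_integrable[OF karcher_op_integrable[OF assms]]
    by (simp add: is_karcher_integral_def)
qed

text \<open>
  The bridge from the variational formula to integrals: \<open>c\<close> is the scaling factor of the base point and \<open>e\<close> the error of the
  pointwise comparison.
\<close>

lemma karcher_integral_le:
  assumes X: "form_between a b X" "0 < a" and Y: "form_between a' b' Y" "0 < a'"
    and t: "t \<in> {0..1}" and u: "u \<in> {0..1}"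
    and le: "\<And>s A. s \<in> {0..1} \<Longrightarrow> form_between \<alpha> \<beta> A \<Longrightarrow>
      karcher_op (shift t s) A X v \<bullet> v \<le> c * (karcher_op (shift u s) A Y v \<bullet> v) + e"
  shows "karcher_integral t X v \<bullet> v \<le> c * (karcher_integral u Y v \<bullet> v) + e"
proof -
  note iX = karcher_integral(2)[OF X t, of v v]
  note iY = karcher_integral(2)[OF Y u, of v v]
  have iR: "has_bochner_integral \<mu> (\<lambda>z. c * (karcher_op (shift u (fst z)) (snd z) Y v \<bullet> v) + e)
      (c * (karcher_integral u Y v \<bullet> v) + e)"
    using has_bochner_integral_add[OF has_bochner_integral_mult_right[OF iY, of c]
        has_bochner_integral_integrable[OF integrable_const[of e]]]
    by (simp add: prob_space)
  have "(\<integral>z. karcher_op (shift t (fst z)) (snd z) X v \<bullet> v \<partial>\<mu>)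
      \<le> (\<integral>z. c * (karcher_op (shift u (fst z)) (snd z) Y v \<bullet> v) + e \<partial>\<mu>)"
    by (rule integral_mono_AE[OF integrable.intros[OF iX] integrable.intros[OF iR]])
      (rule AE_bounded, simp add: le)
  then show ?thesis
    by (simp only: has_bochner_integral_integral_eq[OF iX] has_bochner_integral_integral_eq[OF iR])
qed

end

section \<open>Stability and uniqueness of solutions\<close>

text \<open>
  The least \<open>c \<ge> 1\<close> with \<open>X \<le> c Y\<close>. If \<open>c > 1\<close>, then \<open>c Y - X\<close> has no positive lower bound, since otherwise \<open>c\<close>
  could be decreased; in infinite dimension the touching vector exists only approximately.
\<close>

lemma order_scaling_infimum:
  fixes X Y :: "'a::complex_hilbert \<Rightarrow>\<^sub>L 'a"
  assumes X: "form_between a b X" and Y: "form_between a b Y" and a: "0 < a" "a \<le> b"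
  shows "\<exists>c\<ge>1. (\<forall>v. X v \<bullet> v \<le> c * (Y v \<bullet> v)) \<and>
    (c > 1 \<longrightarrow> (\<forall>e>0. \<exists>v. v \<noteq> 0 \<and> (c *\<^sub>R Y - X) v \<bullet> v < e * (v \<bullet> v)))"
proof -
  define I where "I = {c. 1 \<le> c \<and> (\<forall>v. X v \<bullet> v \<le> c * (Y v \<bullet> v))}"
  have "closed I" unfolding I_def
    by (intro closed_Collect_conj closed_Collect_all closed_Collect_le continuous_intros)
  moreover have ba: "b / a \<in> I"
  proof -
    have "X v \<bullet> v \<le> b / a * (Y v \<bullet> v)" for v
    proof -
      have "X v \<bullet> v \<le> b / a * (a * (v \<bullet> v))" using form_between_le[OF X, of v] a by simp
      also have "\<dots> \<le> b / a * (Y v \<bullet> v)"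
        by (intro mult_left_mono form_between_ge[OF Y]) (use a in auto)
      finally show ?thesis .
    qed
    then show ?thesis using a by (simp add: I_def)
  qed
  moreover have bdd: "bdd_below I" by (auto simp: I_def bdd_below_def)
  ultimately have c: "Inf I \<in> I" by (intro closed_contains_Inf) auto
  have sharp: "\<exists>v. v \<noteq> 0 \<and> (Inf I *\<^sub>R Y - X) v \<bullet> v < e * (v \<bullet> v)" if c1: "Inf I > 1" and e: "e > 0" for e
  proof (rule ccontr)
    assume "\<not> ?thesis"
    then have n: "e * (v \<bullet> v) \<le> (Inf I *\<^sub>R Y - X) v \<bullet> v" for v
      by (cases "v = 0") (auto simp: not_less blinfun.zero_right)
    define d where "d = min (e / b) (Inf I - 1)"
    have d: "d > 0" "d \<le> e / b" "1 \<le> Inf I - d" using e a c1 by (auto simp: d_def)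
    have "X v \<bullet> v \<le> (Inf I - d) * (Y v \<bullet> v)" for v
    proof -
      have Yv: "0 \<le> Y v \<bullet> v" using form_between_ge[OF Y, of v] a
        by (meson inner_ge_zero less_imp_le mult_nonneg_nonneg order_trans)
      have "d * (Y v \<bullet> v) \<le> e / b * (Y v \<bullet> v)" using d Yv by (intro mult_right_mono) auto
      also have "\<dots> \<le> e / b * (b * (v \<bullet> v))" using form_between_le[OF Y] e a by (intro mult_left_mono) auto
      also have "\<dots> = e * (v \<bullet> v)" using a by simp
      finally show ?thesis using n[of v]
        by (simp add: blinfun.diff_left blinfun.scaleR_left inner_diff_left algebra_simps)
    qed
    then have "Inf I - d \<in> I" using d by (simp add: I_def)
    then have "Inf I \<le> Inf I - d" by (intro cInf_lower bdd)
    then show False using d by simp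
  qed
  show ?thesis
    by (rule exI[of _ "Inf I"]) (use c sharp in \<open>auto simp: I_def\<close>)
qed

context operator_measure
begin

text \<open>
  Insert the minimiser \<open>h\<close> that belongs to \<open>Y\<close> into the formula for \<open>X\<close>. The three terms of the error are the change
  of weight, the change of base point from \<open>X\<close> to \<open>c Y\<close>, which involves \<open>(c Y - X) v\<close> only, and the
  gain of scaling \<open>Y\<close> by \<open>c\<close>.
\<close>

lemma comparison_at_touching_vector:
  assumes X: "form_between a b X" and Y: "form_between a b Y" and ab: "0 < a" "a \<le> \<alpha>" "\<beta> \<le> b"
    and t: "t \<in> {0..1}" and u: "u \<in> {0..1}" and c: "1 \<le> c"
    and XY: "\<And>v. X v \<bullet> v \<le> c * (Y v \<bullet> v)"
  defines "H \<equiv> 2 * b / a"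
  shows "karcher_integral t X v \<bullet> v \<le> c * (karcher_integral u Y v \<bullet> v) +
    (\<bar>t - u\<bar> * (b * (4 * H + 3 * H\<^sup>2)) * (v \<bullet> v) + (1 + 2 * H) * (norm ((c *\<^sub>R Y - X) v) * norm v)
      - (c - 1) * (a * (a / b)\<^sup>2) * (v \<bullet> v))"
proof (rule karcher_integral_le[OF X ab(1) Y ab(1) t u])
  fix s :: real and A :: "'a \<Rightarrow>\<^sub>L 'a" assume s: "s \<in> {0..1}" and A': "form_between \<alpha> \<beta> A"
  have A: "form_between a b A" by (rule form_between_mono[OF A' ab(2,3)])
  have b: "0 < b" using ab bounds by linarith
  have H: "0 \<le> H" using ab b by (simp add: H_def)
  note st = shift_unit[OF s t] and su = shift_unit[OF s u]
  define h where "h = karcher_min (shift u s) A Y v"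
  define w where "w = v + (1 - shift u s) *\<^sub>R h"
  define D where "D = c *\<^sub>R Y - X"
  have h: "norm h \<le> H * norm v" unfolding h_def H_def by (rule karcher_min_norm[OF A Y ab(1) su])
  have vh: "norm v * norm h \<le> H * (v \<bullet> v)"
    using mult_left_mono[OF h, of "norm v"] by (simp add: power2_norm_eq_inner[symmetric] power2_eq_square mult_ac)
  have hh: "(norm h)\<^sup>2 \<le> H\<^sup>2 * (v \<bullet> v)"
    using power_mono[OF h, of 2] by (simp add: power_mult_distrib power2_norm_eq_inner)
  have "karcher_op (shift t s) A X v \<bullet> v \<le> karcher_form (shift t s) A X v h"
    by (rule karcher_form_ge[OF A X ab(1) st])
  also have "\<dots> \<le> karcher_form (shift u s) A X v h +
      \<bar>shift t s - shift u s\<bar> * (4 * b * (norm v * norm h) + 3 * b * (norm h)\<^sup>2)"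
    by (rule karcher_form_change_weight[OF A X ab(1) _ st su]) (use b in simp)
  also have "\<bar>shift t s - shift u s\<bar> * (4 * b * (norm v * norm h) + 3 * b * (norm h)\<^sup>2)
      \<le> \<bar>t - u\<bar> * (4 * b * (H * (v \<bullet> v)) + 3 * b * (H\<^sup>2 * (v \<bullet> v)))"
    by (intro mult_mono add_mono mult_left_mono vh hh shift_diff[OF s] add_nonneg_nonneg mult_nonneg_nonneg)
      (use b in auto)
  finally have 1: "karcher_op (shift t s) A X v \<bullet> v \<le> karcher_form (shift u s) A X v h +
      \<bar>t - u\<bar> * (b * (4 * H + 3 * H\<^sup>2)) * (v \<bullet> v)" by (simp add: algebra_simps)
  have "0 \<le> D h \<bullet> h" using XY[of h]
    by (simp add: D_def blinfun.diff_left blinfun.scaleR_left inner_diff_left)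
  then have Dhh: "0 \<le> shift u s * (1 - shift u s) * (D h \<bullet> h)" using su by simp
  have Dvv: "D v \<bullet> v \<le> norm (D v) * norm v" by (rule norm_cauchy_schwarz)
  have "2 * (1 - shift u s) * (D v \<bullet> h) \<le> 2 * (norm (D v) * (H * norm v))"
  proof -
    have "(1 - shift u s) * (D v \<bullet> h) \<le> 1 * (norm (D v) * norm h)"
      using su norm_cauchy_schwarz[of "D v" h]
      by (smt (verit) atLeastAtMost_iff mult_left_le_one_le mult_left_mono mult_nonneg_nonneg norm_ge_zero mult_1)
    also have "\<dots> \<le> norm (D v) * (H * norm v)" using h by (simp add: mult_left_mono)
    finally show ?thesis by (simp only: mult.assoc)
  qed
  then have 2: "karcher_form (shift u s) A X v h \<le>
      karcher_form (shift u s) A (c *\<^sub>R Y) v h + (1 + 2 * H) * (norm (D v) * norm v)"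
    using karcher_form_change_base[of "shift u s" A X v h "c *\<^sub>R Y", folded D_def] Dhh Dvv
    by (simp add: algebra_simps)
  have "a * (a / b)\<^sup>2 * (v \<bullet> v) \<le> A w \<bullet> w"
    unfolding w_def h_def by (rule karcher_min_form_lower[OF A Y ab(1) b su])
  then have "(c - 1) * (a * (a / b)\<^sup>2 * (v \<bullet> v)) \<le> (c - 1) * (A w \<bullet> w)"
    using c by (intro mult_left_mono) auto
  moreover have "karcher_form (shift u s) A (c *\<^sub>R Y) v h =
      c * (karcher_op (shift u s) A Y v \<bullet> v) - (c - 1) * (A w \<bullet> w)"
    using karcher_form_scale[of "shift u s" A c Y v h] karcher_form_min[OF A Y ab(1) su, of v]
    by (simp add: h_def w_def)
  ultimately show "karcher_op (shift t s) A X v \<bullet> v \<le> c * (karcher_op (shift u s) A Y v \<bullet> v) +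
      (\<bar>t - u\<bar> * (b * (4 * H + 3 * H\<^sup>2)) * (v \<bullet> v) + (1 + 2 * H) * (norm ((c *\<^sub>R Y - X) v) * norm v)
      - (c - 1) * (a * (a / b)\<^sup>2) * (v \<bullet> v))"
    using 1 2 by (simp add: D_def mult.assoc)
qed

text \<open>
  For the least \<open>c\<close>, the vectors \<open>v\<close> with \<open>\<langle>(c Y - X) v, v\<rangle>\<close> small make \<open>(c Y - X) v\<close> small, so the comparison
  forces \<open>(c - 1) \<delta> \<le> E |t - u|\<close> in the limit.
\<close>

lemma one_sided_stability:
  assumes X: "form_between a b X" and Y: "form_between a b Y" and ab: "0 < a" "a \<le> \<alpha>" "\<beta> \<le> b"
    and t: "t \<in> {0..1}" and u: "u \<in> {0..1}"
    and X0: "karcher_integral t X = 0" and Y0: "karcher_integral u Y = 0"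
  defines "H \<equiv> 2 * b / a"
  defines "C \<equiv> (b * (4 * H + 3 * H\<^sup>2)) / (a * (a / b)\<^sup>2)"
  shows "X v \<bullet> v \<le> (1 + C * \<bar>t - u\<bar>) * (Y v \<bullet> v)"
proof -
  have ab': "a \<le> b" and b: "0 < b" using ab bounds by linarith+
  have H: "0 \<le> H" using ab b by (simp add: H_def)
  define \<delta> where "\<delta> = a * (a / b)\<^sup>2"
  have \<delta>: "\<delta> > 0" using ab b by (simp add: \<delta>_def)
  define E where "E = b * (4 * H + 3 * H\<^sup>2)"
  have E: "E \<ge> 0" using H b by (simp add: E_def)
  have C: "C = E / \<delta>" by (simp add: C_def E_def \<delta>_def)
  obtain c where c: "1 \<le> c" "\<forall>v. X v \<bullet> v \<le> c * (Y v \<bullet> v)"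
    and sharp: "c > 1 \<longrightarrow> (\<forall>e>0. \<exists>v. v \<noteq> 0 \<and> (c *\<^sub>R Y - X) v \<bullet> v < e * (v \<bullet> v))"
    using order_scaling_infimum[OF X Y ab(1) ab'] by blast
  define D where "D = c *\<^sub>R Y - X"
  have D: "form_between 0 (c * b) D" unfolding form_between_def
  proof (intro conjI allI)
    show "D \<in> selfadjoint_ops" unfolding D_def
      by (intro selfadjoint_diff selfadjoint_scaleR form_between_selfadjoint[OF X] form_between_selfadjoint[OF Y])
    fix v
    have q: "D v \<bullet> v = c * (Y v \<bullet> v) - X v \<bullet> v"
      by (simp add: D_def blinfun.diff_left blinfun.scaleR_left inner_diff_left)
    show "0 * (v \<bullet> v) \<le> D v \<bullet> v" using c(2) q by simp
    have "0 \<le> X v \<bullet> v" using form_between_ge[OF X, of v] ab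
      by (meson inner_ge_zero less_imp_le mult_nonneg_nonneg order_trans)
    moreover have "c * (Y v \<bullet> v) \<le> c * (b * (v \<bullet> v))"
      using c form_between_le[OF Y] by (intro mult_left_mono) auto
    ultimately show "D v \<bullet> v \<le> c * b * (v \<bullet> v)" using q by simp
  qed
  have key: "(c - 1) * \<delta> \<le> E * \<bar>t - u\<bar>"
  proof (rule ccontr)
    assume "\<not> ?thesis"
    then have g: "(c - 1) * \<delta> - E * \<bar>t - u\<bar> > 0" (is "?g > 0") by simp
    have "(c - 1) * \<delta> > 0" using g E by (smt (verit) mult_nonneg_nonneg abs_ge_zero)
    then have c1: "c > 1" using \<delta> by (simp add: zero_less_mult_iff)
    define k where "k = (1 + 2 * H)\<^sup>2 * (c * b)"
    have k: "k > 0" using H c1 b by (simp add: k_def)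
    \<comment> \<open>Chosen so that an \<open>e\<close>-almost touching vector contradicts the lower bound \<open>?g\<close>.\<close>
    define e where "e = ?g\<^sup>2 / k"
    have e: "e > 0" using g k by (simp add: e_def)
    obtain v where v: "v \<noteq> 0" "D v \<bullet> v < e * (v \<bullet> v)" using sharp c1 e unfolding D_def by blast
    have "0 \<le> \<bar>t - u\<bar> * E * (v \<bullet> v) + (1 + 2 * H) * (norm (D v) * norm v) - (c - 1) * \<delta> * (v \<bullet> v)"
      using comparison_at_touching_vector[OF X Y ab t u c(1) c(2)[rule_format], of v] X0 Y0
      by (simp add: E_def H_def \<delta>_def D_def)
    then have "?g * (v \<bullet> v) \<le> (1 + 2 * H) * (norm (D v) * norm v)" by (simp add: algebra_simps)
    then have "(?g * norm v) * norm v \<le> ((1 + 2 * H) * norm (D v)) * norm v"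
      by (simp add: power2_norm_eq_inner[symmetric] power2_eq_square mult.assoc)
    then have "?g * norm v \<le> (1 + 2 * H) * norm (D v)" using v(1) by simp
    then have "(?g * norm v)\<^sup>2 \<le> ((1 + 2 * H) * norm (D v))\<^sup>2" using g by (intro power_mono) auto
    then have "?g\<^sup>2 * (v \<bullet> v) \<le> (1 + 2 * H)\<^sup>2 * (D v \<bullet> D v)"
      by (simp only: power_mult_distrib power2_norm_eq_inner)
    also have "\<dots> \<le> (1 + 2 * H)\<^sup>2 * (c * b * (D v \<bullet> v))"
      by (intro mult_left_mono form_between_square[OF D]) simp
    also have "\<dots> = k * (D v \<bullet> v)" by (simp add: k_def)
    also have "\<dots> < k * (e * (v \<bullet> v))" using k v(2) by simp
    also have "\<dots> = ?g\<^sup>2 * (v \<bullet> v)" using k by (simp add: e_def)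
    finally show False by simp
  qed
  then have "c - 1 \<le> C * \<bar>t - u\<bar>" using \<delta> by (simp add: C field_simps)
  then have "c * (Y v \<bullet> v) \<le> (1 + C * \<bar>t - u\<bar>) * (Y v \<bullet> v)"
    using form_between_ge[OF Y, of v] ab
    by (intro mult_right_mono) (auto intro: order_trans[of 0 "a * (v \<bullet> v)"])
  then show ?thesis using c(2)[rule_format, of v] by linarith
qed

lemma solution_lipschitz_in_parameter:
  assumes ab: "0 < a" "a \<le> \<alpha>" "\<beta> \<le> b"
  shows "\<exists>C\<ge>0. \<forall>X Y t u. form_between a b X \<longrightarrow> form_between a b Y \<longrightarrow> t \<in> {0..1} \<longrightarrow> u \<in> {0..1} \<longrightarrow>
      karcher_integral t X = 0 \<longrightarrow> karcher_integral u Y = 0 \<longrightarrow> norm (X - Y) \<le> C * \<bar>t - u\<bar>"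
proof -
  have b: "0 < b" using ab bounds by linarith
  define H where "H = 2 * b / a"
  define C where "C = (b * (4 * H + 3 * H\<^sup>2)) / (a * (a / b)\<^sup>2)"
  have C: "0 \<le> C" using ab b by (simp add: C_def H_def)
  have "norm (X - Y) \<le> 3 * C * b * \<bar>t - u\<bar>"
    if X: "form_between a b X" and Y: "form_between a b Y" and t: "t \<in> {0..1}" and u: "u \<in> {0..1}"
      and X0: "karcher_integral t X = 0" and Y0: "karcher_integral u Y = 0" for X Y t u
  proof -
    have "norm (X - Y) \<le> 3 * (C * b * \<bar>t - u\<bar>)"
    proof (rule selfadjoint_norm_le)
      show "X - Y \<in> selfadjoint_ops"
        by (intro selfadjoint_diff form_between_selfadjoint[OF X] form_between_selfadjoint[OF Y])
      fix v
      have 1: "X v \<bullet> v \<le> (1 + C * \<bar>t - u\<bar>) * (Y v \<bullet> v)"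
        unfolding C_def H_def by (rule one_sided_stability[OF X Y ab t u X0 Y0])
      have 2: "Y v \<bullet> v \<le> (1 + C * \<bar>t - u\<bar>) * (X v \<bullet> v)"
        using one_sided_stability[OF Y X ab u t Y0 X0, of v] unfolding C_def H_def
        by (simp add: abs_minus_commute)
      have 3: "C * \<bar>t - u\<bar> * (X v \<bullet> v) \<le> C * \<bar>t - u\<bar> * (b * (v \<bullet> v))"
        "C * \<bar>t - u\<bar> * (Y v \<bullet> v) \<le> C * \<bar>t - u\<bar> * (b * (v \<bullet> v))"
        using C form_between_le[OF X, of v] form_between_le[OF Y, of v] by (auto intro!: mult_left_mono)
      show "\<bar>(X - Y) v \<bullet> v\<bar> \<le> C * b * \<bar>t - u\<bar> * (v \<bullet> v)"
        using 1 2 3 by (simp add: blinfun.diff_left inner_diff_left abs_le_iff algebra_simps)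
    qed (use C b in simp)
    then show ?thesis by (simp add: mult_ac)
  qed
  then show ?thesis using C b by (intro exI[of _ "3 * C * b"]) simp
qed

lemma solution_unique:
  assumes X: "X \<in> posdef_ops" and Y: "Y \<in> posdef_ops" and t: "t \<in> {0..1}"
    and X0: "karcher_integral t X = 0" and Y0: "karcher_integral t Y = 0"
  shows "X = Y"
proof -
  obtain a1 b1 where 1: "a1 > 0" "form_between a1 b1 X" using X posdef_iff by blast
  obtain a2 b2 where 2: "a2 > 0" "form_between a2 b2 Y" using Y posdef_iff by blast
  define a where "a = min \<alpha> (min a1 a2)"
  define b where "b = max \<beta> (max b1 b2)"
  have ab: "0 < a" "a \<le> \<alpha>" "\<beta> \<le> b" using 1 2 bounds by (auto simp: a_def b_def)
  have "form_between a b X" "form_between a b Y"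
    by (auto intro: form_between_mono[OF 1(2)] form_between_mono[OF 2(2)] simp: a_def b_def)
  moreover obtain C where "\<forall>X Y t u. form_between a b X \<longrightarrow> form_between a b Y \<longrightarrow> t \<in> {0..1} \<longrightarrow> u \<in> {0..1} \<longrightarrow>
      karcher_integral t X = 0 \<longrightarrow> karcher_integral u Y = 0 \<longrightarrow> norm (X - Y) \<le> C * \<bar>t - u\<bar>"
    using solution_lipschitz_in_parameter[OF ab] by blast
  ultimately have "norm (X - Y) \<le> C * \<bar>t - t\<bar>" using t X0 Y0 by blast
  then show ?thesis by simp
qed

section \<open>Existence for positive parameters\<close>

text \<open>
  For \<open>0 < t \<le> 1\<close> and positive definite \<open>X\<close> this is the weak integral of \<open>M\<^sub>s\<^sub>,\<^sub>t(X, A)\<close>; its fixed points are the solutions with parameter \<open>t\<close>.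
\<close>

definition mean_step :: "real \<Rightarrow> ('a \<Rightarrow>\<^sub>L 'a) \<Rightarrow> ('a \<Rightarrow>\<^sub>L 'a)" where
  "mean_step t X = X + t *\<^sub>R karcher_integral t X"

lemma mean_step_form: "mean_step t X v \<bullet> v = X v \<bullet> v + t * (karcher_integral t X v \<bullet> v)"
  by (simp add: mean_step_def blinfun.add_left blinfun.scaleR_left inner_add_left)

text \<open>
  With \<open>D = Y - X \<ge> 0\<close> and the minimiser \<open>h\<close> for \<open>Y\<close>, the claim reduces to the nonnegativity of
  \<open>(1 - t) \<langle>D v, v\<rangle> - 2 t (1 - r) \<langle>D v, h\<rangle> + t r (1 - r) \<langle>D h, h\<rangle>\<close>. As \<open>t \<le> r\<close>, this is at least
  \<open>(1 - r) \<langle>D (v - t h), v - t h\<rangle>\<close>.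
\<close>

lemma mean_step_mono:
  assumes X: "form_between a b X" "0 < a" and Y: "form_between a b Y" and t: "t \<in> {0..1}"
    and XY: "\<And>v. X v \<bullet> v \<le> Y v \<bullet> v"
  shows "mean_step t X v \<bullet> v \<le> mean_step t Y v \<bullet> v"
proof (cases "t = 0")
  case True
  then show ?thesis using XY by (simp add: mean_step_form)
next
  case False
  then have t0: "t > 0" using t by auto
  define D where "D = Y - X"
  have "karcher_integral t X v \<bullet> v \<le> 1 * (karcher_integral t Y v \<bullet> v) + (D v \<bullet> v) / t"
  proof (rule karcher_integral_le[OF X Y X(2) t t])
    fix s :: real and A :: "'a \<Rightarrow>\<^sub>L 'a" assume s: "s \<in> {0..1}" and A': "form_between \<alpha> \<beta> A"
    define a' where "a' = min a \<alpha>"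
    define b' where "b' = max b \<beta>"
    have a': "0 < a'" using X bounds by (simp add: a'_def)
    have A: "form_between a' b' A" by (rule form_between_mono[OF A']) (auto simp: a'_def b'_def)
    have X': "form_between a' b' X" by (rule form_between_mono[OF X(1)]) (auto simp: a'_def b'_def)
    have Y': "form_between a' b' Y" by (rule form_between_mono[OF Y]) (auto simp: a'_def b'_def)
    define r where "r = shift t s"
    have r: "r \<in> {0..1}" "t \<le> r" using shift_unit[OF s t] shift_ge[OF s t] by (auto simp: r_def)
    define h where "h = karcher_min r A Y v"
    have Dsym: "D h \<bullet> v = D v \<bullet> h"
      by (metis D_def inner_commute selfadjoint_diff selfadjoint_inner form_between_selfadjoint X(1) Y)
    have D: "0 \<le> D x \<bullet> x" for x using XY[of x] by (simp add: D_def blinfun.diff_left inner_diff_left)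
    have "0 \<le> D (v - t *\<^sub>R h) \<bullet> (v - t *\<^sub>R h)" by (rule D)
    also have "\<dots> = D v \<bullet> v - 2 * t * (D v \<bullet> h) + t * t * (D h \<bullet> h)"
      by (simp add: blinfun.diff_right blinfun.scaleR_right inner_diff_left inner_diff_right Dsym algebra_simps)
    finally have "0 \<le> (1 - r) * (D v \<bullet> v - 2 * t * (D v \<bullet> h) + t * t * (D h \<bullet> h))"
      using r by (intro mult_nonneg_nonneg) auto
    moreover have "(1 - r) * (D v \<bullet> v) \<le> (1 - t) * (D v \<bullet> v)"
      using r D by (intro mult_right_mono) auto
    moreover have "(1 - r) * (t * t * (D h \<bullet> h)) \<le> (1 - r) * (t * r * (D h \<bullet> h))"
      using r D t0 by (intro mult_left_mono mult_right_mono) auto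
    ultimately have "t * (D v \<bullet> v + 2 * (1 - r) * (D v \<bullet> h) - r * (1 - r) * (D h \<bullet> h)) \<le> D v \<bullet> v"
      by (simp add: algebra_simps)
    then have "D v \<bullet> v + 2 * (1 - r) * (D v \<bullet> h) - r * (1 - r) * (D h \<bullet> h) \<le> (D v \<bullet> v) / t"
      using t0 by (simp add: field_simps)
    moreover have "karcher_op r A X v \<bullet> v \<le> karcher_form r A X v h"
      by (rule karcher_form_ge[OF A X' a' r(1)])
    moreover have "karcher_form r A X v h = karcher_op r A Y v \<bullet> v +
        (D v \<bullet> v + 2 * (1 - r) * (D v \<bullet> h) - r * (1 - r) * (D h \<bullet> h))"
      using karcher_form_change_base[of r A X v h Y] karcher_form_min[OF A Y' a' r(1), of v]
      by (simp add: D_def h_def)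
    ultimately show "karcher_op (shift t s) A X v \<bullet> v \<le> 1 * (karcher_op (shift t s) A Y v \<bullet> v) + (D v \<bullet> v) / t"
      by (simp add: r_def)
  qed
  then have "t * (karcher_integral t X v \<bullet> v) \<le> t * (karcher_integral t Y v \<bullet> v + (D v \<bullet> v) / t)"
    using t0 by (intro mult_left_mono) auto
  then have "t * (karcher_integral t X v \<bullet> v) \<le> t * (karcher_integral t Y v \<bullet> v) + D v \<bullet> v"
    using t0 by (simp add: distrib_left)
  then show ?thesis by (simp add: mean_step_form D_def blinfun.diff_left inner_diff_left)
qed

text \<open>
  At \<open>X = \<beta> I\<close> the choice \<open>h = 0\<close> in the variational formula gives \<open>\<langle>(A - \<beta> I) v, v\<rangle> \<le> 0\<close>.
\<close>

lemma mean_step_upper: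
  assumes t: "t \<in> {0..1}"
  shows "mean_step t (\<beta> *\<^sub>R id_blinfun) v \<bullet> v \<le> \<beta> * (v \<bullet> v)"
proof -
  let ?X = "\<beta> *\<^sub>R id_blinfun :: 'a \<Rightarrow>\<^sub>L 'a"
  have X: "form_between \<alpha> \<beta> ?X" using form_between_mono[OF form_between_id[of \<beta>], of \<alpha> \<beta>] bounds by simp
  have "karcher_integral t ?X v \<bullet> v \<le> 0 * (karcher_integral t ?X v \<bullet> v) + 0"
  proof (rule karcher_integral_le[OF X bounds(1) X bounds(1) t t])
    fix s :: real and A :: "'a \<Rightarrow>\<^sub>L 'a" assume s: "s \<in> {0..1}" and A: "form_between \<alpha> \<beta> A"
    have "karcher_op (shift t s) A ?X v \<bullet> v \<le> karcher_form (shift t s) A ?X v 0"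
      by (rule karcher_form_ge[OF A X bounds(1) shift_unit[OF s t]])
    also have "\<dots> \<le> 0" using form_between_le[OF A, of v]
      by (simp add: karcher_form_def blinfun.scaleR_left)
    finally show "karcher_op (shift t s) A ?X v \<bullet> v \<le> 0 * (karcher_op (shift t s) A ?X v \<bullet> v) + 0" by simp
  qed
  then have "t * (karcher_integral t ?X v \<bullet> v) \<le> 0" using t by (simp add: mult_nonneg_nonpos)
  then show ?thesis by (simp add: mean_step_form blinfun.scaleR_left)
qed

text \<open>
  At \<open>X = \<alpha> I\<close>, replacing \<open>A\<close> by its lower bound \<open>\<alpha> I\<close> turns the form into \<open>\<alpha> (1 - r) \<parallel>h\<parallel>\<^sup>2\<close>.
\<close>

lemma mean_step_lower:
  assumes t: "t \<in> {0..1}"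
  shows "\<alpha> * (v \<bullet> v) \<le> mean_step t (\<alpha> *\<^sub>R id_blinfun) v \<bullet> v"
proof -
  let ?X = "\<alpha> *\<^sub>R id_blinfun :: 'a \<Rightarrow>\<^sub>L 'a"
  have X: "form_between \<alpha> \<beta> ?X" using form_between_mono[OF form_between_id[of \<alpha>], of \<alpha> \<beta>] bounds by simp
  have pos: "0 \<le> karcher_op (shift t s) A ?X v \<bullet> v" if s: "s \<in> {0..1}" and A: "form_between \<alpha> \<beta> A" for s A
  proof -
    define r where "r = shift t s"
    have r: "r \<in> {0..1}" using shift_unit[OF s t] by (simp add: r_def)
    define h where "h = karcher_min r A ?X v"
    define w where "w = v + (1 - r) *\<^sub>R h"
    have "0 \<le> \<alpha> * ((1 - r) * (h \<bullet> h))" using bounds r by simp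
    also have "\<dots> = \<alpha> * (w \<bullet> w) - \<alpha> * (v \<bullet> v) - 2 * (1 - r) * (\<alpha> * (v \<bullet> h)) + r * (1 - r) * (\<alpha> * (h \<bullet> h))"
      by (simp add: w_def inner_add_left inner_add_right inner_commute[of h v] algebra_simps)
    also have "\<dots> \<le> karcher_form r A ?X v h"
      using form_between_ge[OF A, of w] by (simp add: karcher_form_def w_def blinfun.scaleR_left)
    also have "\<dots> = karcher_op r A ?X v \<bullet> v"
      unfolding h_def by (rule karcher_form_min[OF A X bounds(1) r])
    finally show ?thesis by (simp add: r_def)
  qed
  have "karcher_integral t ?X v \<bullet> v \<ge> 0"
  proof -
    note i = karcher_integral(2)[OF X bounds(1) t, of v v]
    have "0 \<le> (\<integral>z. karcher_op (shift t (fst z)) (snd z) ?X v \<bullet> v \<partial>\<mu>)"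
      by (rule integral_nonneg_AE) (rule AE_bounded, simp add: pos)
    then show ?thesis by (simp only: has_bochner_integral_integral_eq[OF i])
  qed
  then have "t * (karcher_integral t ?X v \<bullet> v) \<ge> 0" using t by simp
  then show ?thesis by (simp add: mean_step_form blinfun.scaleR_left)
qed

lemma mean_step_between:
  assumes X: "form_between \<alpha> \<beta> X" and t: "t \<in> {0..1}"
  shows "form_between \<alpha> \<beta> (mean_step t X)"
  unfolding form_between_def
proof (intro conjI allI)
  have l: "form_between \<alpha> \<beta> (\<alpha> *\<^sub>R id_blinfun :: 'a \<Rightarrow>\<^sub>L 'a)"
    using form_between_mono[OF form_between_id[of \<alpha>], of \<alpha> \<beta>] bounds by simp
  have u: "form_between \<alpha> \<beta> (\<beta> *\<^sub>R id_blinfun :: 'a \<Rightarrow>\<^sub>L 'a)"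
    using form_between_mono[OF form_between_id[of \<beta>], of \<alpha> \<beta>] bounds by simp
  show "mean_step t X \<in> selfadjoint_ops" unfolding mean_step_def
    by (intro selfadjoint_add selfadjoint_scaleR form_between_selfadjoint[OF X] karcher_integral(1)[OF X bounds(1) t])
  fix v
  show "\<alpha> * (v \<bullet> v) \<le> mean_step t X v \<bullet> v"
    by (rule order_trans[OF mean_step_lower[OF t] mean_step_mono[OF l bounds(1) X t]])
      (simp add: blinfun.scaleR_left form_between_ge[OF X])
  show "mean_step t X v \<bullet> v \<le> \<beta> * (v \<bullet> v)"
    by (rule order_trans[OF mean_step_mono[OF X bounds(1) u t] mean_step_upper[OF t]])
      (simp add: blinfun.scaleR_left form_between_le[OF X])
qed

text \<open>
  By monotonicity it suffices to treat \<open>c Y\<close>, where the gain of scaling is bounded below by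
  \<open>(c - 1) \<delta> \<parallel>v\<parallel>\<^sup>2\<close>, and hence by a multiple of the form of the image of \<open>Y\<close>, which is at most \<open>\<beta>\<close>.
\<close>

lemma mean_step_subhomogeneous:
  assumes X: "form_between \<alpha> \<beta> X" and Y: "form_between \<alpha> \<beta> Y" and t: "t \<in> {0..1}" and c: "1 \<le> c"
    and XY: "\<And>v. X v \<bullet> v \<le> c * (Y v \<bullet> v)"
  defines "\<rho> \<equiv> 1 - t * (\<alpha> * (\<alpha> / \<beta>)\<^sup>2) / \<beta>"
  shows "mean_step t X v \<bullet> v \<le> (1 + (c - 1) * \<rho>) * (mean_step t Y v \<bullet> v)"
proof -
  define \<delta> where "\<delta> = \<alpha> * (\<alpha> / \<beta>)\<^sup>2"
  have \<beta>: "0 < \<beta>" using bounds by linarith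
  have \<delta>: "0 \<le> \<delta>" using bounds by (simp add: \<delta>_def)
  have cY: "form_between \<alpha> (c * \<beta>) (c *\<^sub>R Y)"
    by (rule form_between_mono[OF form_between_scaleR[OF Y, of c]]) (use c bounds in auto)
  have X': "form_between \<alpha> (c * \<beta>) X" by (rule form_between_mono[OF X]) (use c bounds in auto)
  have 1: "mean_step t X v \<bullet> v \<le> mean_step t (c *\<^sub>R Y) v \<bullet> v"
    by (rule mean_step_mono[OF X' bounds(1) cY t]) (simp add: blinfun.scaleR_left XY)
  have "karcher_integral t (c *\<^sub>R Y) v \<bullet> v \<le> c * (karcher_integral t Y v \<bullet> v) + - (c - 1) * \<delta> * (v \<bullet> v)"
  proof (rule karcher_integral_le[OF cY bounds(1) Y bounds(1) t t])
    fix s :: real and A :: "'a \<Rightarrow>\<^sub>L 'a" assume s: "s \<in> {0..1}" and A: "form_between \<alpha> \<beta> A"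
    define r where "r = shift t s"
    have r: "r \<in> {0..1}" using shift_unit[OF s t] by (simp add: r_def)
    have A': "form_between \<alpha> (c * \<beta>) A" by (rule form_between_mono[OF A]) (use c bounds in auto)
    define h where "h = karcher_min r A Y v"
    define w where "w = v + (1 - r) *\<^sub>R h"
    have "\<delta> * (v \<bullet> v) \<le> A w \<bullet> w"
      unfolding w_def h_def \<delta>_def by (rule karcher_min_form_lower[OF A Y bounds(1) \<beta> r])
    then have "(c - 1) * (\<delta> * (v \<bullet> v)) \<le> (c - 1) * (A w \<bullet> w)" using c by (intro mult_left_mono) auto
    moreover have "karcher_op r A (c *\<^sub>R Y) v \<bullet> v \<le> karcher_form r A (c *\<^sub>R Y) v h"
      by (rule karcher_form_ge[OF A' cY bounds(1) r])
    moreover have "karcher_form r A (c *\<^sub>R Y) v h = c * (karcher_op r A Y v \<bullet> v) - (c - 1) * (A w \<bullet> w)"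
      using karcher_form_scale[of r A c Y v h] karcher_form_min[OF A Y bounds(1) r, of v]
      by (simp add: h_def w_def)
    ultimately show "karcher_op (shift t s) A (c *\<^sub>R Y) v \<bullet> v \<le>
        c * (karcher_op (shift t s) A Y v \<bullet> v) + - (c - 1) * \<delta> * (v \<bullet> v)"
      by (simp add: r_def algebra_simps)
  qed
  then have "mean_step t (c *\<^sub>R Y) v \<bullet> v \<le> c * (mean_step t Y v \<bullet> v) - t * (c - 1) * \<delta> * (v \<bullet> v)"
    using mult_left_mono[of "karcher_integral t (c *\<^sub>R Y) v \<bullet> v"
        "c * (karcher_integral t Y v \<bullet> v) + - (c - 1) * \<delta> * (v \<bullet> v)" t] t
    by (simp add: mean_step_form blinfun.scaleR_left algebra_simps)
  also have "\<dots> \<le> (1 + (c - 1) * \<rho>) * (mean_step t Y v \<bullet> v)"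
  proof -
    have "t * (c - 1) * \<delta> / \<beta> * (mean_step t Y v \<bullet> v) \<le> t * (c - 1) * \<delta> / \<beta> * (\<beta> * (v \<bullet> v))"
      using t c \<delta> \<beta> by (intro mult_left_mono form_between_le[OF mean_step_between[OF Y t]]) auto
    also have "\<dots> = t * (c - 1) * \<delta> * (v \<bullet> v)" using \<beta> by simp
    finally show ?thesis by (simp add: \<rho>_def \<delta>_def[symmetric] algebra_simps)
  qed
  finally show ?thesis using 1 by linarith
qed

end

lemma has_bochner_integral_eq_on_space:
  assumes "has_bochner_integral M f c" "\<And>z. z \<in> space M \<Longrightarrow> g z = f z"
  shows "has_bochner_integral M g c"
  using assms has_bochner_integral_cong[of M M g f c c] by simp

context operator_measure
begin

lemma contraction_factor_nonneg:
  assumes t: "t \<in> {0..1}"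
  shows "0 \<le> 1 - t * (\<alpha> * (\<alpha> / \<beta>)\<^sup>2) / \<beta>"
proof -
  define q where "q = \<alpha> / \<beta>"
  have q: "0 \<le> q" "q \<le> 1" using bounds by (auto simp: q_def)
  have "t * (q * q\<^sup>2) \<le> 1" using q t by (intro mult_le_one power_le_one) auto
  then show ?thesis by (simp add: q_def mult_ac)
qed

text \<open>
  Monotonicity of the step keeps the iterates \<open>U\<close> from the top above the iterates \<open>W\<close> from the bottom and makes both
  sequences monotone; subhomogeneity multiplies the excess of their ratio over one by \<open>\<rho>\<close> each time.
\<close>

lemma monotone_iterates:
  assumes t: "t \<in> {0..1}"
  defines "U \<equiv> \<lambda>n. (mean_step t ^^ n) (\<beta> *\<^sub>R id_blinfun)"
    and "W \<equiv> \<lambda>n. (mean_step t ^^ n) (\<alpha> *\<^sub>R id_blinfun)"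
    and "\<rho> \<equiv> 1 - t * (\<alpha> * (\<alpha> / \<beta>)\<^sup>2) / \<beta>"
  shows "form_between \<alpha> \<beta> (U n)" "form_between \<alpha> \<beta> (W n)"
    and "W n v \<bullet> v \<le> U n v \<bullet> v"
    and "U (Suc n) v \<bullet> v \<le> U n v \<bullet> v" "W n v \<bullet> v \<le> W (Suc n) v \<bullet> v"
    and "U n v \<bullet> v \<le> (1 + (\<beta> / \<alpha> - 1) * \<rho> ^ n) * (W n v \<bullet> v)"
proof -
  have U0: "U 0 = \<beta> *\<^sub>R id_blinfun" and US: "U (Suc n) = mean_step t (U n)" for n by (auto simp: U_def)
  have W0: "W 0 = \<alpha> *\<^sub>R id_blinfun" and WS: "W (Suc n) = mean_step t (W n)" for n by (auto simp: W_def)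
  have Ub: "form_between \<alpha> \<beta> (U n)" for n
  proof (induction n)
    case 0 show ?case using form_between_mono[OF form_between_id[of \<beta>], of \<alpha> \<beta>] bounds by (simp add: U0)
  next
    case (Suc n) show ?case unfolding US by (rule mean_step_between[OF Suc t])
  qed
  have Wb: "form_between \<alpha> \<beta> (W n)" for n
  proof (induction n)
    case 0 show ?case using form_between_mono[OF form_between_id[of \<alpha>], of \<alpha> \<beta>] bounds by (simp add: W0)
  next
    case (Suc n) show ?case unfolding WS by (rule mean_step_between[OF Suc t])
  qed
  show "form_between \<alpha> \<beta> (U n)" "form_between \<alpha> \<beta> (W n)" by (rule Ub, rule Wb)
  show "W n v \<bullet> v \<le> U n v \<bullet> v"
  proof (induction n arbitrary: v)
    case 0 show ?case using bounds by (simp add: U0 W0 blinfun.scaleR_left mult_right_mono)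
  next
    case (Suc n) show ?case unfolding US WS by (rule mean_step_mono[OF Wb bounds(1) Ub t Suc])
  qed
  show "U (Suc n) v \<bullet> v \<le> U n v \<bullet> v"
  proof (induction n arbitrary: v)
    case 0 show ?case using mean_step_upper[OF t, of v] by (simp add: US U0 blinfun.scaleR_left)
  next
    case (Suc n)
    show ?case using mean_step_mono[OF Ub bounds(1) Ub t Suc] by (simp add: US)
  qed
  show "W n v \<bullet> v \<le> W (Suc n) v \<bullet> v"
  proof (induction n arbitrary: v)
    case 0 show ?case using mean_step_lower[OF t, of v] by (simp add: WS W0 blinfun.scaleR_left)
  next
    case (Suc n)
    show ?case using mean_step_mono[OF Wb bounds(1) Wb t Suc] by (simp add: WS)
  qed
  have \<rho>: "0 \<le> \<rho>" unfolding \<rho>_def by (rule contraction_factor_nonneg[OF t])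
  show "U n v \<bullet> v \<le> (1 + (\<beta> / \<alpha> - 1) * \<rho> ^ n) * (W n v \<bullet> v)"
  proof (induction n arbitrary: v)
    case 0 show ?case using bounds by (simp add: U0 W0 blinfun.scaleR_left)
  next
    case (Suc n)
    let ?c = "1 + (\<beta> / \<alpha> - 1) * \<rho> ^ n"
    have c: "1 \<le> ?c" using bounds \<rho> by simp
    show ?case
      using mean_step_subhomogeneous[OF Ub Wb t c Suc, of v, folded \<rho>_def] by (simp add: US WS mult_ac)
  qed
qed

lemma monotone_iterates_mono:
  assumes t: "t \<in> {0..1}" and mn: "m \<le> n"
  shows "(mean_step t ^^ n) (\<beta> *\<^sub>R id_blinfun) v \<bullet> v \<le> (mean_step t ^^ m) (\<beta> *\<^sub>R id_blinfun) v \<bullet> v"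
    and "(mean_step t ^^ m) (\<alpha> *\<^sub>R id_blinfun) v \<bullet> v \<le> (mean_step t ^^ n) (\<alpha> *\<^sub>R id_blinfun) v \<bullet> v"
  using lift_Suc_antimono_le[of "\<lambda>n. (mean_step t ^^ n) (\<beta> *\<^sub>R id_blinfun) v \<bullet> v" m n]
    lift_Suc_mono_le[of "\<lambda>n. (mean_step t ^^ n) (\<alpha> *\<^sub>R id_blinfun) v \<bullet> v" m n]
    monotone_iterates(4,5)[OF t] mn by simp_all

text \<open>
  The upper iterates are Cauchy because all later ones lie between \<open>W\<^sub>n\<close> and \<open>U\<^sub>n\<close>. Their limit and its image
  under the step both lie between \<open>W\<^sub>n\<close> and \<open>U\<^sub>n\<close> for every \<open>n > 0\<close>, so they coincide.
\<close>

lemma solution_exists_pos: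
  assumes t: "0 < t" "t \<le> 1"
  shows "\<exists>X. form_between \<alpha> \<beta> X \<and> karcher_integral t X = 0"
proof -
  have t': "t \<in> {0..1}" using t by simp
  define U where "U n = (mean_step t ^^ n) (\<beta> *\<^sub>R id_blinfun)" for n
  define W where "W n = (mean_step t ^^ n) (\<alpha> *\<^sub>R id_blinfun)" for n
  define \<rho> where "\<rho> = 1 - t * (\<alpha> * (\<alpha> / \<beta>)\<^sup>2) / \<beta>"
  define \<epsilon> where "\<epsilon> n = (\<beta> / \<alpha> - 1) * \<rho> ^ n * \<beta>" for n
  note it = monotone_iterates[OF t', folded U_def W_def \<rho>_def]
  note mono = monotone_iterates_mono[OF t', folded U_def W_def]
  have \<beta>: "0 < \<beta>" using bounds by linarith
  have \<rho>: "0 \<le> \<rho>" "\<rho> < 1"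
  proof -
    show "0 \<le> \<rho>" unfolding \<rho>_def by (rule contraction_factor_nonneg[OF t'])
    show "\<rho> < 1" using t bounds \<beta> by (simp add: \<rho>_def)
  qed
  have \<epsilon>0: "0 \<le> \<epsilon> n" for n using bounds \<beta> \<rho> by (simp add: \<epsilon>_def)
  have "(\<lambda>n. (\<beta> / \<alpha> - 1) * \<rho> ^ n * \<beta>) \<longlonglongrightarrow> (\<beta> / \<alpha> - 1) * 0 * \<beta>"
    by (intro tendsto_mult tendsto_const LIMSEQ_realpow_zero \<rho>)
  then have \<epsilon>: "\<epsilon> \<longlonglongrightarrow> 0" by (simp add: \<epsilon>_def[abs_def])
  have gap: "U n v \<bullet> v - W n v \<bullet> v \<le> \<epsilon> n * (v \<bullet> v)" for n v
  proof -
    have "(\<beta> / \<alpha> - 1) * \<rho> ^ n * (W n v \<bullet> v) \<le> (\<beta> / \<alpha> - 1) * \<rho> ^ n * (\<beta> * (v \<bullet> v))"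
      using bounds \<rho> by (intro mult_left_mono form_between_le[OF it(2)]) auto
    then show ?thesis using it(6)[of n v] by (simp add: \<epsilon>_def algebra_simps)
  qed
  have Ud: "norm (U m - U n) \<le> 3 * \<epsilon> n" if mn: "n \<le> m" for m n
  proof (rule selfadjoint_norm_le)
    show "U m - U n \<in> selfadjoint_ops" by (intro selfadjoint_diff form_between_selfadjoint[OF it(1)])
    show "\<bar>(U m - U n) v \<bullet> v\<bar> \<le> \<epsilon> n * (v \<bullet> v)" for v
      using gap[of n v] mono[OF mn, of v] it(3)[of m v] by (simp add: blinfun.diff_left inner_diff_left)
  qed (rule \<epsilon>0)
  have "Cauchy U"
  proof (rule metric_CauchyI)
    fix e :: real assume e: "0 < e"
    then have "\<forall>\<^sub>F n in sequentially. \<epsilon> n < e / 6" using \<epsilon> by (intro order_tendstoD(2)) auto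
    then obtain N where N: "\<epsilon> N < e / 6" unfolding eventually_sequentially by blast
    have "dist (U m) (U n) < e" if "m \<ge> N" "n \<ge> N" for m n
      using Ud[OF that(1)] Ud[OF that(2)] N norm_triangle_ineq4[of "U m - U N" "U n - U N"] e
      by (simp add: dist_norm)
    then show "\<exists>M. \<forall>m\<ge>M. \<forall>n\<ge>M. dist (U m) (U n) < e" by blast
  qed
  then obtain X where X: "U \<longlonglongrightarrow> X" using Cauchy_convergent convergent_def by blast
  have Xb: "form_between \<alpha> \<beta> X" by (rule form_between_limit[OF it(1) X])
  have l: "(\<lambda>n. U n v \<bullet> v) \<longlonglongrightarrow> X v \<bullet> v" for v
    by (intro tendsto_inner blinfun.tendsto tendsto_const X)
  have XU: "X v \<bullet> v \<le> U n v \<bullet> v" for n v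
    by (rule LIMSEQ_le_const2[OF l]) (use mono(1) in blast)
  have WX: "W n v \<bullet> v \<le> X v \<bullet> v" for n v
    by (rule LIMSEQ_le_const[OF l]) (use mono(2)[of n _ v] it(3)[of _ v] order_trans in blast)
  have TU: "mean_step t X v \<bullet> v \<le> U (Suc n) v \<bullet> v" for n v
    using mean_step_mono[OF Xb bounds(1) it(1) t' XU, of v n] by (simp add: U_def)
  have WT: "W (Suc n) v \<bullet> v \<le> mean_step t X v \<bullet> v" for n v
    using mean_step_mono[OF it(2) bounds(1) Xb t' WX, of n v] by (simp add: W_def)
  have "karcher_integral t X v \<bullet> v = 0" for v
  proof -
    have "\<bar>t * (karcher_integral t X v \<bullet> v)\<bar> \<le> \<epsilon> (Suc n) * (v \<bullet> v)" for n
      using TU[of v n] WT[of n v] XU[of v "Suc n"] WX[of "Suc n" v] gap[of "Suc n" v]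
      by (simp add: mean_step_form abs_le_iff)
    moreover have "(\<lambda>n. \<epsilon> (Suc n) * (v \<bullet> v)) \<longlonglongrightarrow> 0 * (v \<bullet> v)"
      by (intro tendsto_mult tendsto_const LIMSEQ_Suc \<epsilon>)
    ultimately have "\<bar>t * (karcher_integral t X v \<bullet> v)\<bar> \<le> 0 * (v \<bullet> v)"
      by (intro LIMSEQ_le_const) auto
    then show ?thesis using t by simp
  qed
  then have "karcher_integral t X = 0"
    by (intro selfadjoint_eq_zeroI karcher_integral(1)[OF Xb bounds(1) t'])
  with Xb show ?thesis by blast
qed

section \<open>The solution at parameter zero\<close>

text \<open>
  The minimiser for \<open>(u, Y)\<close> is bounded by \<open>H \<parallel>v\<parallel>\<close>; inserted into the formula for \<open>(t, X)\<close> it changes the value by at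
  most the stated amount. The estimate is one-sided, and exchanging the roles gives the other side.
\<close>

lemma karcher_integral_lipschitz:
  assumes X: "form_between \<alpha> \<beta> X" and Y: "form_between \<alpha> \<beta> Y"
    and t: "t \<in> {0..1}" and u: "u \<in> {0..1}"
  defines "H \<equiv> 2 * \<beta> / \<alpha>"
  shows "karcher_integral t X v \<bullet> v \<le> karcher_integral u Y v \<bullet> v +
    (\<bar>t - u\<bar> * (\<beta> * (4 * H + 3 * H\<^sup>2)) + (1 + 2 * H + H\<^sup>2) * norm (Y - X)) * (v \<bullet> v)"
proof -
  have "karcher_integral t X v \<bullet> v \<le> 1 * (karcher_integral u Y v \<bullet> v) +
    (\<bar>t - u\<bar> * (\<beta> * (4 * H + 3 * H\<^sup>2)) + (1 + 2 * H + H\<^sup>2) * norm (Y - X)) * (v \<bullet> v)"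
  proof (rule karcher_integral_le[OF X bounds(1) Y bounds(1) t u])
    fix s :: real and A :: "'a \<Rightarrow>\<^sub>L 'a" assume s: "s \<in> {0..1}" and A: "form_between \<alpha> \<beta> A"
    have b: "0 < \<beta>" using bounds by linarith
    have H: "0 \<le> H" using bounds b by (simp add: H_def)
    define r where "r = shift t s"
    define q where "q = shift u s"
    have r: "r \<in> {0..1}" and q: "q \<in> {0..1}" using shift_unit[OF s] t u by (auto simp: r_def q_def)
    define h where "h = karcher_min q A Y v"
    define D where "D = Y - X"
    have h: "norm h \<le> H * norm v" unfolding h_def H_def by (rule karcher_min_norm[OF A Y bounds(1) q])
    have vh: "norm v * norm h \<le> H * (v \<bullet> v)"
      using mult_left_mono[OF h, of "norm v"] by (simp add: power2_norm_eq_inner[symmetric] power2_eq_square mult_ac)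
    have hh: "(norm h)\<^sup>2 \<le> H\<^sup>2 * (v \<bullet> v)"
      using power_mono[OF h, of 2] by (simp add: power_mult_distrib power2_norm_eq_inner)
    have "karcher_op r A X v \<bullet> v \<le> karcher_form r A X v h"
      by (rule karcher_form_ge[OF A X bounds(1) r])
    also have "\<dots> \<le> karcher_form q A X v h + \<bar>r - q\<bar> * (4 * \<beta> * (norm v * norm h) + 3 * \<beta> * (norm h)\<^sup>2)"
      by (rule karcher_form_change_weight[OF A X bounds(1) _ r q]) (use b in simp)
    also have "\<bar>r - q\<bar> * (4 * \<beta> * (norm v * norm h) + 3 * \<beta> * (norm h)\<^sup>2)
        \<le> \<bar>t - u\<bar> * (4 * \<beta> * (H * (v \<bullet> v)) + 3 * \<beta> * (H\<^sup>2 * (v \<bullet> v)))"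
      unfolding r_def q_def
      by (intro mult_mono add_mono mult_left_mono vh hh shift_diff[OF s] add_nonneg_nonneg mult_nonneg_nonneg)
        (use b in auto)
    finally have 1: "karcher_op r A X v \<bullet> v \<le> karcher_form q A X v h +
        \<bar>t - u\<bar> * (\<beta> * (4 * H + 3 * H\<^sup>2)) * (v \<bullet> v)" by (simp add: algebra_simps)
    have Dxy: "\<bar>D x \<bullet> y\<bar> \<le> norm D * (norm x * norm y)" for x y
    proof -
      have "\<bar>D x \<bullet> y\<bar> \<le> norm (D x) * norm y" by (rule Cauchy_Schwarz_ineq2)
      also have "\<dots> \<le> (norm D * norm x) * norm y" by (intro mult_right_mono norm_blinfun) simp
      finally show ?thesis by (simp add: mult.assoc)
    qed
    have d1: "D v \<bullet> v \<le> norm D * (v \<bullet> v)"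
      using Dxy[of v v] by (simp add: power2_norm_eq_inner[symmetric] power2_eq_square)
    have "\<bar>(1 - q) * (D v \<bullet> h)\<bar> \<le> 1 * (norm D * (norm v * norm h))"
      unfolding abs_mult using q by (intro mult_mono Dxy) auto
    also have "\<dots> \<le> norm D * (H * (v \<bullet> v))" by (simp add: vh mult_left_mono)
    finally have d2: "(1 - q) * (D v \<bullet> h) \<le> norm D * (H * (v \<bullet> v))" by simp
    have "\<bar>(q * (1 - q)) * (D h \<bullet> h)\<bar> \<le> 1 * (norm D * (norm h * norm h))"
      unfolding abs_mult[of "q * (1 - q)"] using q by (intro mult_mono Dxy) (auto simp: mult_le_one)
    also have "\<dots> \<le> norm D * (H\<^sup>2 * (v \<bullet> v))"
      using hh by (simp add: mult_left_mono power2_eq_square)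
    finally have d3: "- (q * (1 - q) * (D h \<bullet> h)) \<le> norm D * (H\<^sup>2 * (v \<bullet> v))" by simp
    have "karcher_form q A X v h \<le> karcher_op q A Y v \<bullet> v + (1 + 2 * H + H\<^sup>2) * norm D * (v \<bullet> v)"
      using karcher_form_change_base[of q A X v h Y, folded D_def] karcher_form_min[OF A Y bounds(1) q, of v]
        d1 d2 d3 by (simp add: h_def[symmetric] algebra_simps)
    then show "karcher_op (shift t s) A X v \<bullet> v \<le> 1 * (karcher_op (shift u s) A Y v \<bullet> v) +
        (\<bar>t - u\<bar> * (\<beta> * (4 * H + 3 * H\<^sup>2)) + (1 + 2 * H + H\<^sup>2) * norm (Y - X)) * (v \<bullet> v)"
      using 1 by (simp add: r_def q_def D_def algebra_simps)
  qed
  then show ?thesis by simp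
qed

text \<open>
  At \<open>t = 0\<close> the step is the identity, so the iteration gives nothing. Instead the solutions for \<open>t = 1 / (n + 1)\<close> form a
  Cauchy sequence by stability, and the integral is continuous along it.
\<close>

lemma solution_exists_zero: "\<exists>X. form_between \<alpha> \<beta> X \<and> karcher_integral 0 X = 0"
proof -
  define \<tau> where "\<tau> n = inverse (real (Suc n))" for n
  have \<tau>: "0 < \<tau> n" "\<tau> n \<le> 1" "\<tau> n \<in> {0..1}" for n by (auto simp: \<tau>_def inverse_le_1_iff)
  have \<tau>lim: "\<tau> \<longlonglongrightarrow> 0" unfolding \<tau>_def by (rule LIMSEQ_inverse_real_of_nat)
  have "\<forall>n. \<exists>X. form_between \<alpha> \<beta> X \<and> karcher_integral (\<tau> n) X = 0"
    using solution_exists_pos \<tau> by blast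
  then obtain X where X: "\<And>n. form_between \<alpha> \<beta> (X n)" "\<And>n. karcher_integral (\<tau> n) (X n) = 0" by metis
  obtain C where C: "0 \<le> C" "\<forall>X Y t u. form_between \<alpha> \<beta> X \<longrightarrow> form_between \<alpha> \<beta> Y \<longrightarrow> t \<in> {0..1} \<longrightarrow> u \<in> {0..1} \<longrightarrow>
      karcher_integral t X = 0 \<longrightarrow> karcher_integral u Y = 0 \<longrightarrow> norm (X - Y) \<le> C * \<bar>t - u\<bar>"
    using solution_lipschitz_in_parameter[OF bounds(1) order_refl order_refl] by blast
  have d: "norm (X m - X n) \<le> C * \<bar>\<tau> m - \<tau> n\<bar>" for m n
    using C(2) X \<tau>(3) by blast
  have "Cauchy \<tau>" using \<tau>lim by (rule LIMSEQ_imp_Cauchy)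
  have "Cauchy X"
  proof (rule metric_CauchyI)
    fix e :: real assume e: "0 < e"
    then have "0 < e / (C + 1)" using C(1) by simp
    from metric_CauchyD[OF \<open>Cauchy \<tau>\<close> this]
    obtain N where N: "\<And>m n. m \<ge> N \<Longrightarrow> n \<ge> N \<Longrightarrow> \<bar>\<tau> m - \<tau> n\<bar> < e / (C + 1)"
      by (auto simp: dist_real_def)
    have "dist (X m) (X n) < e" if "m \<ge> N" "n \<ge> N" for m n
    proof -
      have "dist (X m) (X n) \<le> (C + 1) * \<bar>\<tau> m - \<tau> n\<bar>"
        using d[of m n] by (simp add: dist_norm distrib_right)
      also have "\<dots> < e" using N[OF that] C(1) by (simp add: field_simps)
      finally show ?thesis .
    qed
    then show "\<exists>M. \<forall>m\<ge>M. \<forall>n\<ge>M. dist (X m) (X n) < e" by blast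
  qed
  then obtain Y where Y: "X \<longlonglongrightarrow> Y" using Cauchy_convergent convergent_def by blast
  have Yb: "form_between \<alpha> \<beta> Y" by (rule form_between_limit[OF X(1) Y])
  define H where "H = 2 * \<beta> / \<alpha>"
  define e where "e n = \<tau> n * (\<beta> * (4 * H + 3 * H\<^sup>2)) + (1 + 2 * H + H\<^sup>2) * norm (X n - Y)" for n
  have zero: "0 \<in> {0..1::real}" by simp
  have "(\<lambda>n. norm (X n - Y)) \<longlonglongrightarrow> 0" using Y LIM_zero tendsto_norm_zero by blast
  then have "(\<lambda>n. \<tau> n * (\<beta> * (4 * H + 3 * H\<^sup>2)) + (1 + 2 * H + H\<^sup>2) * norm (X n - Y)) \<longlonglongrightarrow>
      0 * (\<beta> * (4 * H + 3 * H\<^sup>2)) + (1 + 2 * H + H\<^sup>2) * 0"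
    by (intro tendsto_add tendsto_mult tendsto_const \<tau>lim)
  then have e: "e \<longlonglongrightarrow> 0" by (simp add: e_def[abs_def])
  have "karcher_integral 0 Y v \<bullet> v = 0" for v
  proof -
    have "\<bar>karcher_integral 0 Y v \<bullet> v\<bar> \<le> e n * (v \<bullet> v)" for n
      using karcher_integral_lipschitz[OF Yb X(1)[of n] zero \<tau>(3)[of n], of v]
        karcher_integral_lipschitz[OF X(1)[of n] Yb \<tau>(3)[of n] zero, of v] X(2)[of n] \<tau>(1)[of n]
      by (simp add: e_def H_def norm_minus_commute abs_le_iff algebra_simps)
    moreover have "(\<lambda>n. e n * (v \<bullet> v)) \<longlonglongrightarrow> 0 * (v \<bullet> v)"
      by (intro tendsto_mult tendsto_const e)
    ultimately have "\<bar>karcher_integral 0 Y v \<bullet> v\<bar> \<le> 0 * (v \<bullet> v)"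
      by (intro LIMSEQ_le_const) auto
    then show ?thesis by simp
  qed
  then have "karcher_integral 0 Y = 0"
    by (intro selfadjoint_eq_zeroI karcher_integral(1)[OF Yb bounds(1) zero])
  with Yb show ?thesis by blast
qed

lemma solution_exists:
  assumes "t \<in> {0..1}" shows "\<exists>X. form_between \<alpha> \<beta> X \<and> karcher_integral t X = 0"
  using assms solution_exists_pos[of t] solution_exists_zero by (cases "t = 0") auto

section \<open>The lambda mean\<close>

lemma space_form:
  assumes z: "(s, A) \<in> space \<mu>" and X: "X \<in> posdef_ops"
  obtains a b where "0 < a" "form_between a b A" "form_between a b X" "s \<in> {0..1}"
proof -
  have "s \<in> {0..1}" "A \<in> posdef_ops" using z by (auto simp: space_eq)
  moreover obtain a1 b1 where 1: "a1 > 0" "form_between a1 b1 X" using X posdef_iff by blast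
  moreover obtain a2 b2 where 2: "a2 > 0" "form_between a2 b2 A" using calculation(2) posdef_iff by blast
  ultimately show ?thesis
    by (intro that[of "min a1 a2" "max b1 b2"] form_between_mono[OF 1(2)] form_between_mono[OF 2(2)]) auto
qed

lemma posdef_karcher_integral:
  assumes X: "X \<in> posdef_ops" and t: "t \<in> {0..1}"
  shows "karcher_integral t X \<in> selfadjoint_ops"
    and "has_bochner_integral \<mu> (\<lambda>z. karcher_op (shift t (fst z)) (snd z) X x \<bullet> y) (karcher_integral t X x \<bullet> y)"
proof -
  obtain a b where "form_between a b X" "0 < a" using X posdef_iff by blast
  from karcher_integral[OF this t] show "karcher_integral t X \<in> selfadjoint_ops"
    "has_bochner_integral \<mu> (\<lambda>z. karcher_op (shift t (fst z)) (snd z) X x \<bullet> y) (karcher_integral t X x \<bullet> y)" .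
qed

lemma op_mean_pettis_iff:
  assumes X: "X \<in> posdef_ops" and t: "0 < t" "t \<le> 1"
  shows "has_pettis_integral \<mu> (\<lambda>(s, A). op_mean s t X A) X \<longleftrightarrow> karcher_integral t X = 0"
proof -
  have t': "t \<in> {0..1}" using t by simp
  have Xsa: "X \<in> selfadjoint_ops" using X posdef_iff form_between_selfadjoint by blast
  have op: "op_mean (fst z) t X (snd z) x \<bullet> y = X x \<bullet> y + t * (karcher_op (shift t (fst z)) (snd z) X x \<bullet> y)"
    if z: "z \<in> space \<mu>" for z x y
  proof -
    have z': "(fst z, snd z) \<in> space \<mu>" using z by simp
    obtain a b where "0 < a" "form_between a b (snd z)" "form_between a b X" "fst z \<in> {0..1}"
      by (rule space_form[OF z' X])
    then have "op_mean (fst z) t X (snd z) = X + t *\<^sub>R karcher_op (shift t (fst z)) (snd z) X"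
      by (intro op_mean_eq[OF _ _ _ _ t']) auto
    then show ?thesis by (simp add: blinfun.add_left blinfun.scaleR_left inner_add_left)
  qed
  have i: "has_bochner_integral \<mu> (\<lambda>z. op_mean (fst z) t X (snd z) x \<bullet> y) (X x \<bullet> y + t * (karcher_integral t X x \<bullet> y))" for x y
  proof -
    have "has_bochner_integral \<mu> (\<lambda>z. X x \<bullet> y + t * (karcher_op (shift t (fst z)) (snd z) X x \<bullet> y))
        (X x \<bullet> y + t * (karcher_integral t X x \<bullet> y))"
      using has_bochner_integral_add[OF has_bochner_integral_integrable[OF integrable_const[of "X x \<bullet> y"]]
        has_bochner_integral_mult_right[OF posdef_karcher_integral(2)[OF X t', of x y], of t]]
      by (simp add: prob_space)
    then show ?thesis by (rule has_bochner_integral_eq_on_space) (rule op)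
  qed
  have "(\<forall>x y. has_bochner_integral \<mu> (\<lambda>z. op_mean (fst z) t X (snd z) x \<bullet> y) (X x \<bullet> y)) \<longleftrightarrow>
      (\<forall>x y. karcher_integral t X x \<bullet> y = 0)"
  proof (intro iffI allI)
    fix x y assume "\<forall>x y. has_bochner_integral \<mu> (\<lambda>z. op_mean (fst z) t X (snd z) x \<bullet> y) (X x \<bullet> y)"
    then have "X x \<bullet> y = X x \<bullet> y + t * (karcher_integral t X x \<bullet> y)"
      using i[of x y] has_bochner_integral_eq by blast
    then show "karcher_integral t X x \<bullet> y = 0" using t by simp
  next
    fix x y assume "\<forall>x y. karcher_integral t X x \<bullet> y = 0"
    then show "has_bochner_integral \<mu> (\<lambda>z. op_mean (fst z) t X (snd z) x \<bullet> y) (X x \<bullet> y)" using i[of x y] by simp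
  qed
  moreover have "(\<forall>x y. karcher_integral t X x \<bullet> y = 0) \<longleftrightarrow> karcher_integral t X = 0"
    using selfadjoint_eq_zeroI[OF posdef_karcher_integral(1)[OF X t']] by auto
  ultimately show ?thesis using Xsa by (simp add: has_pettis_integral_iff split_beta)
qed

text \<open>
  With \<open>S = X\<^sup>1\<^sup>/\<^sup>2\<close> and \<open>L = \<ell>\<^sub>s(X\<^sup>-\<^sup>1\<^sup>/\<^sup>2 A X\<^sup>-\<^sup>1\<^sup>/\<^sup>2)\<close>, the Karcher operator is \<open>S L S\<close>; as \<open>S\<close> is invertible,
  the weak integrals of \<open>L\<close> and of \<open>S L S\<close> vanish together.
\<close>

lemma karcher_equation_iff:
  assumes X: "X \<in> posdef_ops"
  shows "has_pettis_integral \<mu>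
      (\<lambda>(s, A). fun_calc (ell s) (op_powr X (-1/2) o\<^sub>L A o\<^sub>L op_powr X (-1/2))) 0
    \<longleftrightarrow> karcher_integral 0 X = 0"
proof -
  define S where "S = op_powr X (1/2)"
  define R where "R = op_powr X (-1/2)"
  let ?L = "\<lambda>z. fun_calc (ell (fst z)) (R o\<^sub>L snd z o\<^sub>L R)"
  obtain a b where Xab: "0 < a" "form_between a b X" using X posdef_iff by blast
  note SR = op_powr_half[OF Xab(2,1), folded S_def R_def]
  have SRx: "S (R x) = x" for x
    using SR(4) by (metis blinfun_apply_blinfun_compose blinfun_apply_id_blinfun id_apply)
  have G: "karcher_op (fst z) (snd z) X x = S (?L z (S x))" if z: "z \<in> space \<mu>" for z x
  proof -
    have z': "(fst z, snd z) \<in> space \<mu>" using z by simp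
    obtain a b where "0 < a" "form_between a b (snd z)" "form_between a b X" "fst z \<in> {0..1}"
      by (rule space_form[OF z' X])
    then show ?thesis unfolding S_def R_def by (intro ell_sandwich(1)[symmetric]) auto
  qed
  have zero: "0 \<in> {0..1::real}" by simp
  note i = posdef_karcher_integral(2)[OF X zero, unfolded shift_zero]
  have "(\<forall>x y. has_bochner_integral \<mu> (\<lambda>z. ?L z x \<bullet> y) 0) \<longleftrightarrow> karcher_integral 0 X = 0"
  proof (intro iffI allI)
    assume L: "\<forall>x y. has_bochner_integral \<mu> (\<lambda>z. ?L z x \<bullet> y) 0"
    have "karcher_integral 0 X v \<bullet> v = 0" for v
    proof -
      have "has_bochner_integral \<mu> (\<lambda>z. karcher_op (fst z) (snd z) X v \<bullet> v) 0"
        using L[rule_format, of "S v" "S v"]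
        by (rule has_bochner_integral_eq_on_space)
          (simp_all add: G selfadjoint_inner[OF SR(1)])
      then show ?thesis using i[of v v] has_bochner_integral_eq by blast
    qed
    then show "karcher_integral 0 X = 0"
      by (intro selfadjoint_eq_zeroI posdef_karcher_integral(1)[OF X zero])
  next
    fix x y assume "karcher_integral 0 X = 0"
    then have "has_bochner_integral \<mu> (\<lambda>z. karcher_op (fst z) (snd z) X (R x) \<bullet> R y) 0"
      using i[of "R x" "R y"] by simp
    moreover have "?L z x \<bullet> y = karcher_op (fst z) (snd z) X (R x) \<bullet> R y" if "z \<in> space \<mu>" for z
      by (simp add: G[OF that] SRx selfadjoint_inner[OF SR(1)])
    ultimately show "has_bochner_integral \<mu> (\<lambda>z. ?L z x \<bullet> y) 0"
      by (rule has_bochner_integral_eq_on_space)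
  qed
  then show ?thesis
    by (simp add: has_pettis_integral_iff split_beta selfadjoint_zero S_def R_def)
qed

lemma between_posdef: "form_between \<alpha> \<beta> X \<Longrightarrow> X \<in> posdef_ops"
  using posdef_iff bounds by blast

text \<open>
  Let \<open>X t\<close> be the solution with parameter \<open>t\<close>. It is \<open>L\<^sub>t(\<mu>)\<close> for \<open>t > 0\<close> and the only Karcher solution for \<open>t = 0\<close>,
  and \<open>\<parallel>X t - X 0\<parallel> \<le> C t\<close>. Strong limits are unique because evaluation at a vector is strongly
  continuous.
\<close>

theorem karcher_solutions_eq_lambda_mean: "karcher_solutions \<mu> = {lambda_mean \<mu>}"
proof -
  have "\<forall>t. \<exists>X. t \<in> {0..1} \<longrightarrow> form_between \<alpha> \<beta> X \<and> karcher_integral t X = 0"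
    using solution_exists by blast
  then obtain X where X: "\<And>t. t \<in> {0..1} \<Longrightarrow> form_between \<alpha> \<beta> (X t)"
    "\<And>t. t \<in> {0..1} \<Longrightarrow> karcher_integral t (X t) = 0" by metis
  have zero: "0 \<in> {0..1::real}" by simp
  have Xpd: "X t \<in> posdef_ops" if "t \<in> {0..1}" for t by (rule between_posdef[OF X(1)[OF that]])
  have ks: "karcher_solutions \<mu> = {X 0}"
  proof -
    have "Y \<in> karcher_solutions \<mu> \<longleftrightarrow> Y = X 0" for Y
      using karcher_equation_iff[of Y] solution_unique[OF _ Xpd[OF zero] zero _ X(2)[OF zero], of Y]
        Xpd[OF zero] X(2)[OF zero] unfolding karcher_solutions_def by auto
    then show ?thesis by auto
  qed
  have L: "L_mean t \<mu> = X t" if t: "0 < t" "t \<le> 1" for t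
    unfolding L_mean_def
  proof (rule the_equality)
    have t': "t \<in> {0..1}" using t by simp
    show "X t \<in> posdef_ops \<and> has_pettis_integral \<mu> (\<lambda>(s, A). op_mean s t (X t) A) (X t)"
      using Xpd[OF t'] op_mean_pettis_iff[OF Xpd[OF t'] t] X(2)[OF t'] by blast
    show "Y = X t" if "Y \<in> posdef_ops \<and> has_pettis_integral \<mu> (\<lambda>(s, A). op_mean s t Y A) Y" for Y
      using that op_mean_pettis_iff[of Y t] t solution_unique[OF _ Xpd[OF t'] t' _ X(2)[OF t'], of Y] by blast
  qed
  obtain C where C: "0 \<le> C" "\<forall>X Y t u. form_between \<alpha> \<beta> X \<longrightarrow> form_between \<alpha> \<beta> Y \<longrightarrow> t \<in> {0..1} \<longrightarrow> u \<in> {0..1} \<longrightarrow>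
      karcher_integral t X = 0 \<longrightarrow> karcher_integral u Y = 0 \<longrightarrow> norm (X - Y) \<le> C * \<bar>t - u\<bar>"
    using solution_lipschitz_in_parameter[OF bounds(1) order_refl order_refl] by blast
  have ev: "\<forall>\<^sub>F t in at_right (0::real). 0 < t \<and> t \<le> 1"
    unfolding eventually_at_right_field by (intro exI[of _ 1]) auto
  have lim: "((\<lambda>t. L_mean t \<mu>) \<longlongrightarrow> X 0) (at_right 0)"
  proof -
    have "((\<lambda>t. L_mean t \<mu> - X 0) \<longlongrightarrow> 0) (at_right 0)"
    proof (rule Lim_null_comparison)
      show "\<forall>\<^sub>F t in at_right 0. norm (L_mean t \<mu> - X 0) \<le> C * t"
        using ev
      proof eventually_elim
        case (elim t)
        then have "t \<in> {0..1}" by simp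
        then have "norm (X t - X 0) \<le> C * \<bar>t - 0\<bar>" using C(2) X zero by blast
        then show ?case using elim by (simp add: L)
      qed
      have "((\<lambda>t. C * t) \<longlongrightarrow> C * 0) (at_right (0::real))" by (intro tendsto_intros)
      then show "((\<lambda>t. C * t) \<longlongrightarrow> 0) (at_right (0::real))" by simp
    qed
    then show ?thesis by (simp add: LIM_zero_iff)
  qed
  have "lambda_mean \<mu> = X 0"
    unfolding lambda_mean_def
  proof (rule the_equality)
    have "limitin strong_operator_topology (id \<circ> (\<lambda>t. L_mean t \<mu>)) (id (X 0)) (at_right 0)"
      using lim strong_operator_topology_weaker_than_euclidean
      by (intro continuous_map_limit[of euclidean]) (auto simp: id_def)
    then show "X 0 \<in> posdef_ops \<and> limitin strong_operator_topology (\<lambda>t. L_mean t \<mu>) (X 0) (at_right 0)"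
      using Xpd[OF zero] by (simp add: o_def)
  next
    fix Y assume "Y \<in> posdef_ops \<and> limitin strong_operator_topology (\<lambda>t. L_mean t \<mu>) Y (at_right 0)"
    then have Y: "limitin strong_operator_topology (\<lambda>t. L_mean t \<mu>) Y (at_right 0)" by simp
    show "Y = X 0"
    proof (rule blinfun_eqI)
      fix x
      have "limitin euclidean ((\<lambda>f. blinfun_apply f x) \<circ> (\<lambda>t. L_mean t \<mu>)) (Y x) (at_right 0)"
        by (rule continuous_map_limit[OF strong_operator_topology_continuous_evaluation Y])
      then have "((\<lambda>t. L_mean t \<mu> x) \<longlongrightarrow> Y x) (at_right 0)" by (simp add: o_def)
      moreover have "((\<lambda>t. L_mean t \<mu> x) \<longlongrightarrow> X 0 x) (at_right 0)"
        by (intro blinfun.tendsto lim tendsto_const)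
      ultimately show "Y x = X 0 x" by (rule tendsto_unique[rotated]) simp
    qed
  qed
  with ks show ?thesis by simp
qed

end

text \<open>
  Passing from \<open>r\<close> to \<open>|r|\<close> ensures that the lower bound does not exceed the upper one.
\<close>

lemma bdd_prob_measures_operator_measure:
  fixes \<mu> :: "(real \<times> ('a::complex_hilbert \<Rightarrow>\<^sub>L 'a)) measure"
  assumes \<mu>: "\<mu> \<in> bdd_prob_measures"
  shows "\<exists>\<alpha> \<beta>. operator_measure \<mu> \<alpha> \<beta>"
proof -
  have p: "prob_space \<mu>" and s: "sets \<mu> = sets (restrict_space borel ({0..1} \<times> posdef_ops))"
    and e: "emeasure \<mu> (measure_support \<mu>) = 1"
    using \<mu> by (auto simp: bdd_prob_measures_def)
  obtain r where r: "measure_support \<mu> \<subseteq> {0..1} \<times> {A. exp (- r) *\<^sub>R id_blinfun \<preceq> A \<and> A \<preceq> exp r *\<^sub>R id_blinfun}"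
    using \<mu> by (auto simp: bdd_prob_measures_def)
  interpret prob_space \<mu> by (rule p)
  have m: "measure_support \<mu> \<in> sets \<mu>" using e emeasure_notin_sets by force
  have ae: "AE z in \<mu>. z \<in> measure_support \<mu>"
    using e m by (simp add: AE_in_set_eq_1 emeasure_eq_measure)
  have between: "form_between (exp (- r)) (exp r) (snd z)" if "z \<in> measure_support \<mu>" for z
    using that r op_le_form_between[of "exp (- r)" "snd z" "exp r"] by (auto simp: mem_Times_iff)
  then have AE: "AE z in \<mu>. form_between (exp (- r)) (exp r) (snd z)"
    using ae by (auto elim: eventually_mono)
  have "form_between (exp (- \<bar>r\<bar>)) (exp \<bar>r\<bar>) A" if "form_between (exp (- r)) (exp r) A" for A :: "'a \<Rightarrow>\<^sub>L 'a"
    by (rule form_between_mono[OF that]) auto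
  then have "AE z in \<mu>. form_between (exp (- \<bar>r\<bar>)) (exp \<bar>r\<bar>) (snd z)"
    using AE by (auto elim: eventually_mono)
  then have "operator_measure \<mu> (exp (- \<bar>r\<bar>)) (exp \<bar>r\<bar>)"
    by unfold_locales (use s in auto)
  then show ?thesis by blast
qed

theorem theorem6p13:
  fixes \<mu> :: "(real \<times> ('a::complex_hilbert \<Rightarrow>\<^sub>L 'a)) measure"
  assumes "\<mu> \<in> bdd_prob_measures"
  shows "karcher_solutions \<mu> = {lambda_mean \<mu>}"
  using bdd_prob_measures_operator_measure[OF assms] operator_measure.karcher_solutions_eq_lambda_mean
  by blast

end
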